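(* Let $\phi$ be a nonconstant inner function on $\mathbb{D}^2$ and let $\alpha\in\mathbb{T}$. Assume that $J_\alpha\colon K_\phi\to L^2(\sigma_\alpha)$ is surjective, that $\vartheta^1_\alpha$ is bounded on $\mathbb{D}^2$, and that $\frac{1}{1-\bar\alpha\phi(0,z_2)}\in H^2_2$. Write $K_\phi=S_1^{\max}\oplus S_2^{\min}$. Then $$P_\phi P_{H^2_2}M_{\overline{\vartheta^1_\alpha}}\equiv0\quad\text{on }S_1^{\max}.$$
   Context: $\mathbb{D}$ is the open unit disk, $\mathbb{T}$ the unit circle. $H^2(\mathbb{D}^2)$ is the Hardy space of holomorphic $f=\sum_{k,l\ge0}a_{k,l}z_1^kz_2^l$ on $\mathbb{D}^2$ with $\|f\|^2=\sum|a_{k,l}|^2<\infty$, identified via boundary values with a closed subspace of $L^2=L^2(\mathbb{T}^2)$ (normalized Lebesgue measure). A function $\phi$ is inner on $\mathbb{D}^2$ if it is bounded and holomorphic on $\mathbb{D}^2$ with non-tangential boundary values of modulus $1$ a.e. on $\mathbb{T}^2$. The model space is $K_\phi=H^2(\mathbb{D}^2)\ominus\phi H^2(\mathbb{D}^2)$; $P_\phi\colon H^2(\mathbb{D}^2)\to K_\phi$ is the orthogonal projection. $S_1^{\max}$ is the largest (closed) subspace of $K_\phi$ invariant under the shift $T_1f=z_1f$, and $S_2^{\min}=K_\phi\ominus S_1^{\max}$ (which is known to be invariant under $T_2f=z_2f$). $k_w(z)=\frac{1}{(1-z_1\bar w_1)(1-z_2\bar w_2)}$, and $k_w^\phi(z)=\frac{1-\phi(z)\overline{\phi(w)}}{(1-z_1\bar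 w_1)(1-z_2\bar w_2)}$ is the reproducing kernel of $K_\phi$. Clark measure: for $\alpha\in\mathbb{T}$, $\sigma_\alpha$ is the positive Borel measure on $\mathbb{T}^2$ with $\frac{1-|\phi(z)|^2}{|\alpha-\phi(z)|^2}=\int_{\mathbb{T}^2}P_{z_1}(\zeta_1)P_{z_2}(\zeta_2)\,d\sigma_\alpha(\zeta)$ for all $z\in\mathbb{D}^2$, where $P_{z_j}(\zeta_j)=\frac{1-|z_j|^2}{|\zeta_j-z_j|^2}$. Clark embedding: $J_\alpha\colon K_\phi\to L^2(\sigma_\alpha)$ is the linear isometry (known to exist, not necessarily surjective) determined by $J_\alpha k_w^\phi=(1-\alpha\overline{\phi(w)})\,k_w$ for all $w\in\mathbb{D}^2$. With $(B_1f)(z)=\frac{f(z)-f(0,z_2)}{z_1}$, the holomorphic function $\vartheta^1_\alpha$ on $\mathbb{D}^2$ is $\vartheta^1_\alpha(z)=\bar\alpha\,\frac{(B_1\phi)(z)}{1-\bar\alpha\phi(0,z_2)}$. When it is bounded, $M_{\overline{\vartheta^1_\alpha}}$ is multiplication on $L^2(\mathbb{T}^2)$ by the complex conjugate of (the boundary values of) $\vartheta^1_\alpha$. $H^2_2\subset H^2(\mathbb{D}^2)$ is the one-variable Hardy space $H^2(\mathbb{D})$ in the variable $z_2$, and $P_{H^2_2}$ is the orthogonal projection of $L^2(\mathbb{T}^2)$ onto $H^2_2$. *)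

theory Defs
  imports "HOL-Analysis.Analysis"
begin

section \<open>The bidisk and the torus\<close>

definition bidisk :: "(complex \<times> complex) set" where
  "bidisk = ball 0 1 \<times> ball 0 1"

definition torus :: "(complex \<times> complex) set" where
  "torus = sphere 0 1 \<times> sphere 0 1"

definition circle_measure :: "complex measure" where
  "circle_measure = distr (uniform_measure lborel {0..<2 * pi}) (restrict_space borel (sphere 0 1)) cis"

definition torus_measure :: "(complex \<times> complex) measure" where
  "torus_measure = circle_measure \<Otimes>\<^sub>M circle_measure"

text \<open>A continuous real derivative that is complex linear, i.e. complex
  Frechet differentiability at every point of the (open) bidisk.\<close>

definition holomorphic_bidisk :: "(complex \<times> complex \<Rightarrow> complex) \<Rightarrow> bool" where
  "holomorphic_bidisk f \<longleftrightarrow>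
     (\<forall>z\<in>bidisk. \<exists>a b. (f has_derivative (\<lambda>h. a * fst h + b * snd h)) (at z))"

text \<open>Functions on the bidisk are represented by functions that vanish outside
  it, so that equality of functions is equality on the bidisk.\<close>

definition on_bidisk :: "(complex \<times> complex \<Rightarrow> complex) \<Rightarrow> complex \<times> complex \<Rightarrow> complex" where
  "on_bidisk f = (\<lambda>z. if z \<in> bidisk then f z else 0)"


section \<open>Square-integrable functions\<close>

text \<open>Elements of \<open>L2 M\<close> are functions, not classes; identities between them are
  stated almost everywhere.\<close>

definition L2 :: "'a measure \<Rightarrow> ('a \<Rightarrow> complex) set" where
  "L2 M = {F \<in> borel_measurable M. integrable M (\<lambda>x. (cmod (F x))\<^sup>2)}"

definition L2_inner :: "'a measure \<Rightarrow> ('a \<Rightarrow> complex) \<Rightarrow> ('a \<Rightarrow> complex) \<Rightarrow> complex" where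
  "L2_inner M F G = (\<integral>x. F x * cnj (G x) \<partial>M)"

definition L2_norm :: "'a measure \<Rightarrow> ('a \<Rightarrow> complex) \<Rightarrow> real" where
  "L2_norm M F = sqrt (\<integral>x. (cmod (F x))\<^sup>2 \<partial>M)"


section \<open>Non-tangential boundary values\<close>

definition stolz :: "real \<Rightarrow> complex \<Rightarrow> complex set" where
  "stolz c \<zeta> = {z \<in> ball 0 1. cmod (\<zeta> - z) < c * (1 - cmod z)}"

definition nt_limit :: "(complex \<times> complex \<Rightarrow> complex) \<Rightarrow> complex \<times> complex \<Rightarrow> complex \<Rightarrow> bool" where
  "nt_limit f \<zeta> l \<longleftrightarrow>
     (\<forall>c>1. (f \<longlongrightarrow> l) (at \<zeta> within stolz c (fst \<zeta>) \<times> stolz c (snd \<zeta>)))"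

text \<open>\<open>F\<close> represents the class of boundary functions of \<open>f\<close>. For \<open>f\<close> in the Hardy space,
  and for bounded holomorphic \<open>f\<close>, such an \<open>F\<close> exists (Fatou), is unique almost
  everywhere and belongs to \<open>L2 torus_measure\<close>.\<close>

definition boundary_values ::
    "(complex \<times> complex \<Rightarrow> complex) \<Rightarrow> (complex \<times> complex \<Rightarrow> complex) \<Rightarrow> bool" where
  "boundary_values f F \<longleftrightarrow>
     F \<in> borel_measurable torus_measure \<and> (AE \<zeta> in torus_measure. nt_limit f \<zeta> (F \<zeta>))"

definition inner_function :: "(complex \<times> complex \<Rightarrow> complex) \<Rightarrow> bool" where
  "inner_function \<phi> \<longleftrightarrow>
     holomorphic_bidisk \<phi> \<and> bounded (\<phi> ` bidisk) \<and>
     (AE \<zeta> in torus_measure. \<exists>l. nt_limit \<phi> \<zeta> l \<and> cmod l = 1)"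


section \<open>The Hardy space of the bidisk\<close>

definition has_taylor ::
    "(complex \<times> complex \<Rightarrow> complex) \<Rightarrow> (nat \<times> nat \<Rightarrow> complex) \<Rightarrow> bool" where
  "has_taylor f a \<longleftrightarrow>
     (\<forall>z\<in>bidisk. ((\<lambda>(k, l). a (k, l) * fst z ^ k * snd z ^ l) has_sum f z) UNIV)"

definition taylor :: "(complex \<times> complex \<Rightarrow> complex) \<Rightarrow> nat \<times> nat \<Rightarrow> complex" where
  "taylor f = (THE a. has_taylor f a)"

definition H2 :: "(complex \<times> complex \<Rightarrow> complex) set" where
  "H2 = {f. (\<forall>z. z \<notin> bidisk \<longrightarrow> f z = 0) \<and>
            (\<exists>a. has_taylor f a \<and> (\<lambda>p. (cmod (a p))\<^sup>2) summable_on UNIV)}"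

definition H2_inner ::
    "(complex \<times> complex \<Rightarrow> complex) \<Rightarrow> (complex \<times> complex \<Rightarrow> complex) \<Rightarrow> complex" where
  "H2_inner f g = (\<Sum>\<^sub>\<infinity>p\<in>UNIV. taylor f p * cnj (taylor g p))"

definition H2_norm :: "(complex \<times> complex \<Rightarrow> complex) \<Rightarrow> real" where
  "H2_norm f = sqrt (\<Sum>\<^sub>\<infinity>p\<in>UNIV. (cmod (taylor f p))\<^sup>2)"

definition closed_subspace :: "(complex \<times> complex \<Rightarrow> complex) set \<Rightarrow> bool" where
  "closed_subspace M \<longleftrightarrow>
     M \<subseteq> H2 \<and> (\<lambda>z. 0) \<in> M \<and>
     (\<forall>f\<in>M. \<forall>g\<in>M. (\<lambda>z. f z + g z) \<in> M) \<and>
     (\<forall>c. \<forall>f\<in>M. (\<lambda>z. c * f z) \<in> M) \<and>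
     (\<forall>s. \<forall>f\<in>H2. (\<forall>n. s n \<in> M) \<longrightarrow>
        (\<lambda>n::nat. H2_norm (\<lambda>z. s n z - f z)) \<longlonglongrightarrow> 0 \<longrightarrow> f \<in> M)"

text \<open>The one-variable Hardy space in the variable \<open>z\<^sub>2\<close>.\<close>

definition H2_2 :: "(complex \<times> complex \<Rightarrow> complex) set" where
  "H2_2 = {f \<in> H2. \<exists>g. \<forall>z\<in>bidisk. f z = g (snd z)}"

text \<open>Orthogonal projection of \<open>L2 torus_measure\<close> onto \<open>H2_2\<close>, where \<open>H2_2\<close> is embedded
  isometrically by boundary values: the inner product on the torus of the boundary
  functions of \<open>h\<close> and \<open>u\<close> is \<open>H2_inner h u\<close>, so the condition
  says that \<open>G\<close> minus the boundary function of \<open>h\<close> is orthogonal to \<open>H2_2\<close>.\<close>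

definition proj_H2_2 :: "(complex \<times> complex \<Rightarrow> complex) \<Rightarrow> complex \<times> complex \<Rightarrow> complex" where
  "proj_H2_2 G = (THE h. h \<in> H2_2 \<and>
     (\<forall>u\<in>H2_2. \<forall>U. boundary_values u U \<longrightarrow> L2_inner torus_measure G U = H2_inner h u))"


section \<open>The model space\<close>

definition model_space :: "(complex \<times> complex \<Rightarrow> complex) \<Rightarrow> (complex \<times> complex \<Rightarrow> complex) set" where
  "model_space \<phi> = {f \<in> H2. \<forall>g\<in>H2. H2_inner f (\<lambda>z. \<phi> z * g z) = 0}"

definition proj_model ::
    "(complex \<times> complex \<Rightarrow> complex) \<Rightarrow> (complex \<times> complex \<Rightarrow> complex) \<Rightarrow> complex \<times> complex \<Rightarrow> complex" where
  "proj_model \<phi> h = (THE k. k \<in> model_space \<phi> \<and>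
     (\<forall>u\<in>model_space \<phi>. H2_inner (\<lambda>z. h z - k z) u = 0))"

definition shift1 :: "(complex \<times> complex \<Rightarrow> complex) \<Rightarrow> complex \<times> complex \<Rightarrow> complex" where
  "shift1 f = (\<lambda>z. fst z * f z)"

definition S1_max :: "(complex \<times> complex \<Rightarrow> complex) \<Rightarrow> (complex \<times> complex \<Rightarrow> complex) set" where
  "S1_max \<phi> = (GREATEST M. closed_subspace M \<and> M \<subseteq> model_space \<phi> \<and> shift1 ` M \<subseteq> M)"

definition szego_kernel :: "complex \<times> complex \<Rightarrow> complex \<times> complex \<Rightarrow> complex" where
  "szego_kernel w z = 1 / ((1 - fst z * cnj (fst w)) * (1 - snd z * cnj (snd w)))"

definition model_kernel ::
    "(complex \<times> complex \<Rightarrow> complex) \<Rightarrow> complex \<times> complex \<Rightarrow> complex \<times> complex \<Rightarrow> complex" where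
  "model_kernel \<phi> w = on_bidisk (\<lambda>z. (1 - \<phi> z * cnj (\<phi> w)) /
     ((1 - fst z * cnj (fst w)) * (1 - snd z * cnj (snd w))))"


section \<open>Clark measures and Clark embeddings\<close>

definition poisson :: "complex \<Rightarrow> complex \<Rightarrow> real" where
  "poisson z \<zeta> = (1 - (cmod z)\<^sup>2) / (cmod (\<zeta> - z))\<^sup>2"

definition clark_measure ::
    "(complex \<times> complex \<Rightarrow> complex) \<Rightarrow> complex \<Rightarrow> (complex \<times> complex) measure \<Rightarrow> bool" where
  "clark_measure \<phi> \<alpha> \<sigma> \<longleftrightarrow>
     sets \<sigma> = sets (restrict_space borel torus) \<and>
     (\<forall>z\<in>bidisk. (\<integral>\<^sup>+\<zeta>. ennreal (poisson (fst z) (fst \<zeta>) * poisson (snd z) (snd \<zeta>)) \<partial>\<sigma>) =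
        ennreal ((1 - (cmod (\<phi> z))\<^sup>2) / (cmod (\<alpha> - \<phi> z))\<^sup>2))"

definition clark_embedding ::
    "(complex \<times> complex \<Rightarrow> complex) \<Rightarrow> complex \<Rightarrow> (complex \<times> complex) measure \<Rightarrow>
     ((complex \<times> complex \<Rightarrow> complex) \<Rightarrow> complex \<times> complex \<Rightarrow> complex) \<Rightarrow> bool" where
  "clark_embedding \<phi> \<alpha> \<sigma> J \<longleftrightarrow>
     (\<forall>f\<in>model_space \<phi>. J f \<in> L2 \<sigma>) \<and>
     (\<forall>f\<in>model_space \<phi>. \<forall>g\<in>model_space \<phi>. AE \<zeta> in \<sigma>. J (\<lambda>z. f z + g z) \<zeta> = J f \<zeta> + J g \<zeta>) \<and>
     (\<forall>c. \<forall>f\<in>model_space \<phi>. AE \<zeta> in \<sigma>. J (\<lambda>z. c * f z) \<zeta> = c * J f \<zeta>) \<and>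
     (\<forall>f\<in>model_space \<phi>. L2_norm \<sigma> (J f) = H2_norm f) \<and>
     (\<forall>w\<in>bidisk. AE \<zeta> in \<sigma>. J (model_kernel \<phi> w) \<zeta> = (1 - \<alpha> * cnj (\<phi> w)) * szego_kernel w \<zeta>)"

definition clark_surjective ::
    "(complex \<times> complex \<Rightarrow> complex) \<Rightarrow> (complex \<times> complex) measure \<Rightarrow>
     ((complex \<times> complex \<Rightarrow> complex) \<Rightarrow> complex \<times> complex \<Rightarrow> complex) \<Rightarrow> bool" where
  "clark_surjective \<phi> \<sigma> J \<longleftrightarrow> (\<forall>G\<in>L2 \<sigma>. \<exists>f\<in>model_space \<phi>. AE \<zeta> in \<sigma>. J f \<zeta> = G \<zeta>)"

text \<open>At \<open>z\<^sub>1 = 0\<close> the difference quotient is continued by its limit.\<close>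

definition backward_shift1 :: "(complex \<times> complex \<Rightarrow> complex) \<Rightarrow> complex \<times> complex \<Rightarrow> complex" where
  "backward_shift1 f = (\<lambda>z. if fst z = 0 then deriv (\<lambda>w. f (w, snd z)) 0
                            else (f z - f (0, snd z)) / fst z)"

definition theta1 :: "(complex \<times> complex \<Rightarrow> complex) \<Rightarrow> complex \<Rightarrow> complex \<times> complex \<Rightarrow> complex" where
  "theta1 \<phi> \<alpha> = (\<lambda>z. cnj \<alpha> * (backward_shift1 \<phi> z / (1 - cnj \<alpha> * \<phi> (0, snd z))))"

end

theory Submission
  imports Defs "HOL-Complex_Analysis.Cauchy_Integral_Formula"
begin

text \<open>Let \<open>J\<close> be the Clark embedding. For \<open>g\<close> in the model space let \<open>V g\<close> be the element with
  \<open>J (V g)\<close> equal to \<open>J g\<close> times the conjugate of the first coordinate; it exists because \<open>J\<close> is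
  surjective, and \<open>V\<close> is isometric because \<open>J\<close> is. Since \<open>J\<close> is known on the reproducing
  kernels, \<open>V\<close> can be computed: \<open>V g = B\<^sub>1 g + \<theta> \<cdot> g(0, \<cdot>)\<close>, and hence \<open>V (z\<^sub>1 f) = f\<close>
  whenever \<open>f\<close> and \<open>z\<^sub>1 f\<close> lie in the model space. If \<open>p\<close> is the projection of the conjugate of
  \<open>\<theta>\<close> times \<open>f\<close>, then for all \<open>g\<close> in the model space
  \<open>\<langle>p, g\<rangle> = \<langle>f, \<theta> \<cdot> g(0, \<cdot>)\<rangle> = \<langle>f, V g\<rangle> - \<langle>f, B\<^sub>1 g\<rangle> = \<langle>V (z\<^sub>1 f), V g\<rangle> - \<langle>z\<^sub>1 f, g\<rangle> = 0\<close>.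

  Existence of boundary values (Fatou's theorem) is never needed: the functions \<open>f(r \<zeta>)\<close> are
  Cauchy in \<open>L\<^sup>2\<close> of the torus as \<open>r\<close> tends to 1, so a boundary function, where one is given, is
  their \<open>L\<^sup>2\<close>-limit.\<close>


section \<open>Square-integrable functions\<close>

text \<open>The formula for V comes from one identity on the torus: the Szego kernel at w,
  multiplied by \<zeta>1 and the conjugate of w1, is the difference of the kernels at w and at (0,
  w2). Pairing with \<open>J g\<close> therefore produces only the values of g at these two points.
  The product of \<theta> and g(0, .) is recognised as a member of \<open>H2\<close> through V g -
  B1 g, because V g is an element of the model space by construction. Identities involving \<theta>
  are used on tori of radius r < 1, where they hold pointwise and the first coordinate never
  vanishes; only then does r tend to 1. The first equality of the chain holds because p has
  frequencies in z2 alone, so that g can be replaced by g(0, .) in the pairing. Inner products of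
  Hardy functions are sums over coefficients, those of boundary functions are integrals. Both are
  instances of \<open>L2 M\<close>, with counting measure or torus measure for \<open>M\<close>, and
  Parseval's identity on the smaller tori connects them.\<close>

lemma borel_measurable_cnj [measurable (raw)]:
  "f \<in> borel_measurable M \<Longrightarrow> (\<lambda>x. cnj (f x)) \<in> borel_measurable M"
  by (rule borel_measurable_continuous_on[where f = cnj]) (auto intro: continuous_intros)

lemma L2_I: "F \<in> borel_measurable M \<Longrightarrow> integrable M (\<lambda>x. (cmod (F x))\<^sup>2) \<Longrightarrow> F \<in> L2 M"
  by (simp add: L2_def)

lemma L2_measurable: "F \<in> L2 M \<Longrightarrow> F \<in> borel_measurable M"
  and L2_integrable_square: "F \<in> L2 M \<Longrightarrow> integrable M (\<lambda>x. (cmod (F x))\<^sup>2)"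
  by (simp_all add: L2_def)

lemma L2_integrable_prod:
  assumes "F \<in> L2 M" "G \<in> L2 M"
  shows "integrable M (\<lambda>x. F x * cnj (G x))"
proof (rule Bochner_Integration.integrable_bound)
  show "integrable M (\<lambda>x. (cmod (F x))\<^sup>2 + (cmod (G x))\<^sup>2)"
    using assms by (intro Bochner_Integration.integrable_add L2_integrable_square)
  show "(\<lambda>x. F x * cnj (G x)) \<in> borel_measurable M"
    using assms[THEN L2_measurable] by (intro borel_measurable_times borel_measurable_cnj)
  have "cmod a * cmod b \<le> (cmod a)\<^sup>2 + (cmod b)\<^sup>2" for a b
    using sum_squares_bound[of "cmod a" "cmod b"] mult_nonneg_nonneg[OF norm_ge_zero norm_ge_zero, of a b]
    by linarith
  then show "AE x in M. norm (F x * cnj (G x)) \<le> norm ((cmod (F x))\<^sup>2 + (cmod (G x))\<^sup>2)"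
    by (simp add: norm_mult)
qed

text \<open>The bound is only asked for almost everywhere because boundary functions satisfy it only
  there; with counting measure the same lemma covers the weights r^k on Taylor coefficients.\<close>

lemma L2_mult_bounded:
  assumes "F \<in> L2 M" "m \<in> borel_measurable M" "AE x in M. cmod (m x) \<le> C" "C \<ge> 0"
  shows "(\<lambda>x. m x * F x) \<in> L2 M" "L2_norm M (\<lambda>x. m x * F x) \<le> C * L2_norm M F"
proof -
  note [measurable] = assms(2) L2_measurable[OF assms(1)]
  have le: "AE x in M. (cmod (m x * F x))\<^sup>2 \<le> C\<^sup>2 * (cmod (F x))\<^sup>2"
    using assms(3)
    by eventually_elim (auto simp: norm_mult power_mult_distrib intro!: mult_right_mono power_mono)
  have int: "integrable M (\<lambda>x. C\<^sup>2 * (cmod (F x))\<^sup>2)"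
    using L2_integrable_square[OF assms(1)] by simp
  have int': "integrable M (\<lambda>x. (cmod (m x * F x))\<^sup>2)"
    by (rule Bochner_Integration.integrable_bound[OF int]) (use le in auto)
  then show "(\<lambda>x. m x * F x) \<in> L2 M" by (intro L2_I) auto
  have "L2_norm M (\<lambda>x. m x * F x) \<le> sqrt (\<integral>x. C\<^sup>2 * (cmod (F x))\<^sup>2 \<partial>M)"
    unfolding L2_norm_def by (intro real_sqrt_le_mono integral_mono_AE int int' le)
  also have "\<dots> = C * L2_norm M F"
    using assms(4) by (simp add: L2_norm_def real_sqrt_mult)
  finally show "L2_norm M (\<lambda>x. m x * F x) \<le> C * L2_norm M F" .
qed

lemma L2_scale: "F \<in> L2 M \<Longrightarrow> (\<lambda>x. c * F x) \<in> L2 M"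
  using L2_mult_bounded(1)[of F M "\<lambda>_. c" "cmod c"] by simp

lemma L2_add:
  assumes "F \<in> L2 M" "G \<in> L2 M"
  shows "(\<lambda>x. F x + G x) \<in> L2 M"
proof (rule L2_I)
  note [measurable] = assms[THEN L2_measurable]
  show "(\<lambda>x. F x + G x) \<in> borel_measurable M" by measurable
  have le: "(cmod (a + b))\<^sup>2 \<le> 2 * (cmod a)\<^sup>2 + 2 * (cmod b)\<^sup>2" for a b
  proof -
    have "(cmod (a + b))\<^sup>2 \<le> (cmod a + cmod b)\<^sup>2" by (simp add: norm_triangle_ineq power_mono)
    also have "\<dots> \<le> 2 * (cmod a)\<^sup>2 + 2 * (cmod b)\<^sup>2"
      using sum_squares_bound[of "cmod a" "cmod b"] by (simp add: power2_sum)
    finally show ?thesis .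
  qed
  show "integrable M (\<lambda>x. (cmod (F x + G x))\<^sup>2)"
  proof (rule Bochner_Integration.integrable_bound)
    show "integrable M (\<lambda>x. 2 * (cmod (F x))\<^sup>2 + 2 * (cmod (G x))\<^sup>2)"
      using assms[THEN L2_integrable_square] by simp
    show "AE x in M. norm ((cmod (F x + G x))\<^sup>2) \<le> norm (2 * (cmod (F x))\<^sup>2 + 2 * (cmod (G x))\<^sup>2)"
      by (rule AE_I2) (simp add: le)
  qed measurable
qed

lemma L2_diff: "F \<in> L2 M \<Longrightarrow> G \<in> L2 M \<Longrightarrow> (\<lambda>x. F x - G x) \<in> L2 M"
  by (drule L2_scale[where c = "-1"]) (drule (1) L2_add, simp)

lemma L2_inner_add_left:
  "F \<in> L2 M \<Longrightarrow> G \<in> L2 M \<Longrightarrow> K \<in> L2 M \<Longrightarrow>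
    L2_inner M (\<lambda>x. F x + G x) K = L2_inner M F K + L2_inner M G K"
  unfolding L2_inner_def by (simp add: distrib_right L2_integrable_prod)

lemma L2_inner_diff_left:
  "F \<in> L2 M \<Longrightarrow> G \<in> L2 M \<Longrightarrow> K \<in> L2 M \<Longrightarrow>
    L2_inner M (\<lambda>x. F x - G x) K = L2_inner M F K - L2_inner M G K"
  unfolding L2_inner_def by (simp add: left_diff_distrib L2_integrable_prod)

lemma L2_inner_scale_left: "L2_inner M (\<lambda>x. c * F x) K = c * L2_inner M F K"
  unfolding L2_inner_def by (simp add: mult.assoc)

lemma L2_inner_commute: "L2_inner M F G = cnj (L2_inner M G F)"
proof -
  have "cnj (L2_inner M G F) = (\<integral>x. cnj (G x * cnj (F x)) \<partial>M)"
    unfolding L2_inner_def by (simp only: Bochner_Integration.integral_cnj)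
  then show ?thesis by (simp add: L2_inner_def mult.commute)
qed

lemma L2_inner_diff_right:
  "F \<in> L2 M \<Longrightarrow> G \<in> L2 M \<Longrightarrow> K \<in> L2 M \<Longrightarrow>
    L2_inner M K (\<lambda>x. F x - G x) = L2_inner M K F - L2_inner M K G"
  by (subst (1 2 3) L2_inner_commute) (simp add: L2_inner_diff_left)

lemma L2_inner_add_right:
  "F \<in> L2 M \<Longrightarrow> G \<in> L2 M \<Longrightarrow> K \<in> L2 M \<Longrightarrow>
    L2_inner M K (\<lambda>x. F x + G x) = L2_inner M K F + L2_inner M K G"
  by (subst (1 2 3) L2_inner_commute) (simp add: L2_inner_add_left)

lemma L2_inner_scale_right: "L2_inner M K (\<lambda>x. c * F x) = cnj c * L2_inner M K F"
  by (subst (1 2) L2_inner_commute) (simp add: L2_inner_scale_left)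

lemma L2_inner_cong_AE:
  assumes "AE x in M. F x = F' x" "AE x in M. G x = G' x"
    and "F \<in> L2 M" "F' \<in> L2 M" "G \<in> L2 M" "G' \<in> L2 M"
  shows "L2_inner M F G = L2_inner M F' G'"
  unfolding L2_inner_def
proof (rule integral_cong_AE)
  show "AE x in M. F x * cnj (G x) = F' x * cnj (G' x)"
    using assms(1,2) by eventually_elim simp
qed (use assms(3-6)[THEN L2_measurable] in \<open>auto intro!: borel_measurable_times borel_measurable_cnj\<close>)

lemma L2_norm_nonneg: "L2_norm M F \<ge> 0"
  by (simp add: L2_norm_def)

lemma L2_norm_square: "(L2_norm M F)\<^sup>2 = (\<integral>x. (cmod (F x))\<^sup>2 \<partial>M)"
  by (simp add: L2_norm_def)

lemma L2_inner_self: "L2_inner M F F = of_real ((L2_norm M F)\<^sup>2)"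
  by (simp add: L2_norm_square L2_inner_def complex_norm_square[symmetric] flip: of_real_power)

lemma L2_norm_cong_AE:
  assumes "AE x in M. F x = G x" "F \<in> L2 M" "G \<in> L2 M"
  shows "L2_norm M F = L2_norm M G"
  using L2_inner_cong_AE[OF assms(1,1) assms(2,3,2,3)]
  by (simp add: L2_inner_self L2_norm_nonneg flip: of_real_power)

lemma L2_norm_add_square:
  assumes "F \<in> L2 M" "G \<in> L2 M"
  shows "(L2_norm M (\<lambda>x. F x + G x))\<^sup>2 = (L2_norm M F)\<^sup>2 + (L2_norm M G)\<^sup>2 + 2 * Re (L2_inner M F G)"
proof -
  have "L2_inner M (\<lambda>x. F x + G x) (\<lambda>x. F x + G x) =
      L2_inner M F F + L2_inner M G G + (L2_inner M F G + L2_inner M G F)"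
    using assms L2_add[OF assms]
    by (simp add: L2_inner_add_left L2_inner_add_right)
  moreover have "L2_inner M F G + L2_inner M G F = of_real (2 * Re (L2_inner M F G))"
    by (subst (2) L2_inner_commute) (simp add: complex_eq_iff)
  ultimately show ?thesis
    by (simp only: L2_inner_self of_real_add[symmetric] of_real_eq_iff)
qed

lemma L2_norm_scale: "L2_norm M (\<lambda>x. c * F x) = cmod c * L2_norm M F"
  by (simp add: L2_norm_def norm_mult power_mult_distrib real_sqrt_mult)

lemma L2_norm_eq_0_iff:
  assumes "F \<in> L2 M"
  shows "L2_norm M F = 0 \<longleftrightarrow> (AE x in M. F x = 0)"
  using integral_nonneg_eq_0_iff_AE[OF L2_integrable_square[OF assms]]
  by (simp add: L2_norm_def)

lemma L2_Cauchy_Schwarz: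
  assumes "F \<in> L2 M" "G \<in> L2 M"
  shows "cmod (L2_inner M F G) \<le> L2_norm M F * L2_norm M G"
proof (cases "L2_norm M G = 0")
  case True
  then have "AE x in M. G x = 0" using L2_norm_eq_0_iff assms by blast
  then have "L2_inner M F G = L2_inner M F (\<lambda>x. 0 * G x)"
    using assms by (intro L2_inner_cong_AE) (auto dest: L2_scale[where c = 0])
  then show ?thesis using True by (simp add: L2_inner_def)
next
  case False
  then have pos: "L2_norm M G > 0" using L2_norm_nonneg[of M G] by simp
  define i where "i = L2_inner M F G"
  \<comment> \<open>This \<open>c\<close> minimises the norm of \<open>F + c * G\<close>; that the
    minimum is nonnegative is the inequality.\<close>
  define c where "c = - i / of_real ((L2_norm M G)\<^sup>2)"
  have "0 \<le> (L2_norm M (\<lambda>x. F x + c * G x))\<^sup>2" by simp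
  also have "\<dots> = (L2_norm M F)\<^sup>2 + (cmod c * L2_norm M G)\<^sup>2 + 2 * Re (cnj c * i)"
    using assms by (simp add: L2_norm_add_square L2_scale L2_norm_scale L2_inner_scale_right i_def)
  also have "cmod c * L2_norm M G = cmod i / L2_norm M G"
    using pos by (simp add: c_def norm_divide power2_eq_square norm_mult)
  also have "cnj c * i = of_real (- ((cmod i)\<^sup>2 / (L2_norm M G)\<^sup>2))"
    using complex_norm_square[of i] by (simp add: c_def mult.commute)
  finally have "(cmod i)\<^sup>2 / (L2_norm M G)\<^sup>2 \<le> (L2_norm M F)\<^sup>2"
    by (simp add: power_divide)
  then have "(cmod i)\<^sup>2 \<le> (L2_norm M F * L2_norm M G)\<^sup>2"
    using pos by (simp add: divide_le_eq power_mult_distrib)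
  then show ?thesis
    unfolding i_def by (rule power2_le_imp_le) (simp add: L2_norm_nonneg)
qed

lemma L2_norm_triangle:
  assumes "F \<in> L2 M" "G \<in> L2 M"
  shows "L2_norm M (\<lambda>x. F x + G x) \<le> L2_norm M F + L2_norm M G"
proof (rule power2_le_imp_le)
  have "Re (L2_inner M F G) \<le> L2_norm M F * L2_norm M G"
    using L2_Cauchy_Schwarz[OF assms] complex_Re_le_cmod order_trans by blast
  then show "(L2_norm M (\<lambda>x. F x + G x))\<^sup>2 \<le> (L2_norm M F + L2_norm M G)\<^sup>2"
    using assms by (simp add: L2_norm_add_square power2_sum)
qed (simp add: L2_norm_nonneg)

lemma L2_norm_minus_commute: "L2_norm M (\<lambda>x. F x - G x) = L2_norm M (\<lambda>x. G x - F x)"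
  by (simp add: L2_norm_def norm_minus_commute)

lemma L2_inner_tendsto_left:
  assumes F: "\<And>n. F n \<in> L2 M" "F' \<in> L2 M" and "G \<in> L2 M"
    and lim: "(\<lambda>n. L2_norm M (\<lambda>x. F n x - F' x)) \<longlonglongrightarrow> 0"
  shows "(\<lambda>n. L2_inner M (F n) G) \<longlonglongrightarrow> L2_inner M F' G"
proof (rule LIM_zero_cancel, rule Lim_null_comparison)
  show "\<forall>\<^sub>F n in sequentially. norm (L2_inner M (F n) G - L2_inner M F' G)
      \<le> L2_norm M (\<lambda>x. F n x - F' x) * L2_norm M G"
    using assms by (intro always_eventually allI)
      (simp add: L2_Cauchy_Schwarz L2_diff flip: L2_inner_diff_left)
  show "(\<lambda>n. L2_norm M (\<lambda>x. F n x - F' x) * L2_norm M G) \<longlonglongrightarrow> 0"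
    using tendsto_mult_right[OF lim, of "L2_norm M G"] by simp
qed

lemma L2_inner_tendsto_right:
  assumes "\<And>n. F n \<in> L2 M" "F' \<in> L2 M" and "G \<in> L2 M"
    and "(\<lambda>n. L2_norm M (\<lambda>x. F n x - F' x)) \<longlonglongrightarrow> 0"
  shows "(\<lambda>n. L2_inner M G (F n)) \<longlonglongrightarrow> L2_inner M G F'"
  using tendsto_cnj[OF L2_inner_tendsto_left[OF assms]] by (simp flip: L2_inner_commute)

section \<open>Cauchy sequences in L2 and almost everywhere limits\<close>

definition L2_Cauchy :: "'a measure \<Rightarrow> (nat \<Rightarrow> 'a \<Rightarrow> complex) \<Rightarrow> bool" where
  "L2_Cauchy M F \<longleftrightarrow> (\<forall>n. F n \<in> L2 M) \<and>
     (\<forall>e>0. \<exists>N. \<forall>m\<ge>N. \<forall>n\<ge>N. L2_norm M (\<lambda>x. F m x - F n x) < e)"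

lemma L2_mult_tendsto_0:
  assumes "G \<in> L2 M" "\<And>n. m n \<in> borel_measurable M" "\<And>n. AE x in M. cmod (m n x) \<le> C"
    and "AE x in M. (\<lambda>n. m n x) \<longlonglongrightarrow> 0"
  shows "(\<lambda>n. L2_norm M (\<lambda>x. m n x * G x)) \<longlonglongrightarrow> 0"
proof -
  note [measurable] = assms(2) L2_measurable[OF assms(1)]
  have "(\<lambda>n. \<integral>x. (cmod (m n x * G x))\<^sup>2 \<partial>M) \<longlonglongrightarrow> (\<integral>x. 0 \<partial>M)"
  proof (rule integral_dominated_convergence)
    show "integrable M (\<lambda>x. C\<^sup>2 * (cmod (G x))\<^sup>2)"
      using L2_integrable_square[OF assms(1)] by simp
    show "AE x in M. norm ((cmod (m n x * G x))\<^sup>2) \<le> C\<^sup>2 * (cmod (G x))\<^sup>2" for n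
      using assms(3)[of n] by eventually_elim
        (auto simp: norm_mult power_mult_distrib intro!: mult_right_mono power_mono)
    show "AE x in M. (\<lambda>n. (cmod (m n x * G x))\<^sup>2) \<longlonglongrightarrow> 0"
      using assms(4)
    proof eventually_elim
      case (elim x)
      then have "(\<lambda>n. (cmod (m n x * G x))\<^sup>2) \<longlonglongrightarrow> (cmod (0 * G x))\<^sup>2"
        by (intro tendsto_intros)
      then show ?case by simp
    qed
  qed measurable
  then have "(\<lambda>n. sqrt (\<integral>x. (cmod (m n x * G x))\<^sup>2 \<partial>M)) \<longlonglongrightarrow> sqrt 0"
    by (intro tendsto_real_sqrt) simp
  then show ?thesis by (simp add: L2_norm_def)
qed

text \<open>Dominated convergence needs one fixed factor, but here both factors vary. A late member
  \<open>G N\<close> is fixed: the rest \<open>G n - G N\<close> is small in norm and the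
  multipliers are bounded, while \<open>m n * G N\<close> tends to 0 by the preceding lemma.\<close>

lemma L2_Cauchy_mult_tendsto_0:
  assumes "L2_Cauchy M G" "\<And>n. m n \<in> borel_measurable M" "\<And>n. AE x in M. cmod (m n x) \<le> C"
    and "AE x in M. (\<lambda>n. m n x) \<longlonglongrightarrow> 0" and "C \<ge> 0"
  shows "(\<lambda>n. L2_norm M (\<lambda>x. m n x * G n x)) \<longlonglongrightarrow> 0"
proof (rule LIMSEQ_I)
  fix e :: real assume "e > 0"
  have G: "G n \<in> L2 M" for n using assms(1) by (simp add: L2_Cauchy_def)
  \<comment> \<open>\<open>C + 1\<close> in place of \<open>C\<close> keeps the quotient positive
    when \<open>C = 0\<close>.\<close>
  have "e / (2 * (C + 1)) > 0" using \<open>e > 0\<close> \<open>C \<ge> 0\<close> by simp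
  then obtain N where N: "L2_norm M (\<lambda>x. G n x - G N x) < e / (2 * (C + 1))" if "n \<ge> N" for n
    using assms(1) unfolding L2_Cauchy_def by (meson order_refl)
  obtain N' where N': "L2_norm M (\<lambda>x. m n x * G N x) < e / 2" if "n \<ge> N'" for n
    using LIMSEQ_D[OF L2_mult_tendsto_0[OF G[of N] assms(2-4)], of "e/2"] \<open>e > 0\<close>
    by (auto simp: L2_norm_nonneg)
  show "\<exists>no. \<forall>n\<ge>no. norm (L2_norm M (\<lambda>x. m n x * G n x) - 0) < e"
  proof (intro exI allI impI)
    fix n assume n: "n \<ge> max N N'"
    have "L2_norm M (\<lambda>x. m n x * G n x) =
        L2_norm M (\<lambda>x. m n x * (G n x - G N x) + m n x * G N x)"
      by (simp add: algebra_simps)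
    also have "\<dots> \<le> L2_norm M (\<lambda>x. m n x * (G n x - G N x)) + L2_norm M (\<lambda>x. m n x * G N x)"
      using G assms(2-5) by (intro L2_norm_triangle L2_mult_bounded(1)[of _ _ _ C] L2_diff) auto
    also have "\<dots> < C * (e / (2 * (C + 1))) + e / 2"
    proof -
      have "L2_norm M (\<lambda>x. m n x * (G n x - G N x)) \<le> C * L2_norm M (\<lambda>x. G n x - G N x)"
        using G assms(2-5) by (intro L2_mult_bounded(2) L2_diff) auto
      also have "\<dots> \<le> C * (e / (2 * (C + 1)))"
        using N[of n] n \<open>C \<ge> 0\<close> by (intro mult_left_mono) auto
      finally show ?thesis using N'[of n] n by linarith
    qed
    also have "\<dots> \<le> e"
    proof -
      have "C / (C + 1) \<le> 1" using \<open>C \<ge> 0\<close> by simp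
      then have "(C / (C + 1)) * (e / 2) \<le> 1 * (e / 2)" using \<open>e > 0\<close> by (intro mult_right_mono) auto
      moreover have "C * (e / (2 * (C + 1))) = (C / (C + 1)) * (e / 2)" using \<open>C \<ge> 0\<close> by (simp add: field_simps)
      ultimately show ?thesis by linarith
    qed
    finally show "norm (L2_norm M (\<lambda>x. m n x * G n x) - 0) < e"
      by (simp add: L2_norm_nonneg)
  qed
qed

text \<open>Fatou's lemma for fixed n: the square of |G n - F| is almost everywhere the limit in m
  of the square of |G n - G m|, whose integral is below \<open>e\<^sup>2\<close>. So a pointwise
  limit that is given in advance is also the limit in norm.\<close>

lemma L2_Cauchy_AE_limit:
  assumes "L2_Cauchy M G" "F \<in> borel_measurable M" "AE x in M. (\<lambda>n. G n x) \<longlonglongrightarrow> F x"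
  shows "F \<in> L2 M" "(\<lambda>n. L2_norm M (\<lambda>x. G n x - F x)) \<longlonglongrightarrow> 0"
proof -
  have G: "G n \<in> L2 M" for n using assms(1) by (simp add: L2_Cauchy_def)
  note [measurable] = assms(2) L2_measurable[OF G]
  have main: "(\<lambda>x. G n x - F x) \<in> L2 M \<and> L2_norm M (\<lambda>x. G n x - F x) \<le> e"
    if "e > 0" and n: "\<And>m. m \<ge> n \<Longrightarrow> L2_norm M (\<lambda>x. G n x - G m x) < e" for e n
  proof -
    have lim: "AE x in M. ennreal ((cmod (G n x - F x))\<^sup>2) = liminf (\<lambda>m. ennreal ((cmod (G n x - G m x))\<^sup>2))"
      using assms(3)
    proof eventually_elim
      case (elim x)
      then have "(\<lambda>m. ennreal ((cmod (G n x - G m x))\<^sup>2)) \<longlonglongrightarrow> ennreal ((cmod (G n x - F x))\<^sup>2)"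
        by (intro tendsto_intros) auto
      from lim_imp_Liminf[OF _ this] show ?case by simp
    qed
    have "(\<integral>\<^sup>+x. ennreal ((cmod (G n x - F x))\<^sup>2) \<partial>M)
        = (\<integral>\<^sup>+x. liminf (\<lambda>m. ennreal ((cmod (G n x - G m x))\<^sup>2)) \<partial>M)"
      by (rule nn_integral_cong_AE[OF lim])
    also have "\<dots> \<le> liminf (\<lambda>m. \<integral>\<^sup>+x. ennreal ((cmod (G n x - G m x))\<^sup>2) \<partial>M)"
      by (rule nn_integral_liminf) measurable
    also have "\<dots> \<le> ennreal (e\<^sup>2)"
    proof (rule Liminf_le)
      show "\<forall>\<^sub>F m in sequentially. (\<integral>\<^sup>+x. ennreal ((cmod (G n x - G m x))\<^sup>2) \<partial>M) \<le> ennreal (e\<^sup>2)"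
      proof (rule eventually_sequentiallyI)
        fix m assume "m \<ge> n"
        have "(\<integral>\<^sup>+x. ennreal ((cmod (G n x - G m x))\<^sup>2) \<partial>M) = ennreal ((L2_norm M (\<lambda>x. G n x - G m x))\<^sup>2)"
          unfolding L2_norm_square
          by (intro nn_integral_eq_integral L2_integrable_square L2_diff G) auto
        also have "\<dots> \<le> ennreal (e\<^sup>2)"
          using n[OF \<open>m \<ge> n\<close>] by (intro ennreal_leI power_mono) (auto simp: L2_norm_nonneg)
        finally show "(\<integral>\<^sup>+x. ennreal ((cmod (G n x - G m x))\<^sup>2) \<partial>M) \<le> ennreal (e\<^sup>2)" .
      qed
    qed simp
    finally have le: "(\<integral>\<^sup>+x. ennreal ((cmod (G n x - F x))\<^sup>2) \<partial>M) \<le> ennreal (e\<^sup>2)" .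
    have "integrable M (\<lambda>x. (cmod (G n x - F x))\<^sup>2)"
      using le by (intro integrableI_bounded) (auto simp: le_less_trans)
    then have L: "(\<lambda>x. G n x - F x) \<in> L2 M" by (intro L2_I) auto
    have "ennreal ((L2_norm M (\<lambda>x. G n x - F x))\<^sup>2) \<le> ennreal (e\<^sup>2)"
      using le unfolding L2_norm_square
      by (subst (asm) nn_integral_eq_integral) (auto intro: L2_integrable_square[OF L])
    then have "L2_norm M (\<lambda>x. G n x - F x) \<le> e"
      using \<open>e > 0\<close> by (simp add: abs_le_square_iff[symmetric] L2_norm_nonneg)
    with L show ?thesis by blast
  qed
  have ex: "\<exists>N. \<forall>n\<ge>N. \<forall>m\<ge>n. L2_norm M (\<lambda>x. G n x - G m x) < e" if "e > 0" for e
    using assms(1) that unfolding L2_Cauchy_def by (meson order_trans)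
  obtain N where "\<And>m. m \<ge> N \<Longrightarrow> L2_norm M (\<lambda>x. G N x - G m x) < 1"
    using ex[of 1] by auto
  then have "(\<lambda>x. G N x - F x) \<in> L2 M" using main[of 1 N] by simp
  \<comment> \<open>One difference suffices: F = G N - (G N - F).\<close>
  from L2_diff[OF G[of N] this] show "F \<in> L2 M" by simp
  show "(\<lambda>n. L2_norm M (\<lambda>x. G n x - F x)) \<longlonglongrightarrow> 0"
  proof (rule LIMSEQ_I)
    fix e :: real assume "e > 0"
    then obtain N where "\<forall>n\<ge>N. \<forall>m\<ge>n. L2_norm M (\<lambda>x. G n x - G m x) < e / 2"
      using ex[of "e/2"] by auto
    then have "\<forall>n\<ge>N. norm (L2_norm M (\<lambda>x. G n x - F x) - 0) < e"
      using main[of "e/2"] \<open>e > 0\<close> by (force simp: L2_norm_nonneg)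
    then show "\<exists>no. \<forall>n\<ge>no. norm (L2_norm M (\<lambda>x. G n x - F x) - 0) < e" ..
  qed
qed

section \<open>Integration on the torus\<close>

lemma sets_circle_measure [measurable_cong]:
  "sets circle_measure = sets (restrict_space borel (sphere 0 1))"
  and space_circle_measure: "space circle_measure = sphere 0 1"
  by (simp_all add: circle_measure_def space_restrict_space)

lemma measurable_cis_circle:
  "cis \<in> uniform_measure lborel {0..<2 * pi} \<rightarrow>\<^sub>M restrict_space borel (sphere 0 1)"
proof (rule measurable_restrict_space2)
  have "cis \<in> borel_measurable borel"
    by (intro borel_measurable_continuous_onI continuous_intros)
  then show "cis \<in> borel_measurable (uniform_measure lborel {0..<2 * pi})"
    by (simp add: measurable_cong_sets[OF sets_uniform_measure refl])
qed auto

lemma emeasure_circle_measure: "emeasure circle_measure (sphere 0 1) = 1"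
proof -
  have "emeasure circle_measure (sphere 0 1) =
      emeasure (uniform_measure lborel {0..<2 * pi}) (cis -` sphere 0 1 \<inter> UNIV)"
    unfolding circle_measure_def
    by (subst emeasure_distr[OF measurable_cis_circle]) (auto simp: sets_restrict_space_iff)
  also have "cis -` sphere 0 1 \<inter> UNIV = UNIV" by auto
  also have "emeasure (uniform_measure lborel {0..<2 * pi}) UNIV = 1"
    by (subst emeasure_uniform_measure) (auto simp: ennreal_eq_0_iff not_le)
  finally show ?thesis .
qed

lemma finite_measure_circle: "finite_measure circle_measure"
  by (rule finite_measureI) (simp add: emeasure_circle_measure space_circle_measure)

interpretation circ: finite_measure circle_measure
  by (rule finite_measure_circle)

interpretation tor: finite_measure torus_measure
  unfolding torus_measure_def by (intro finite_measure_pair_measure finite_measure_circle)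

interpretation circ2: pair_sigma_finite circle_measure circle_measure ..

lemma space_torus_measure: "space torus_measure = torus"
  by (simp add: torus_measure_def torus_def space_pair_measure space_circle_measure)

lemma measurable_id_circle: "(\<lambda>z. z) \<in> borel_measurable circle_measure"
proof -
  have "(\<lambda>z. z) \<in> borel_measurable (restrict_space borel (sphere 0 1 :: complex set))"
    by (intro measurable_restrict_space1) simp
  then show ?thesis by (simp add: measurable_cong_sets[OF sets_circle_measure refl])
qed

lemma measurable_fst_torus [measurable]: "fst \<in> borel_measurable torus_measure"
  and measurable_snd_torus [measurable]: "snd \<in> borel_measurable torus_measure"
  unfolding torus_measure_def
  using measurable_compose[OF measurable_fst[of circle_measure circle_measure] measurable_id_circle]
    measurable_compose[OF measurable_snd[of circle_measure circle_measure] measurable_id_circle]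
  by simp_all

lemma circle_integral:
  fixes g :: "complex \<Rightarrow> complex"
  assumes "g \<in> borel_measurable circle_measure"
  shows "(\<integral>z. g z \<partial>circle_measure) = (\<integral>t. indicator {0..2*pi} t *\<^sub>R g (cis t) \<partial>lborel) / (2 * pi)"
proof -
  have g: "g \<in> borel_measurable (restrict_space borel (sphere 0 1))"
    using assms by (simp add: measurable_cong_sets[OF sets_circle_measure refl])
  have gc: "(\<lambda>t. g (cis t)) \<in> borel_measurable lborel"
    using measurable_compose[OF measurable_cis_circle g]
    by (simp add: measurable_cong_sets[OF sets_uniform_measure refl])
  have u: "uniform_measure lborel {0..<2*pi} =
      density lborel (\<lambda>x. ennreal (indicator {0..<2*pi} x / (2*pi)))"
    unfolding uniform_measure_def
    by (intro density_cong) (auto split: split_indicator simp: divide_ennreal[symmetric] ennreal_1[symmetric] simp del: ennreal_1)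
  have "(\<integral>z. g z \<partial>circle_measure) = (\<integral>t. g (cis t) \<partial>uniform_measure lborel {0..<2*pi})"
    unfolding circle_measure_def by (rule integral_distr[OF measurable_cis_circle g])
  also have "\<dots> = (\<integral>t. (indicator {0..<2*pi} t / (2*pi)) *\<^sub>R g (cis t) \<partial>lborel)"
    unfolding u by (rule integral_density) (use gc in auto)
  \<comment> \<open>The fundamental theorem of calculus is applied later on a closed interval; the
    added endpoint is a null set.\<close>
  also have "\<dots> = (\<integral>t. (indicator {0..2*pi} t *\<^sub>R g (cis t)) / (2*pi) \<partial>lborel)"
  proof (rule integral_cong_AE)
    have "AE t in lborel. t \<noteq> (2*pi :: real)" by (rule AE_lborel_singleton)
    then show "AE t in lborel. (indicator {0..<2*pi} t / (2*pi)) *\<^sub>R g (cis t) =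
        (indicator {0..2*pi} t *\<^sub>R g (cis t)) / (2*pi)"
      by eventually_elim (auto split: split_indicator simp: scaleR_conv_of_real)
  qed (use gc in measurable)
  finally show ?thesis by simp
qed

text \<open>Conjugation inverts points of the circle, so the integrand is the character of frequency
  m - n. For nonzero frequency its primitive takes equal values at both ends of the full
  period.\<close>

lemma circle_integral_power:
  "(\<integral>z. z ^ m * cnj z ^ n \<partial>circle_measure) = (if m = n then 1 else 0)"
proof -
  define k where "k = real m - real n"
  have eq: "cis t ^ m * cnj (cis t) ^ n = cis (k * t)" for t
  proof -
    have "cis t ^ m * cnj (cis t) ^ n = cis (real m * t) * cis (real n * (- t))"
      by (simp only: Complex.DeMoivre cis_cnj)
    then show ?thesis by (simp add: cis_mult k_def algebra_simps)
  qed
  have "(\<lambda>z. z ^ m * cnj z ^ n) \<in> borel_measurable circle_measure"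
    using measurable_id_circle by (intro borel_measurable_times borel_measurable_power borel_measurable_cnj)
  then have "(\<integral>z. z ^ m * cnj z ^ n \<partial>circle_measure) =
      (\<integral>t. indicator {0..2*pi} t *\<^sub>R cis (k * t) \<partial>lborel) / (2 * pi)"
    by (subst circle_integral) (auto simp: eq)
  also have "(\<integral>t. indicator {0..2*pi} t *\<^sub>R cis (k * t) \<partial>lborel) = (if m = n then 2 * pi else 0)"
  proof (cases "m = n")
    case True
    have "(\<integral>t. indicator {0..2*pi} t *\<^sub>R (1::complex) \<partial>lborel) = of_real (2 * pi) - of_real 0"
      by (rule integral_FTC_Icc) (auto intro!: derivative_eq_intros simp: has_vector_derivative_def scaleR_conv_of_real)
    then show ?thesis using True by (simp add: k_def)
  next
    case False
    then have k: "k \<noteq> 0" by (simp add: k_def)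
    have "(\<integral>t. indicator {0..2*pi} t *\<^sub>R cis (k * t) \<partial>lborel) =
        cis (k * (2*pi)) / (\<i> * k) - cis (k * 0) / (\<i> * k)"
    proof (rule integral_FTC_Icc)
      fix t
      have "((\<lambda>z. exp (\<i> * (of_real k * z)) / (\<i> * k)) has_field_derivative
          exp (\<i> * (of_real k * of_real t))) (at (of_real t))"
        using k by (auto intro!: derivative_eq_intros simp: mult.commute[of "exp _"])
      from has_vector_derivative_real_field[OF this]
      show "((\<lambda>t. cis (k * t) / (\<i> * k)) has_vector_derivative cis (k * t)) (at t within {0..2*pi})"
        by (simp add: cis_conv_exp)
    qed (auto intro!: continuous_intros)
    also have "k * (2*pi) = 2 * pi * real_of_int (int m - int n)"
      by (simp add: k_def)
    also have "cis \<dots> = 1" by (rule cis_multiple_2pi) simp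
    finally show ?thesis using False by simp
  qed
  finally show ?thesis by simp
qed

section \<open>Monomials as characters of the torus\<close>

definition monomial :: "nat \<times> nat \<Rightarrow> complex \<times> complex \<Rightarrow> complex" where
  "monomial p z = fst z ^ fst p * snd z ^ snd p"

lemma measurable_monomial [measurable]: "monomial p \<in> borel_measurable torus_measure"
  unfolding monomial_def[abs_def] by (intro borel_measurable_times borel_measurable_power) measurable

lemma norm_monomial_torus: "\<zeta> \<in> torus \<Longrightarrow> cmod (monomial p \<zeta>) = 1"
  by (auto simp: torus_def monomial_def norm_mult norm_power)

lemma integrable_torus_bounded:
  fixes f :: "_ \<Rightarrow> complex"
  assumes "f \<in> borel_measurable torus_measure" "\<And>\<zeta>. \<zeta> \<in> torus \<Longrightarrow> cmod (f \<zeta>) \<le> C"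
  shows "integrable torus_measure f"
  using assms by (intro tor.integrable_const_bound[of _ C]) (auto simp: space_torus_measure)

lemma L2_torus_bounded:
  assumes "f \<in> borel_measurable torus_measure" "\<And>\<zeta>. \<zeta> \<in> torus \<Longrightarrow> cmod (f \<zeta>) \<le> C"
  shows "f \<in> L2 torus_measure"
proof (rule L2_I[OF assms(1)], rule tor.integrable_const_bound)
  show "AE x in torus_measure. norm ((cmod (f x))\<^sup>2) \<le> C\<^sup>2"
    using assms(2) by (auto simp: space_torus_measure intro!: AE_I2 power_mono)
qed (use assms(1) in measurable)

lemma integral_torus:
  fixes f :: "_ \<Rightarrow> complex"
  assumes "integrable torus_measure f"
  shows "(\<integral>\<zeta>. f \<zeta> \<partial>torus_measure) = (\<integral>x. (\<integral>y. f (x, y) \<partial>circle_measure) \<partial>circle_measure)"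
  using circ2.integral_fst'[of f] assms by (simp add: torus_measure_def)

lemma monomial_L2: "monomial p \<in> L2 torus_measure"
  by (rule L2_torus_bounded[where C = 1]) (auto simp: norm_monomial_torus)

lemma monomial_orthonormal: "L2_inner torus_measure (monomial p) (monomial q) = (if p = q then 1 else 0)"
proof -
  have "L2_inner torus_measure (monomial p) (monomial q) =
     (\<integral>x. (\<integral>y. (x ^ fst p * cnj x ^ fst q) * (y ^ snd p * cnj y ^ snd q) \<partial>circle_measure) \<partial>circle_measure)"
    unfolding L2_inner_def
    by (subst integral_torus[OF L2_integrable_prod[OF monomial_L2 monomial_L2]]) (simp add: monomial_def mult_ac)
  then show ?thesis
    by (simp add: circle_integral_power prod_eq_iff)
qed

section \<open>Interchanging sums and integrals\<close>

text \<open>The unordered sum is turned into a series along the enumeration \<open>e\<close>;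
  absolute convergence makes the order irrelevant. The product form \<open>B i * G x\<close> of the
  bound gives absolute convergence at each point and of the integrals at once.\<close>

lemma integral_has_sum:
  fixes f :: "'i \<Rightarrow> 'a \<Rightarrow> complex"
  assumes e: "bij (e :: nat \<Rightarrow> 'i)"
    and f: "\<And>i. integrable M (f i)"
    and le: "\<And>i x. x \<in> space M \<Longrightarrow> cmod (f i x) \<le> B i * G x"
    and B: "B summable_on UNIV" and G: "integrable M G"
    and S: "\<And>x. x \<in> space M \<Longrightarrow> ((\<lambda>i. f i x) has_sum S x) UNIV"
  shows "integrable M S" "((\<lambda>i. \<integral>x. f i x \<partial>M) has_sum (\<integral>x. S x \<partial>M)) UNIV"
proof -
  have B': "summable (\<lambda>n. B (e n))"
    using B summable_on_reindex_bij_betw[OF e, of B] by (simp add: summable_on_imp_summable)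
  have S': "((\<lambda>n. f (e n) x) has_sum S x) UNIV" if "x \<in> space M" for x
    using S[OF that] has_sum_reindex_bij_betw[OF e, of "\<lambda>i. f i x"] by simp
  have sumint: "summable (\<lambda>n. \<integral>x. norm (f (e n) x) \<partial>M)"
  proof (rule summable_comparison_test)
    show "\<exists>N. \<forall>n\<ge>N. norm (\<integral>x. norm (f (e n) x) \<partial>M) \<le> B (e n) * (\<integral>x. G x \<partial>M)"
    proof (intro exI allI impI)
      fix n
      have "(\<integral>x. norm (f (e n) x) \<partial>M) \<le> (\<integral>x. B (e n) * G x \<partial>M)"
        using f G le by (intro integral_mono) auto
      then show "norm (\<integral>x. norm (f (e n) x) \<partial>M) \<le> B (e n) * (\<integral>x. G x \<partial>M)"
        by (simp add: integral_nonneg)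
    qed
    show "summable (\<lambda>n. B (e n) * (\<integral>x. G x \<partial>M))"
      using B' by (rule summable_mult2)
  qed
  have AE: "AE x in M. summable (\<lambda>n. norm (f (e n) x))"
  proof (rule AE_I2)
    fix x assume x: "x \<in> space M"
    show "summable (\<lambda>n. norm (f (e n) x))"
      by (rule summable_comparison_test[OF _ summable_mult2[OF B', of "G x"]]) (use le[OF x] in auto)
  qed
  have eq: "(\<Sum>n. f (e n) x) = S x" if "x \<in> space M" for x
    using has_sum_imp_sums[OF S'[OF that]] by (simp add: sums_iff)
  show "integrable M S"
    using integrable_suminf[OF f AE sumint] Bochner_Integration.integrable_cong[OF refl eq, of M] by simp
  have "summable (\<lambda>n. norm (\<integral>x. f (e n) x \<partial>M))"
    by (rule summable_comparison_test[OF _ sumint]) auto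
  moreover have "(\<lambda>n. \<integral>x. f (e n) x \<partial>M) sums (\<integral>x. S x \<partial>M)"
    using sums_integral[OF f AE sumint] Bochner_Integration.integral_cong[OF refl eq, of M] by simp
  ultimately have "((\<lambda>n. \<integral>x. f (e n) x \<partial>M) has_sum (\<integral>x. S x \<partial>M)) UNIV"
    by (rule norm_summable_imp_has_sum)
  then show "((\<lambda>i. \<integral>x. f i x \<partial>M) has_sum (\<integral>x. S x \<partial>M)) UNIV"
    using has_sum_reindex_bij_betw[OF e, of "\<lambda>i. \<integral>x. f i x \<partial>M"] by simp
qed

lemmas integral_has_sum_nat2 = integral_has_sum[OF bij_prod_decode]
lemmas integral_has_sum_nat = integral_has_sum[where e = "\<lambda>n::nat. n", simplified bij_def, simplified]

section \<open>Power series on the bidisk\<close>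

lemma has_sum_single:
  assumes "\<And>p. p \<noteq> q \<Longrightarrow> f p = 0"
  shows "(f has_sum f q) UNIV"
proof -
  have "(f has_sum f q) {q}" by (rule has_sum_finiteI) auto
  moreover have "(f has_sum f q) {q} \<longleftrightarrow> (f has_sum f q) UNIV"
    using assms by (intro has_sum_cong_neutral) auto
  ultimately show ?thesis by blast
qed

text \<open>Summable complex families are absolutely summable, so the family of products is
  absolutely summable too and may be summed one index at a time.\<close>

lemma has_sum_product_UNIV:
  fixes f :: "'i \<Rightarrow> complex" and g :: "'j \<Rightarrow> complex"
  assumes f: "(f has_sum a) UNIV" and g: "(g has_sum b) UNIV"
  shows "((\<lambda>p. f (fst p) * g (snd p)) has_sum a * b) UNIV"
proof -
  have nf: "(\<lambda>i. norm (f i)) summable_on UNIV" and ng: "(\<lambda>j. norm (g j)) summable_on UNIV"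
    using f g summable_on_iff_abs_summable_on_complex has_sum_imp_summable by blast+
  have "(\<lambda>p. norm (f (fst p) * g (snd p))) summable_on UNIV \<times> UNIV"
  proof (rule summable_on_SigmaI)
    show "((\<lambda>j. norm (f (fst (i, j)) * g (snd (i, j)))) has_sum norm (f i) * infsum (\<lambda>j. norm (g j)) UNIV) UNIV" for i
      using has_sum_cmult_right[OF has_sum_infsum[OF ng], of "norm (f i)"] by (simp add: norm_mult)
    show "(\<lambda>i. norm (f i) * infsum (\<lambda>j. norm (g j)) UNIV) summable_on UNIV"
      using nf by (rule summable_on_cmult_left)
  qed simp
  then have "(\<lambda>p. f (fst p) * g (snd p)) summable_on UNIV \<times> UNIV"
    by (rule abs_summable_summable)
  moreover have "((\<lambda>j. f (fst (i, j)) * g (snd (i, j))) has_sum f i * b) UNIV" for i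
    using has_sum_cmult_right[OF g] by simp
  ultimately have "((\<lambda>p. f (fst p) * g (snd p)) has_sum a * b) (UNIV \<times> UNIV)"
    using has_sum_cmult_left[OF f, of b] by (intro has_sum_SigmaI[where g = "\<lambda>i. f i * b"]) auto
  then show ?thesis by simp
qed

lemma has_sum_geometric:
  fixes x :: complex
  assumes "cmod x < 1"
  shows "((\<lambda>n. x ^ n) has_sum 1 / (1 - x)) UNIV"
  using assms by (intro norm_summable_imp_has_sum geometric_sums)
    (auto simp: norm_power intro: summable_geometric)

lemma has_sum_monomial_geometric:
  assumes "cmod x < 1" "cmod y < 1"
  shows "((\<lambda>p. monomial p (x, y)) has_sum 1 / ((1 - x) * (1 - y))) UNIV"
  using has_sum_product_UNIV[OF has_sum_geometric[OF assms(1)] has_sum_geometric[OF assms(2)]]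
  by (simp add: monomial_def)

definition total_degree :: "nat \<times> nat \<Rightarrow> nat" where
  "total_degree p = fst p + snd p"

definition dilate :: "real \<Rightarrow> complex \<times> complex \<Rightarrow> complex \<times> complex" where
  "dilate r z = (of_real r * fst z, of_real r * snd z)"

lemma monomial_dilate: "monomial p (dilate r z) = of_real (r ^ total_degree p) * monomial p z"
  by (simp add: monomial_def dilate_def total_degree_def power_mult_distrib power_add)

lemma has_taylor_iff:
  "has_taylor f a \<longleftrightarrow> (\<forall>z\<in>bidisk. ((\<lambda>p. a p * monomial p z) has_sum f z) UNIV)"
  by (simp add: has_taylor_def monomial_def case_prod_unfold mult.assoc)

lemma torus_mem: "\<zeta> \<in> torus \<longleftrightarrow> cmod (fst \<zeta>) = 1 \<and> cmod (snd \<zeta>) = 1"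
  by (cases \<zeta>) (auto simp: torus_def)

lemma bidisk_mem: "z \<in> bidisk \<longleftrightarrow> cmod (fst z) < 1 \<and> cmod (snd z) < 1"
  by (cases z) (auto simp: bidisk_def)

lemma open_bidisk: "open bidisk"
  by (simp add: bidisk_def open_Times)

lemma dilate_bidisk: "\<zeta> \<in> torus \<Longrightarrow> 0 \<le> r \<Longrightarrow> r < 1 \<Longrightarrow> dilate r \<zeta> \<in> bidisk"
  by (auto simp: torus_mem bidisk_mem dilate_def norm_mult)

section \<open>Absolutely convergent Fourier series on the torus\<close>

context
  fixes h :: "complex \<times> complex \<Rightarrow> complex" and b :: "nat \<times> nat \<Rightarrow> complex"
  assumes expansion: "\<And>\<zeta>. \<zeta> \<in> torus \<Longrightarrow> ((\<lambda>p. b p * monomial p \<zeta>) has_sum h \<zeta>) UNIV"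
begin

lemma torus_series_summable: "(\<lambda>p. cmod (b p)) summable_on UNIV"
proof -
  \<comment> \<open>At (1, 1) every monomial equals 1, so convergence there is already summability
    of the coefficients.\<close>
  have "(\<lambda>p. b p * monomial p (1, 1)) summable_on UNIV"
    using expansion[of "(1, 1)"] has_sum_imp_summable by (fastforce simp: torus_mem)
  then show ?thesis
    using summable_on_iff_abs_summable_on_complex[of "\<lambda>p. b p * monomial p (1, 1)"] by (simp add: monomial_def)
qed

lemma torus_series_L2: "h \<in> L2 torus_measure"
proof (rule L2_torus_bounded)
  have "integrable torus_measure h"
  proof (rule integral_has_sum_nat2(1)[where f = "\<lambda>p \<zeta>. b p * monomial p \<zeta>" and B = "\<lambda>p. cmod (b p)" and G = "\<lambda>_. 1"])
    show "integrable torus_measure (\<lambda>\<zeta>. b p * monomial p \<zeta>)" for p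
      by (rule integrable_torus_bounded[where C = "cmod (b p)"]) (auto simp: norm_mult norm_monomial_torus)
  qed (auto simp: space_torus_measure norm_mult norm_monomial_torus torus_series_summable expansion)
  then show "h \<in> borel_measurable torus_measure" by simp
  show "cmod (h \<zeta>) \<le> infsum (\<lambda>p. cmod (b p)) UNIV" if "\<zeta> \<in> torus" for \<zeta>
    using norm_infsum_bound[of "\<lambda>p. b p * monomial p \<zeta>" UNIV] that expansion[OF that] torus_series_summable
    by (simp add: norm_mult norm_monomial_torus infsumI)
qed

text \<open>The series of \<open>h\<close>, multiplied by \<open>G\<close>, is dominated by
  \<open>cmod (b p)\<close> times the modulus of \<open>G\<close>, and \<open>G\<close> is
  integrable since constants are in L2 of the torus. A monomial for \<open>G\<close> yields the
  coefficients of \<open>h\<close>; a second series for \<open>G\<close> yields Parseval's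
  identity.\<close>

lemma torus_series_inner:
  assumes "G \<in> L2 torus_measure"
  shows "((\<lambda>p. cnj (b p) * L2_inner torus_measure G (monomial p)) has_sum L2_inner torus_measure G h) UNIV"
proof -
  have G: "integrable torus_measure G"
    using L2_integrable_prod[OF assms L2_torus_bounded[of "\<lambda>_. 1" 1]] by simp
  have "((\<lambda>p. \<integral>\<zeta>. G \<zeta> * cnj (b p * monomial p \<zeta>) \<partial>torus_measure) has_sum (\<integral>\<zeta>. G \<zeta> * cnj (h \<zeta>) \<partial>torus_measure)) UNIV"
  proof (rule integral_has_sum_nat2(2)[where B = "\<lambda>p. cmod (b p)" and G = "\<lambda>\<zeta>. cmod (G \<zeta>)"])
    show "integrable torus_measure (\<lambda>\<zeta>. G \<zeta> * cnj (b p * monomial p \<zeta>))" for p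
      by (intro L2_integrable_prod assms L2_scale monomial_L2)
    show "((\<lambda>p. G \<zeta> * cnj (b p * monomial p \<zeta>)) has_sum G \<zeta> * cnj (h \<zeta>)) UNIV"
      if "\<zeta> \<in> space torus_measure" for \<zeta>
      using expansion[of \<zeta>] that by (intro has_sum_cmult_right) (simp only: has_sum_cnj_iff space_torus_measure)
  qed (auto simp: space_torus_measure norm_mult norm_monomial_torus torus_series_summable G)
  moreover have "(\<integral>\<zeta>. G \<zeta> * cnj (b p * monomial p \<zeta>) \<partial>torus_measure) = cnj (b p) * L2_inner torus_measure G (monomial p)" for p
    by (simp add: L2_inner_def mult.left_commute flip: integral_mult_right_zero)
  ultimately show ?thesis by (simp add: L2_inner_def)
qed

lemma torus_series_coeff: "L2_inner torus_measure h (monomial q) = b q"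
proof -
  have "((\<lambda>p. cnj (b p) * (if q = p then 1 else 0)) has_sum L2_inner torus_measure (monomial q) h) UNIV"
    using torus_series_inner[OF monomial_L2, of q] by (simp add: monomial_orthonormal)
  moreover have "((\<lambda>p. cnj (b p) * (if q = p then 1 else 0)) has_sum cnj (b q)) UNIV"
    using has_sum_single[of q "\<lambda>p. cnj (b p) * (if q = p then 1 else 0)"] by simp
  ultimately have "L2_inner torus_measure (monomial q) h = cnj (b q)" by (rule has_sum_unique)
  then show ?thesis by (subst L2_inner_commute) simp
qed

end

lemma has_taylor_dilate:
  assumes "has_taylor f a" "0 \<le> r" "r < 1" "\<zeta> \<in> torus"
  shows "((\<lambda>p. (of_real (r ^ total_degree p) * a p) * monomial p \<zeta>) has_sum f (dilate r \<zeta>)) UNIV"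
  using assms dilate_bidisk[OF assms(4,2,3)] by (auto simp: has_taylor_iff monomial_dilate mult_ac)

text \<open>On the torus of radius 1/2 both series converge absolutely, and the Fourier coefficients
  there are the Taylor coefficients up to powers of 1/2. This makes the definite description in
  \<open>taylor\<close> meaningful.\<close>

lemma has_taylor_unique:
  assumes "has_taylor f a" "has_taylor f b"
  shows "a = b"
proof
  fix q
  show "a q = b q"
    using torus_series_coeff[OF has_taylor_dilate[OF assms(1)], of "1/2" q]
      torus_series_coeff[OF has_taylor_dilate[OF assms(2)], of "1/2" q] by simp
qed

lemma taylor_eqI: "has_taylor f a \<Longrightarrow> taylor f = a"
  unfolding taylor_def by (blast intro: has_taylor_unique)

lemma has_taylor_continuous:
  assumes "has_taylor f a"
  shows "continuous_on bidisk f"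
proof -
  have "isCont f z" if z: "z \<in> bidisk" for z
  proof -
    \<comment> \<open>Halfway between the larger modulus and 1: the polydisc of radius r contains z,
      and absolute convergence at (r, r) supplies the Weierstrass majorant.\<close>
    define r where "r = (1 + max (cmod (fst z)) (cmod (snd z))) / 2"
    have r: "0 < r" "r < 1" "cmod (fst z) < r" "cmod (snd z) < r"
      using z by (auto simp: r_def bidisk_mem max_def add_pos_nonneg)
    let ?U = "ball 0 r \<times> ball 0 r :: (complex \<times> complex) set"
    have sub: "?U \<subseteq> bidisk" using r by (auto simp: bidisk_mem)
    have sum: "(\<lambda>p. cmod (a p) * r ^ total_degree p) summable_on UNIV"
      using torus_series_summable[OF has_taylor_dilate[OF assms], of r] r
      by (simp add: norm_mult norm_power mult.commute)
    have "uniform_limit ?U (\<lambda>X z. \<Sum>p\<in>X. a p * monomial p z) f (finite_subsets_at_top UNIV)"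
    proof (rule Weierstrass_m_test_general'[OF _ _ sum])
      fix p w assume w: "w \<in> ?U"
      have "cmod (fst w) ^ fst p * cmod (snd w) ^ snd p \<le> r ^ fst p * r ^ snd p"
        using w r by (intro mult_mono power_mono) auto
      then show "norm (a p * monomial p w) \<le> cmod (a p) * r ^ total_degree p"
        by (auto simp: monomial_def total_degree_def power_add norm_mult norm_power intro!: mult_left_mono)
    next
      fix w assume "w \<in> ?U"
      then show "((\<lambda>p. a p * monomial p w) has_sum f w) UNIV"
        using sub assms by (auto simp: has_taylor_iff)
    qed
    then have "continuous_on ?U f"
      by (rule uniform_limit_theorem[rotated])
        (auto intro!: always_eventually continuous_intros simp: monomial_def)
    moreover have "open ?U" "z \<in> ?U" using r by (auto simp: open_Times mem_Times_iff)
    ultimately show ?thesis using continuous_on_eq_continuous_at by blast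
  qed
  then show ?thesis by (simp add: continuous_at_imp_continuous_on)
qed

lemma dilate_measurable:
  fixes f :: "complex \<times> complex \<Rightarrow> complex"
  assumes "continuous_on bidisk f" "0 \<le> r" "r < 1"
  shows "(\<lambda>\<zeta>. f (dilate r \<zeta>)) \<in> borel_measurable torus_measure"
proof -
  \<comment> \<open>Extension by 0 gives a Borel function on the whole space, which can be composed
    with the dilation.\<close>
  have 1: "(\<lambda>z. indicator bidisk z *\<^sub>R f z) \<in> borel_measurable borel"
    using assms(1) open_bidisk by (intro borel_measurable_continuous_on_indicator) auto
  have 2: "dilate r \<in> borel_measurable torus_measure"
    unfolding dilate_def[abs_def] by (intro borel_measurable_Pair borel_measurable_times) measurable
  show ?thesis
    using measurable_compose[OF 2 1] dilate_bidisk[OF _ assms(2,3)]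
    by (subst measurable_cong[where g = "\<lambda>\<zeta>. indicator bidisk (dilate r \<zeta>) *\<^sub>R f (dilate r \<zeta>)"])
      (auto simp: space_torus_measure)
qed

lemma continuous_dilate: "continuous_on S (dilate r)"
  unfolding dilate_def[abs_def] by (intro continuous_intros)

lemma dilate_bounded:
  assumes "continuous_on bidisk f" "0 \<le> r" "r < 1"
  obtains C where "\<And>\<zeta>. \<zeta> \<in> torus \<Longrightarrow> cmod (f (dilate r \<zeta>)) \<le> C"
proof -
  have "compact torus" by (simp add: torus_def compact_Times)
  moreover have "continuous_on torus (\<lambda>\<zeta>. f (dilate r \<zeta>))"
    by (rule continuous_on_compose2[OF assms(1) continuous_dilate]) (use dilate_bidisk[OF _ assms(2,3)] in blast)
  ultimately have "bounded ((\<lambda>\<zeta>. f (dilate r \<zeta>)) ` torus)"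
    by (intro compact_imp_bounded compact_continuous_image)
  then show ?thesis using that by (auto simp: bounded_iff)
qed

lemma dilate_L2:
  assumes "continuous_on bidisk f" "0 \<le> r" "r < 1"
  shows "(\<lambda>\<zeta>. f (dilate r \<zeta>)) \<in> L2 torus_measure"
  using dilate_bounded[OF assms] L2_torus_bounded[OF dilate_measurable[OF assms]] by metis

lemma has_taylor_inner_dilate:
  assumes "has_taylor f a" "has_taylor g b" "0 \<le> r" "r < 1"
  shows "((\<lambda>p. (of_real (r ^ total_degree p) * a p) * cnj (of_real (r ^ total_degree p) * b p)) has_sum
     L2_inner torus_measure (\<lambda>\<zeta>. f (dilate r \<zeta>)) (\<lambda>\<zeta>. g (dilate r \<zeta>))) UNIV"
  using torus_series_inner[OF has_taylor_dilate[OF assms(2-4)] torus_series_L2[OF has_taylor_dilate[OF assms(1,3,4)]]]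
  by (simp only: torus_series_coeff[OF has_taylor_dilate[OF assms(1,3,4)]] mult.commute)

subsection \<open>Holomorphic functions have Taylor series\<close>

text \<open>Termwise integration over the circle of radius r isolates the k-th Taylor coefficient
  times r^k. The radius only serves to find the coefficients, so z may lie anywhere in the disc,
  also beyond r.\<close>

lemma circle_Cauchy:
  assumes g: "g holomorphic_on ball 0 1" and r: "0 < r" "r < 1" and z: "cmod z < 1"
  shows "((\<lambda>k. z ^ k / of_real r ^ k * (\<integral>x. g (of_real r * x) * cnj x ^ k \<partial>circle_measure)) has_sum g z) UNIV"
proof -
  define c where "c k = (deriv ^^ k) g 0 / fact k" for k
  have sums: "(\<lambda>k. c k * w ^ k) sums g w" if "cmod w < 1" for w
    using holomorphic_power_series[OF g, of w] that by (simp add: c_def)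
  have abs: "summable (\<lambda>k. norm (c k * w ^ k))" if w: "cmod w < 1" for w
  proof -
    \<comment> \<open>A point of modulus strictly between that of \<open>w\<close> and 1;
      convergence at \<open>s\<close> gives absolute convergence at \<open>w\<close>.\<close>
    define s where "s = complex_of_real ((1 + cmod w) / 2)"
    have s: "cmod s = (1 + cmod w) / 2" by (simp only: s_def norm_of_real) simp
    have "cmod s < 1" "cmod w < cmod s" using w by (simp_all add: s)
    then show ?thesis using powser_insidea[of c s w] sums[of s] by (simp add: sums_iff)
  qed
  have hs: "((\<lambda>k. c k * w ^ k) has_sum g w) UNIV" if "cmod w < 1" for w
    by (rule norm_summable_imp_has_sum[OF abs[OF that] sums[OF that]])
  have coeff: "(\<integral>x. g (of_real r * x) * cnj x ^ k \<partial>circle_measure) = c k * of_real r ^ k" for k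
  proof -
    have "((\<lambda>j. \<integral>x. (c j * (of_real r * x) ^ j) * cnj x ^ k \<partial>circle_measure) has_sum
       (\<integral>x. g (of_real r * x) * cnj x ^ k \<partial>circle_measure)) UNIV"
    proof (rule integral_has_sum_nat(2)[where B = "\<lambda>j. norm (c j * of_real r ^ j)" and G = "\<lambda>_. 1"])
      show "integrable circle_measure (\<lambda>x. (c j * (of_real r * x) ^ j) * cnj x ^ k)" for j
        by (rule circ.integrable_const_bound[where B = "norm (c j * of_real r ^ j)"])
          (use measurable_id_circle in \<open>auto simp: space_circle_measure norm_mult norm_power
             intro!: borel_measurable_times borel_measurable_power borel_measurable_cnj\<close>)
      show "(\<lambda>j. norm (c j * of_real r ^ j)) summable_on UNIV"
        using abs[of "of_real r"] r by (simp add: summable_on_UNIV_nonneg_real_iff)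
      show "((\<lambda>j. (c j * (of_real r * x) ^ j) * cnj x ^ k) has_sum g (of_real r * x) * cnj x ^ k) UNIV"
        if "x \<in> space circle_measure" for x
        using that r by (intro has_sum_cmult_left hs) (auto simp: space_circle_measure norm_mult)
    qed (auto simp: space_circle_measure norm_mult norm_power)
    moreover have "(\<integral>x. (c j * (of_real r * x) ^ j) * cnj x ^ k \<partial>circle_measure) =
        (if j = k then c k * of_real r ^ k else 0)" for j
    proof -
      have "(\<integral>x. (c j * (of_real r * x) ^ j) * cnj x ^ k \<partial>circle_measure) =
         (c j * of_real r ^ j) * (\<integral>x. x ^ j * cnj x ^ k \<partial>circle_measure)"
        by (simp add: power_mult_distrib mult_ac flip: integral_mult_right_zero)
      then show ?thesis by (simp add: circle_integral_power)
    qed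
    ultimately have "((\<lambda>j. if j = k then c k * of_real r ^ k else 0) has_sum
       (\<integral>x. g (of_real r * x) * cnj x ^ k \<partial>circle_measure)) UNIV" by simp
    moreover have "((\<lambda>j. if j = k then c k * of_real r ^ k else 0) has_sum (c k * of_real r ^ k)) UNIV"
      using has_sum_single[of k "\<lambda>j. if j = k then c k * of_real r ^ k else 0"] by simp
    ultimately show ?thesis by (rule has_sum_unique)
  qed
  show ?thesis unfolding coeff using hs[OF z] r by (simp add: mult_ac)
qed

text \<open>The coefficients are Fourier coefficients on the torus of radius \<open>r\<close>, found by expanding in
  one variable at a time. They do not depend on \<open>r\<close>, since a smaller torus determines them.\<close>

lemma holomorphic_has_taylor:
  assumes cont: "continuous_on bidisk f"
    and hol1: "\<And>y. cmod y < 1 \<Longrightarrow> (\<lambda>x. f (x, y)) holomorphic_on ball 0 1"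
    and hol2: "\<And>x. cmod x < 1 \<Longrightarrow> (\<lambda>y. f (x, y)) holomorphic_on ball 0 1"
  shows "\<exists>a. has_taylor f a"
proof -
  define a where "a r p = L2_inner torus_measure (\<lambda>\<zeta>. f (dilate r \<zeta>)) (monomial p) / of_real (r ^ total_degree p)" for r p
  have local: "((\<lambda>p. a r p * monomial p z) has_sum f z) UNIV"
    if r: "0 < r" "r < 1" and z: "cmod (fst z) < r" "cmod (snd z) < r" for r z
  proof -
    obtain z1 z2 where [simp]: "z = (z1, z2)" by (cases z)
    obtain C where C: "\<And>\<zeta>. \<zeta> \<in> torus \<Longrightarrow> cmod (f (dilate r \<zeta>)) \<le> C"
      using dilate_bounded[OF cont, of r] r by auto
    define T where "T k l = L2_inner torus_measure (\<lambda>\<zeta>. f (dilate r \<zeta>)) (monomial (k, l))" for k l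
    define A where "A l x = (\<integral>y. f (dilate r (x, y)) * cnj y ^ l \<partial>circle_measure)" for l x
    have L: "(\<lambda>\<zeta>. f (dilate r \<zeta>)) \<in> L2 torus_measure" using r by (intro dilate_L2 cont) auto
    have int: "integrable torus_measure (\<lambda>\<zeta>. f (dilate r \<zeta>) * cnj (monomial (k, l) \<zeta>))" for k l
      by (intro L2_integrable_prod L monomial_L2)
    have inner: "(\<integral>y. f (dilate r (x, y)) * cnj (monomial (k, l) (x, y)) \<partial>circle_measure) = A l x * cnj x ^ k" for k l x
      by (simp add: A_def monomial_def mult_ac flip: integral_mult_right_zero)
    have T: "T k l = (\<integral>x. A l x * cnj x ^ k \<partial>circle_measure)" for k l
      unfolding T_def L2_inner_def by (subst integral_torus[OF int]) (simp only: inner)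
    have Aint: "integrable circle_measure (\<lambda>x. A l x * cnj x ^ k)" for k l
      using circ2.integrable_fst'[of "\<lambda>\<zeta>. f (dilate r \<zeta>) * cnj (monomial (k, l) \<zeta>)"] int[of k l]
      by (simp add: torus_measure_def inner)
    have C0: "C \<ge> 0" by (rule order_trans[OF norm_ge_zero C[of "(1,1)"]]) (simp add: torus_mem)
    have meas1: "emeasure circle_measure (space circle_measure) = 1"
      by (simp add: emeasure_circle_measure space_circle_measure)
    have Abound: "cmod (A l x) \<le> C" if "cmod x = 1" for l x
    proof -
      have "cmod (A l x) \<le> (\<integral>y. norm (f (dilate r (x, y)) * cnj y ^ l) \<partial>circle_measure)"
        unfolding A_def by (rule integral_norm_bound)
      also have "\<dots> \<le> (\<integral>y. C \<partial>circle_measure)"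
        by (rule integral_mono') (use C0 C that in \<open>auto simp: space_circle_measure norm_mult norm_power torus_mem\<close>)
      finally show ?thesis by (simp add: measure_def meas1)
    qed
    have Tbound: "cmod (T k l) \<le> C" for k l
    proof -
      have "cmod (T k l) \<le> (\<integral>x. norm (A l x * cnj x ^ k) \<partial>circle_measure)"
        unfolding T by (rule integral_norm_bound)
      also have "\<dots> \<le> (\<integral>y. C \<partial>circle_measure)"
        by (rule integral_mono') (use C0 Abound in \<open>auto simp: space_circle_measure norm_mult norm_power\<close>)
      finally show ?thesis by (simp add: measure_def meas1)
    qed
    have geo: "(\<lambda>l. (cmod w / r) ^ l) summable_on UNIV" if "cmod w < r" for w
      using that r by (subst summable_on_UNIV_nonneg_real_iff) (auto intro!: summable_geometric)
    have z2: "((\<lambda>l. z2 ^ l / of_real r ^ l * A l x) has_sum f (of_real r * x, z2)) UNIV" if "cmod x = 1" for x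
      using circle_Cauchy[OF hol2 r, of "of_real r * x" z2] z that r
      by (simp add: A_def dilate_def norm_mult)
    have inner_sum: "((\<lambda>l. z2 ^ l / of_real r ^ l * T k l) has_sum
       (\<integral>x. f (of_real r * x, z2) * cnj x ^ k \<partial>circle_measure)) UNIV" for k
    proof -
      have "((\<lambda>l. \<integral>x. (z2 ^ l / of_real r ^ l * A l x) * cnj x ^ k \<partial>circle_measure) has_sum
       (\<integral>x. f (of_real r * x, z2) * cnj x ^ k \<partial>circle_measure)) UNIV"
      proof (rule integral_has_sum_nat(2)[where B = "\<lambda>l. (cmod z2 / r) ^ l" and G = "\<lambda>_. C"])
        show "integrable circle_measure (\<lambda>x. (z2 ^ l / of_real r ^ l * A l x) * cnj x ^ k)" for l
          using Aint[of l k] by (simp add: mult.assoc)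
        show "cmod ((z2 ^ l / of_real r ^ l * A l x) * cnj x ^ k) \<le> (cmod z2 / r) ^ l * C"
          if "x \<in> space circle_measure" for l x
          using that Abound[of x l] r
          by (auto simp: space_circle_measure norm_mult norm_power norm_divide power_divide intro!: mult_left_mono divide_right_mono)
        show "((\<lambda>l. (z2 ^ l / of_real r ^ l * A l x) * cnj x ^ k) has_sum f (of_real r * x, z2) * cnj x ^ k) UNIV"
          if "x \<in> space circle_measure" for x
          using that by (intro has_sum_cmult_left z2) (auto simp: space_circle_measure)
      qed (use geo z in auto)
      moreover have "(\<integral>x. (z2 ^ l / of_real r ^ l * A l x) * cnj x ^ k \<partial>circle_measure) =
          z2 ^ l / of_real r ^ l * T k l" for l
        unfolding T by (simp add: mult.assoc)
      ultimately show ?thesis by (simp only:)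
    qed
    have outer_sum: "((\<lambda>k. z1 ^ k / of_real r ^ k * (\<integral>x. f (of_real r * x, z2) * cnj x ^ k \<partial>circle_measure))
        has_sum f (z1, z2)) UNIV"
      using circle_Cauchy[OF hol1 r, of z2 z1] z r by simp
    \<comment> \<open>Iterated sums alone do not give an unordered double sum. Since the integrals
      \<open>T k l\<close> are bounded by \<open>C\<close>, a double geometric series with ratios
      |z1|/r and |z2|/r dominates.\<close>
    have "(\<lambda>p. norm (a r p * monomial p z)) summable_on UNIV"
    proof (rule summable_on_comparison_test)
      have "((\<lambda>p. monomial p (of_real (cmod z1 / r), of_real (cmod z2 / r))) summable_on UNIV)"
        using r z by (intro has_sum_imp_summable[OF has_sum_monomial_geometric]) (auto simp: norm_divide)
      then have "(\<lambda>p. norm (monomial p (of_real (cmod z1 / r), of_real (cmod z2 / r)))) summable_on UNIV"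
        by (subst (asm) summable_on_iff_abs_summable_on_complex)
      from summable_on_cmult_right[OF this, of C]
      show "(\<lambda>p. C * norm (monomial p (of_real (cmod z1 / r), of_real (cmod z2 / r)))) summable_on UNIV" .
      show "norm (a r p * monomial p z) \<le> C * norm (monomial p (of_real (cmod z1 / r), of_real (cmod z2 / r)))" for p
      proof -
        have "norm (a r p * monomial p z) = cmod (T (fst p) (snd p)) * norm (monomial p (of_real (cmod z1 / r), of_real (cmod z2 / r)))"
          using r by (simp add: a_def T_def monomial_def norm_mult norm_divide norm_power power_divide total_degree_def power_add)
        then show ?thesis using Tbound by (simp add: mult_right_mono)
      qed
    qed auto
    then have abs: "(\<lambda>p. a r p * monomial p z) summable_on UNIV \<times> UNIV"
      by (simp add: abs_summable_summable)
    have "((\<lambda>p. a r p * monomial p z) has_sum f (z1, z2)) (UNIV \<times> UNIV)"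
    proof (rule has_sum_SigmaI[OF _ outer_sum abs])
      fix k
      have "a r (k, l) * monomial (k, l) z = z1 ^ k / of_real r ^ k * (z2 ^ l / of_real r ^ l * T k l)" for l
        by (simp add: a_def T_def monomial_def total_degree_def power_add mult_ac)
      then show "((\<lambda>l. a r (k, l) * monomial (k, l) z) has_sum
          z1 ^ k / of_real r ^ k * (\<integral>x. f (of_real r * x, z2) * cnj x ^ k \<partial>circle_measure)) UNIV"
        using has_sum_cmult_right[OF inner_sum[of k], of "z1 ^ k / of_real r ^ k"] by (simp only:)
    qed
    then show ?thesis by simp
  qed
  have indep: "a r = a s" if "0 < r" "r < 1" "0 < s" "s < 1" for r s
  proof -
    define t where "t = min r s / 2"
    have t: "0 < t" "t < r" "t < s" "t < 1" using that by (auto simp: t_def)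
    have "a u p * of_real (t ^ total_degree p) = L2_inner torus_measure (\<lambda>\<zeta>. f (dilate t \<zeta>)) (monomial p)"
      if u: "0 < u" "u < 1" "t < u" for u p
    proof (rule torus_series_coeff[symmetric])
      fix \<zeta> :: "complex \<times> complex" assume "\<zeta> \<in> torus"
      then have "((\<lambda>p. a u p * monomial p (dilate t \<zeta>)) has_sum f (dilate t \<zeta>)) UNIV"
        using t u by (intro local) (auto simp: torus_mem dilate_def norm_mult)
      then show "((\<lambda>p. a u p * of_real (t ^ total_degree p) * monomial p \<zeta>) has_sum f (dilate t \<zeta>)) UNIV"
        by (simp add: monomial_dilate mult.assoc)
    qed
    from this[of r] this[of s] have "a r p * of_real (t ^ total_degree p) = a s p * of_real (t ^ total_degree p)" for p
      using that t by simp
    then show ?thesis using t by (auto simp: fun_eq_iff)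
  qed
  have "has_taylor f (a (1/2))"
    unfolding has_taylor_iff
  proof
    fix z assume z: "z \<in> bidisk"
    define r where "r = (1 + max (cmod (fst z)) (cmod (snd z))) / 2"
    have r: "0 < r" "r < 1" "cmod (fst z) < r" "cmod (snd z) < r"
      using z by (auto simp: r_def bidisk_mem max_def add_pos_nonneg)
    then show "((\<lambda>p. a (1/2) p * monomial p z) has_sum f z) UNIV"
      using local[OF r] indep[of r "1/2"] by simp
  qed
  then show ?thesis by blast
qed

lemma holomorphic_bidisk_has_taylor:
  assumes "holomorphic_bidisk f"
  shows "\<exists>a. has_taylor f a"
proof (rule holomorphic_has_taylor)
  have D: "\<exists>a b. (f has_derivative (\<lambda>h. a * fst h + b * snd h)) (at (x, y))"
    if "cmod x < 1" "cmod y < 1" for x y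
    using assms that by (simp add: holomorphic_bidisk_def bidisk_mem)
  show "continuous_on bidisk f"
    using assms unfolding holomorphic_bidisk_def
    by (intro continuous_at_imp_continuous_on ballI) (blast intro: has_derivative_continuous)
  show "(\<lambda>x. f (x, y)) holomorphic_on ball 0 1" if y: "cmod y < 1" for y
    unfolding holomorphic_on_open[OF open_ball]
  proof
    fix x :: complex assume x: "x \<in> ball 0 1"
    then obtain a b where "(f has_derivative (\<lambda>h. a * fst h + b * snd h)) (at (x, y))"
      using D[of x y] y by auto
    moreover have "((\<lambda>x. (x, y)) has_derivative (\<lambda>h. (h, 0))) (at x)"
      by (intro derivative_eq_intros) auto
    ultimately have "((\<lambda>x. f (x, y)) has_derivative (\<lambda>h. a * h)) (at x)"
      using has_derivative_compose[of "\<lambda>x. (x, y)" "\<lambda>h. (h, 0)" x UNIV f] by force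
    then show "\<exists>f'. ((\<lambda>x. f (x, y)) has_field_derivative f') (at x)"
      by (auto simp: has_field_derivative_def)
  qed
  show "(\<lambda>y. f (x, y)) holomorphic_on ball 0 1" if x: "cmod x < 1" for x
    unfolding holomorphic_on_open[OF open_ball]
  proof
    fix y :: complex assume y: "y \<in> ball 0 1"
    then obtain a b where "(f has_derivative (\<lambda>h. a * fst h + b * snd h)) (at (x, y))"
      using D[of x y] x by auto
    moreover have "((\<lambda>y. (x, y)) has_derivative (\<lambda>h. (0, h))) (at y)"
      by (intro derivative_eq_intros) auto
    ultimately have "((\<lambda>y. f (x, y)) has_derivative (\<lambda>h. b * h)) (at y)"
      using has_derivative_compose[of "\<lambda>y. (x, y)" "\<lambda>h. (0, h)" y UNIV f] by force
    then show "\<exists>f'. ((\<lambda>y. f (x, y)) has_field_derivative f') (at y)"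
      by (auto simp: has_field_derivative_def)
  qed
qed

lemma has_taylor_mult:
  assumes f: "has_taylor f a" and g: "has_taylor g b"
  shows "\<exists>c. has_taylor (\<lambda>z. f z * g z) c"
proof -
  \<comment> \<open>The Cauchy product: the pair (p, p') is indexed by (p + p', p).
    \<open>N q\<close> holds the p below q in both entries, so the truncated subtraction in
    \<open>d q p\<close> is exact and each inner sum is finite.\<close>
  define N :: "(nat \<times> nat) \<Rightarrow> (nat \<times> nat) set" where "N q = {..fst q} \<times> {..snd q}" for q
  define d where "d q p = (fst q - fst p, snd q - snd p)" for q p :: "nat \<times> nat"
  define c where "c q = (\<Sum>p\<in>N q. a p * b (d q p))" for q
  have "has_taylor (\<lambda>z. f z * g z) c"
    unfolding has_taylor_iff
  proof
    fix z assume z: "z \<in> bidisk"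
    let ?F = "\<lambda>x. (a (fst x) * monomial (fst x) z) * (b (snd x) * monomial (snd x) z)"
    have "(?F has_sum f z * g z) UNIV"
      using has_sum_product_UNIV[of "\<lambda>p. a p * monomial p z" "f z" "\<lambda>p. b p * monomial p z" "g z"] f g z
      by (auto simp: has_taylor_iff)
    also have "?this \<longleftrightarrow> ((\<lambda>(q, p). a p * b (d q p) * monomial q z) has_sum f z * g z) (Sigma UNIV N)"
    proof (rule has_sum_reindex_bij_witness[where i = "\<lambda>(q, p). (p, d q p)"
          and j = "\<lambda>(p, p'). ((fst p + fst p', snd p + snd p'), p)"])
    qed (auto simp: N_def d_def monomial_def power_add)
    finally have "(c' has_sum f z * g z) UNIV" if "\<And>q. c' q = (\<Sum>p\<in>N q. a p * b (d q p) * monomial q z)" for c'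
      by (rule has_sum_SigmaD) (auto simp: that N_def intro!: has_sum_finiteI)
    then show "((\<lambda>q. c q * monomial q z) has_sum f z * g z) UNIV"
      by (simp add: c_def sum_distrib_right)
  qed
  then show ?thesis by blast
qed

section \<open>The Hardy space as a sequence space\<close>

text \<open>With counting measure the square-summable families are an instance of \<open>L2\<close>,
  so the Cauchy-Schwarz inequality, dominated convergence and continuity of the inner product apply
  to coefficients as they do to functions on the torus.\<close>

abbreviation ell2 :: "(nat \<times> nat) measure" where
  "ell2 \<equiv> count_space UNIV"

lemma ell2_iff: "a \<in> L2 ell2 \<longleftrightarrow> (\<lambda>p. (cmod (a p))\<^sup>2) summable_on UNIV"
proof -
  have "integrable ell2 (\<lambda>p. (cmod (a p))\<^sup>2) \<longleftrightarrow> (\<lambda>p. norm ((cmod (a p))\<^sup>2)) summable_on UNIV"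
    using abs_summable_equivalent[of "\<lambda>p. (cmod (a p))\<^sup>2" UNIV]
    by (simp add: Infinite_Set_Sum.abs_summable_on_def)
  then show ?thesis by (simp add: L2_def)
qed

lemma ell2_inner: "L2_inner ell2 a b = infsum (\<lambda>p. a p * cnj (b p)) UNIV"
proof (cases "(\<lambda>p. norm (a p * cnj (b p))) summable_on UNIV")
  case True
  then have "Infinite_Set_Sum.abs_summable_on (\<lambda>p. a p * cnj (b p)) UNIV"
    by (simp add: abs_summable_equivalent[symmetric])
  from infsetsum_infsum[OF this] show ?thesis
    by (simp add: L2_inner_def infsetsum_def)
next
  \<comment> \<open>Here the integral and the infinite sum both take their default value 0.\<close>
  case False
  then have "\<not> integrable ell2 (\<lambda>p. a p * cnj (b p))"
    using abs_summable_equivalent[of "\<lambda>p. a p * cnj (b p)" UNIV]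
    by (simp add: Infinite_Set_Sum.abs_summable_on_def)
  moreover have "\<not> (\<lambda>p. a p * cnj (b p)) summable_on UNIV"
    using False by (subst summable_on_iff_abs_summable_on_complex)
  ultimately show ?thesis
    by (simp add: L2_inner_def not_integrable_integral_eq infsum_not_exists)
qed

lemma ell2_norm: "a \<in> L2 ell2 \<Longrightarrow> L2_norm ell2 a = sqrt (infsum (\<lambda>p. (cmod (a p))\<^sup>2) UNIV)"
proof -
  assume "a \<in> L2 ell2"
  then have "(\<lambda>p. norm ((cmod (a p))\<^sup>2)) summable_on UNIV" by (simp add: ell2_iff)
  then have "Infinite_Set_Sum.abs_summable_on (\<lambda>p. (cmod (a p))\<^sup>2) UNIV"
    by (simp only: abs_summable_equivalent)
  from infsetsum_infsum[OF this] show ?thesis by (simp add: L2_norm_def infsetsum_def)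
qed

lemma ell2_norm_eq_0: "a \<in> L2 ell2 \<Longrightarrow> L2_norm ell2 a = 0 \<Longrightarrow> a = (\<lambda>p. 0)"
  by (subst (asm) L2_norm_eq_0_iff) (auto simp: AE_count_space)

lemma H2_taylor: "f \<in> H2 \<Longrightarrow> has_taylor f (taylor f)"
  and H2_taylor_L2: "f \<in> H2 \<Longrightarrow> taylor f \<in> L2 ell2"
  and H2_outside: "f \<in> H2 \<Longrightarrow> z \<notin> bidisk \<Longrightarrow> f z = 0"
  unfolding H2_def ell2_iff using taylor_eqI by blast+

lemma H2_I: "has_taylor f a \<Longrightarrow> a \<in> L2 ell2 \<Longrightarrow> (\<And>z. z \<notin> bidisk \<Longrightarrow> f z = 0) \<Longrightarrow> f \<in> H2"
  by (auto simp: H2_def ell2_iff)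

lemma H2_inner_ell2: "H2_inner f g = L2_inner ell2 (taylor f) (taylor g)"
  by (simp add: H2_inner_def ell2_inner)

lemma H2_norm_ell2: "f \<in> H2 \<Longrightarrow> H2_norm f = L2_norm ell2 (taylor f)"
  by (simp add: H2_norm_def ell2_norm H2_taylor_L2)

lemma has_taylor_ext:
  assumes "has_taylor f a" "has_taylor g a" "\<And>z. z \<notin> bidisk \<Longrightarrow> f z = g z"
  shows "f = g"
proof
  fix z show "f z = g z"
    using assms has_sum_unique unfolding has_taylor_iff by (cases "z \<in> bidisk") blast+
qed

lemma H2_ext: "f \<in> H2 \<Longrightarrow> g \<in> H2 \<Longrightarrow> taylor f = taylor g \<Longrightarrow> f = g"
  using has_taylor_ext[of f "taylor f" g] H2_taylor[of f] H2_taylor[of g] by (simp add: H2_outside)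

lemma has_taylor_add:
  "has_taylor f a \<Longrightarrow> has_taylor g b \<Longrightarrow> has_taylor (\<lambda>z. f z + g z) (\<lambda>p. a p + b p)"
  unfolding has_taylor_iff using has_sum_add by (fastforce simp: distrib_right)

lemma has_taylor_scale: "has_taylor f a \<Longrightarrow> has_taylor (\<lambda>z. c * f z) (\<lambda>p. c * a p)"
  unfolding has_taylor_iff by (simp add: has_sum_cmult_right mult.assoc)

lemma H2_scale:
  assumes "f \<in> H2"
  shows "(\<lambda>z. c * f z) \<in> H2" and "taylor (\<lambda>z. c * f z) = (\<lambda>p. c * taylor f p)"
proof -
  have t: "has_taylor (\<lambda>z. c * f z) (\<lambda>p. c * taylor f p)"
    by (rule has_taylor_scale[OF H2_taylor[OF assms]])
  from t show "taylor (\<lambda>z. c * f z) = (\<lambda>p. c * taylor f p)" by (rule taylor_eqI)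
  from t show "(\<lambda>z. c * f z) \<in> H2"
    by (rule H2_I) (auto intro: L2_scale H2_taylor_L2 assms simp: H2_outside[OF assms])
qed

lemma H2_add:
  assumes "f \<in> H2" "g \<in> H2"
  shows "(\<lambda>z. f z + g z) \<in> H2" and "taylor (\<lambda>z. f z + g z) = (\<lambda>p. taylor f p + taylor g p)"
proof -
  have t: "has_taylor (\<lambda>z. f z + g z) (\<lambda>p. taylor f p + taylor g p)"
    by (rule has_taylor_add[OF assms[THEN H2_taylor]])
  from t show "taylor (\<lambda>z. f z + g z) = (\<lambda>p. taylor f p + taylor g p)" by (rule taylor_eqI)
  from t show "(\<lambda>z. f z + g z) \<in> H2"
    by (rule H2_I) (auto intro: L2_add H2_taylor_L2 assms simp: assms[THEN H2_outside])
qed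

lemma H2_diff:
  assumes "f \<in> H2" "g \<in> H2"
  shows "(\<lambda>z. f z - g z) \<in> H2" and "taylor (\<lambda>z. f z - g z) = (\<lambda>p. taylor f p - taylor g p)"
  using H2_add[OF assms(1) H2_scale(1)[OF assms(2), of "-1"]] H2_scale(2)[OF assms(2), of "-1"]
  by simp_all

lemma H2_zero: "(\<lambda>z. 0) \<in> H2" and taylor_zero: "taylor (\<lambda>z. 0) = (\<lambda>p. 0)"
proof -
  have t: "has_taylor (\<lambda>z. 0) (\<lambda>p. 0)" by (simp add: has_taylor_iff)
  then show "(\<lambda>z. 0) \<in> H2" by (rule H2_I) (auto simp: ell2_iff)
  from t show "taylor (\<lambda>z. 0) = (\<lambda>p. 0)" by (rule taylor_eqI)
qed

definition power_series :: "(nat \<times> nat \<Rightarrow> complex) \<Rightarrow> complex \<times> complex \<Rightarrow> complex" where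
  "power_series a = on_bidisk (\<lambda>z. infsum (\<lambda>p. a p * monomial p z) UNIV)"

text \<open>The squared moduli form a double geometric series with the squared moduli of the
  coordinates as ratios. Hence every square-summable family defines a convergent power series, and
  the Szego kernels lie in \<open>H2\<close>.\<close>

lemma monomial_L2_ell2:
  assumes "z \<in> bidisk"
  shows "(\<lambda>p. monomial p z) \<in> L2 ell2"
proof -
  have "(\<lambda>p. monomial p (z1, z2)) summable_on UNIV" if "cmod z1 < 1" "cmod z2 < 1" for z1 z2
    using has_sum_monomial_geometric[OF that] by (rule has_sum_imp_summable)
  from this[of "of_real ((cmod (fst z))\<^sup>2)" "of_real ((cmod (snd z))\<^sup>2)"] assms
  have "(\<lambda>p. norm (monomial p (of_real ((cmod (fst z))\<^sup>2), of_real ((cmod (snd z))\<^sup>2)))) summable_on UNIV"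
    by (subst summable_on_iff_abs_summable_on_complex[symmetric])
      (simp add: bidisk_mem norm_power power_less_one_iff del: of_real_power)
  moreover have "norm (monomial p (of_real ((cmod (fst z))\<^sup>2), of_real ((cmod (snd z))\<^sup>2))) = (cmod (monomial p z))\<^sup>2" for p
    by (simp add: monomial_def norm_mult norm_power power_mult_distrib power_mult[symmetric] mult.commute)
  ultimately show ?thesis by (simp add: ell2_iff)
qed

lemma ell2_prod_summable:
  assumes "a \<in> L2 ell2" "b \<in> L2 ell2"
  shows "(\<lambda>p. a p * cnj (b p)) summable_on UNIV"
proof -
  have "Infinite_Set_Sum.abs_summable_on (\<lambda>p. a p * cnj (b p)) UNIV"
    using L2_integrable_prod[OF assms] by (simp add: Infinite_Set_Sum.abs_summable_on_def)
  then show ?thesis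
    by (simp add: abs_summable_equivalent[symmetric] abs_summable_summable)
qed

lemma has_taylor_power_series:
  assumes "a \<in> L2 ell2"
  shows "has_taylor (power_series a) a"
  unfolding has_taylor_iff
proof
  fix z assume z: "z \<in> bidisk"
  then have "(cnj (fst z), cnj (snd z)) \<in> bidisk" by (simp add: bidisk_mem)
  from ell2_prod_summable[OF assms monomial_L2_ell2[OF this]]
  have "(\<lambda>p. a p * monomial p z) summable_on UNIV" by (simp add: monomial_def)
  then show "((\<lambda>p. a p * monomial p z) has_sum power_series a z) UNIV"
    using z by (simp add: power_series_def on_bidisk_def)
qed

lemma power_series_H2: "a \<in> L2 ell2 \<Longrightarrow> power_series a \<in> H2"
  and taylor_power_series: "a \<in> L2 ell2 \<Longrightarrow> taylor (power_series a) = a"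
  using has_taylor_power_series
  by (auto intro!: H2_I taylor_eqI simp: power_series_def on_bidisk_def)

subsection \<open>Radial dilations\<close>

text \<open>A sequence rather than a continuous parameter, to suit dominated convergence and Fatou's
  lemma. It starts at 1/2, so that no dilation is degenerate and dilated torus points keep a nonzero
  first coordinate.\<close>

definition radius :: "nat \<Rightarrow> real" where
  "radius n = real (Suc n) / real (Suc (Suc n))"

lemma radius_bounds: "0 \<le> radius n" "0 < radius n" "radius n < 1"
  by (auto simp: radius_def)

lemma radius_tendsto: "radius \<longlonglongrightarrow> 1"
  unfolding radius_def[abs_def] using LIMSEQ_Suc[OF LIMSEQ_n_over_Suc_n] by simp

definition radial :: "nat \<Rightarrow> (complex \<times> complex \<Rightarrow> complex) \<Rightarrow> complex \<times> complex \<Rightarrow> complex" where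
  "radial n f \<zeta> = f (dilate (radius n) \<zeta>)"

definition radial_coeff :: "nat \<Rightarrow> (nat \<times> nat \<Rightarrow> complex) \<Rightarrow> nat \<times> nat \<Rightarrow> complex" where
  "radial_coeff n a p = of_real (radius n ^ total_degree p) * a p"

lemma radius_power_le: "radius n ^ k \<le> 1"
  using radius_bounds[of n] by (simp add: power_le_one)

lemma radial_coeff_L2: "a \<in> L2 ell2 \<Longrightarrow> radial_coeff n a \<in> L2 ell2"
  and radial_coeff_norm: "a \<in> L2 ell2 \<Longrightarrow> L2_norm ell2 (radial_coeff n a) \<le> L2_norm ell2 a"
  using L2_mult_bounded[of a ell2 "\<lambda>p. of_real (radius n ^ total_degree p)" 1] radius_power_le[of n] radius_bounds(1)[of n]
  by (simp_all add: radial_coeff_def[abs_def] norm_power)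

text \<open>Dominated convergence for counting measure: the multipliers r^k - 1 are at most 1 in
  modulus and tend to 0 for each index.\<close>

lemma radial_coeff_tendsto:
  assumes "a \<in> L2 ell2"
  shows "(\<lambda>n. L2_norm ell2 (\<lambda>p. radial_coeff n a p - a p)) \<longlonglongrightarrow> 0"
proof -
  have "(\<lambda>n. L2_norm ell2 (\<lambda>p. (of_real (radius n ^ total_degree p) - 1) * a p)) \<longlonglongrightarrow> 0"
  proof (rule L2_mult_tendsto_0[OF assms, where C = 1])
    show "AE p in ell2. cmod (of_real (radius n ^ total_degree p) - 1) \<le> 1" for n
    proof (rule AE_I2)
      fix p
      have "cmod (of_real (radius n ^ total_degree p) - 1) = \<bar>radius n ^ total_degree p - 1\<bar>"
        by (metis norm_of_real of_real_1 of_real_diff)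
      then show "cmod (of_real (radius n ^ total_degree p) - 1) \<le> 1"
        using radius_power_le[of n "total_degree p"] radius_bounds(1)[of n] by simp
    qed
    have "(\<lambda>n. of_real (radius n ^ total_degree p) - 1) \<longlonglongrightarrow> of_real (1 ^ total_degree p) - (1::complex)" for p
      by (intro tendsto_intros radius_tendsto)
    then show "AE p in ell2. (\<lambda>n. of_real (radius n ^ total_degree p) - 1) \<longlonglongrightarrow> (0::complex)"
      by simp
  qed auto
  then show ?thesis by (simp add: radial_coeff_def algebra_simps)
qed

lemma torus_series_isometry:
  assumes "\<And>\<zeta>. \<zeta> \<in> torus \<Longrightarrow> ((\<lambda>p. a p * monomial p \<zeta>) has_sum f \<zeta>) UNIV"
    and "\<And>\<zeta>. \<zeta> \<in> torus \<Longrightarrow> ((\<lambda>p. b p * monomial p \<zeta>) has_sum g \<zeta>) UNIV"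
  shows "L2_inner torus_measure f g = L2_inner ell2 a b"
  using torus_series_inner[OF assms(2) torus_series_L2[OF assms(1)]]
  by (simp add: torus_series_coeff[OF assms(1)] ell2_inner infsumI mult.commute)

lemma has_taylor_radial:
  "has_taylor f a \<Longrightarrow> \<zeta> \<in> torus \<Longrightarrow> ((\<lambda>p. radial_coeff n a p * monomial p \<zeta>) has_sum radial n f \<zeta>) UNIV"
  using has_taylor_dilate[OF _ radius_bounds(1,3)] by (simp add: radial_coeff_def radial_def)

lemma radial_L2: "continuous_on bidisk f \<Longrightarrow> radial n f \<in> L2 torus_measure"
  using dilate_L2[OF _ radius_bounds(1,3)] by (simp add: radial_def[abs_def])

lemma has_taylor_radial_L2: "has_taylor f a \<Longrightarrow> radial n f \<in> L2 torus_measure"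
  by (intro radial_L2 has_taylor_continuous)

lemma radial_inner:
  assumes "has_taylor f a" "has_taylor g b"
  shows "L2_inner torus_measure (radial n f) (radial n g) = L2_inner ell2 (radial_coeff n a) (radial_coeff n b)"
  by (intro torus_series_isometry has_taylor_radial assms)

text \<open>Both arguments move, so one is changed at a time; the Cauchy-Schwarz inequality handles
  the first change, since dilation does not increase the norm of the other argument.\<close>

lemma radial_coeff_inner_tendsto:
  assumes a: "a \<in> L2 ell2" and b: "b \<in> L2 ell2"
  shows "(\<lambda>n. L2_inner ell2 (radial_coeff n a) (radial_coeff n b)) \<longlonglongrightarrow> L2_inner ell2 a b"
proof -
  have "(\<lambda>n. L2_inner ell2 (\<lambda>p. radial_coeff n a p - a p) (radial_coeff n b)) \<longlonglongrightarrow> 0"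
  proof (rule Lim_null_comparison)
    show "\<forall>\<^sub>F n in sequentially. norm (L2_inner ell2 (\<lambda>p. radial_coeff n a p - a p) (radial_coeff n b))
       \<le> L2_norm ell2 (\<lambda>p. radial_coeff n a p - a p) * L2_norm ell2 b"
    proof (intro always_eventually allI)
      fix n
      have "norm (L2_inner ell2 (\<lambda>p. radial_coeff n a p - a p) (radial_coeff n b))
         \<le> L2_norm ell2 (\<lambda>p. radial_coeff n a p - a p) * L2_norm ell2 (radial_coeff n b)"
        by (intro L2_Cauchy_Schwarz L2_diff radial_coeff_L2 a b)
      also have "\<dots> \<le> L2_norm ell2 (\<lambda>p. radial_coeff n a p - a p) * L2_norm ell2 b"
        by (intro mult_left_mono radial_coeff_norm b L2_norm_nonneg)
      finally show "norm (L2_inner ell2 (\<lambda>p. radial_coeff n a p - a p) (radial_coeff n b))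
         \<le> L2_norm ell2 (\<lambda>p. radial_coeff n a p - a p) * L2_norm ell2 b" .
    qed
    show "(\<lambda>n. L2_norm ell2 (\<lambda>p. radial_coeff n a p - a p) * L2_norm ell2 b) \<longlonglongrightarrow> 0"
      using tendsto_mult_right[OF radial_coeff_tendsto[OF a], of "L2_norm ell2 b"] by simp
  qed
  moreover have "(\<lambda>n. L2_inner ell2 a (radial_coeff n b)) \<longlonglongrightarrow> L2_inner ell2 a b"
    by (intro L2_inner_tendsto_right radial_coeff_L2 a b radial_coeff_tendsto)
  ultimately have "(\<lambda>n. L2_inner ell2 (\<lambda>p. radial_coeff n a p - a p) (radial_coeff n b) + L2_inner ell2 a (radial_coeff n b)) \<longlonglongrightarrow> 0 + L2_inner ell2 a b"
    by (rule tendsto_add)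
  then show ?thesis
    by (simp add: L2_inner_diff_left radial_coeff_L2 a b)
qed

text \<open>The working substitute for integrating a product of boundary functions: an inner product
  in \<open>H2\<close> is a limit of integrals of honest pointwise products.\<close>

lemma radial_inner_tendsto:
  assumes "f \<in> H2" "g \<in> H2"
  shows "(\<lambda>n. L2_inner torus_measure (radial n f) (radial n g)) \<longlonglongrightarrow> H2_inner f g"
  using radial_coeff_inner_tendsto[OF assms[THEN H2_taylor_L2]]
  by (simp add: radial_inner[OF assms[THEN H2_taylor]] H2_inner_ell2)

lemma radial_norm:
  assumes "has_taylor f a"
  shows "L2_norm torus_measure (radial n f) = L2_norm ell2 (radial_coeff n a)"
  using radial_inner[OF assms assms, of n] by (simp add: L2_inner_self L2_norm_nonneg flip: of_real_power)

lemma radial_norm_le: "f \<in> H2 \<Longrightarrow> L2_norm torus_measure (radial n f) \<le> H2_norm f"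
  by (simp add: radial_norm[OF H2_taylor] H2_norm_ell2 radial_coeff_norm H2_taylor_L2)

text \<open>By Parseval's identity the distance of two dilates is the distance of their coefficient
  families, and these converge to \<open>taylor f\<close>.\<close>

lemma radial_Cauchy:
  assumes "f \<in> H2"
  shows "L2_Cauchy torus_measure (\<lambda>n. radial n f)"
  unfolding L2_Cauchy_def
proof (intro conjI allI impI)
  show "radial n f \<in> L2 torus_measure" for n by (rule has_taylor_radial_L2[OF H2_taylor[OF assms]])
  fix e :: real assume "e > 0"
  let ?a = "taylor f"
  have a: "?a \<in> L2 ell2" by (rule H2_taylor_L2[OF assms])
  obtain N where N: "L2_norm ell2 (\<lambda>p. radial_coeff n ?a p - ?a p) < e / 2" if "n \<ge> N" for n
    using LIMSEQ_D[OF radial_coeff_tendsto[OF a], of "e/2"] \<open>e > 0\<close> by (auto simp: L2_norm_nonneg)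
  have "L2_norm torus_measure (\<lambda>\<zeta>. radial m f \<zeta> - radial n f \<zeta>) < e" if "m \<ge> N" "n \<ge> N" for m n
  proof -
    have s: "((\<lambda>p. (radial_coeff m ?a p - radial_coeff n ?a p) * monomial p \<zeta>) has_sum radial m f \<zeta> - radial n f \<zeta>) UNIV" if "\<zeta> \<in> torus" for \<zeta>
      using has_sum_add[OF has_taylor_radial[OF H2_taylor[OF assms] that, of m]
          has_sum_cmult_right[OF has_taylor_radial[OF H2_taylor[OF assms] that, of n], of "-1"]]
      by (simp add: left_diff_distrib)
    have "L2_norm torus_measure (\<lambda>\<zeta>. radial m f \<zeta> - radial n f \<zeta>) = L2_norm ell2 (\<lambda>p. radial_coeff m ?a p - radial_coeff n ?a p)"
      using torus_series_isometry[OF s s] by (simp add: L2_inner_self L2_norm_nonneg flip: of_real_power)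
    also have "\<dots> = L2_norm ell2 (\<lambda>p. (radial_coeff m ?a p - ?a p) + (?a p - radial_coeff n ?a p))" by simp
    also have "\<dots> \<le> L2_norm ell2 (\<lambda>p. radial_coeff m ?a p - ?a p) + L2_norm ell2 (\<lambda>p. ?a p - radial_coeff n ?a p)"
      by (intro L2_norm_triangle L2_diff radial_coeff_L2 a)
    also have "\<dots> < e"
      using N[OF \<open>m \<ge> N\<close>] N[OF \<open>n \<ge> N\<close>] by (simp add: L2_norm_minus_commute[of ell2 ?a])
    finally show ?thesis .
  qed
  then show "\<exists>N. \<forall>m\<ge>N. \<forall>n\<ge>N. L2_norm torus_measure (\<lambda>x. radial m f x - radial n f x) < e" by blast
qed

text \<open>Bounded integral means characterise the Hardy space: each finite partial sum of the
  weighted squares is at most \<open>C\<^sup>2\<close>, and the weights tend to 1. This puts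
  products into \<open>H2\<close> without an estimate of their coefficients.\<close>

lemma H2_radial_boundedI:
  assumes t: "has_taylor f a" and out: "\<And>z. z \<notin> bidisk \<Longrightarrow> f z = 0"
    and le: "\<And>n. L2_norm torus_measure (radial n f) \<le> C"
  shows "f \<in> H2"
proof (rule H2_I[OF t _ out])
  have "(\<Sum>p\<in>F. (cmod (a p))\<^sup>2) \<le> C\<^sup>2" if "finite F" for F
  proof (rule LIMSEQ_le_const2)
    show "(\<lambda>n. \<Sum>p\<in>F. (cmod (radial_coeff n a p))\<^sup>2) \<longlonglongrightarrow> (\<Sum>p\<in>F. (cmod (a p))\<^sup>2)"
    proof (intro tendsto_intros)
      fix p
      have "(\<lambda>n. radial_coeff n a p) \<longlonglongrightarrow> of_real (1 ^ total_degree p) * a p"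
        unfolding radial_coeff_def by (intro tendsto_intros radius_tendsto)
      then show "(\<lambda>n. radial_coeff n a p) \<longlonglongrightarrow> a p" by simp
    qed
    have "(\<Sum>p\<in>F. (cmod (radial_coeff n a p))\<^sup>2) \<le> C\<^sup>2" for n
    proof -
      have radial_coeff: "((\<lambda>p. radial_coeff n a p * cnj (radial_coeff n a p)) has_sum L2_inner torus_measure (radial n f) (radial n f)) UNIV"
        using has_taylor_inner_dilate[OF t t radius_bounds(1,3)] by (simp add: radial_coeff_def radial_def[abs_def])
      then have "((\<lambda>p. of_real ((cmod (radial_coeff n a p))\<^sup>2)) has_sum (of_real ((L2_norm torus_measure (radial n f))\<^sup>2) :: complex)) UNIV"
        unfolding L2_inner_self complex_norm_square[symmetric] .
      then have "((\<lambda>p. (cmod (radial_coeff n a p))\<^sup>2) has_sum (L2_norm torus_measure (radial n f))\<^sup>2) UNIV"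
        by (simp only: has_sum_of_real_iff)
      then have "(\<Sum>p\<in>F. (cmod (radial_coeff n a p))\<^sup>2) \<le> (L2_norm torus_measure (radial n f))\<^sup>2"
        using has_sum_mono2[OF has_sum_finite[OF that]] by fastforce
      also have "\<dots> \<le> C\<^sup>2" using le by (intro power_mono) (auto simp: L2_norm_nonneg)
      finally show ?thesis .
    qed
    then show "\<exists>N. \<forall>n\<ge>N. (\<Sum>p\<in>F. (cmod (radial_coeff n a p))\<^sup>2) \<le> C\<^sup>2" by blast
  qed
  then show "a \<in> L2 ell2"
    unfolding ell2_iff by (intro nonneg_bdd_above_summable_on) (auto simp: bdd_above_def)
qed

lemma H2_mult_bounded:
  assumes m: "has_taylor m c" and bd: "\<And>z. z \<in> bidisk \<Longrightarrow> cmod (m z) \<le> C" and f: "f \<in> H2"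
  shows "(\<lambda>z. m z * f z) \<in> H2"
proof -
  obtain d where d: "has_taylor (\<lambda>z. m z * f z) d"
    using has_taylor_mult[OF m H2_taylor[OF f]] by blast
  have C: "C \<ge> 0" using order_trans[OF norm_ge_zero bd[of "(0,0)"]] by (simp add: bidisk_mem)
  show ?thesis
  proof (rule H2_radial_boundedI[OF d])
    show "m z * f z = 0" if "z \<notin> bidisk" for z using f that by (simp add: H2_outside)
    show "L2_norm torus_measure (radial n (\<lambda>z. m z * f z)) \<le> C * H2_norm f" for n
    proof -
      have "L2_norm torus_measure (\<lambda>\<zeta>. radial n m \<zeta> * radial n f \<zeta>) \<le> C * L2_norm torus_measure (radial n f)"
      proof (rule L2_mult_bounded(2)[OF has_taylor_radial_L2[OF H2_taylor[OF f]] _ _ C])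
        show "radial n m \<in> borel_measurable torus_measure"
          by (rule L2_measurable[OF has_taylor_radial_L2[OF m]])
        show "AE \<zeta> in torus_measure. cmod (radial n m \<zeta>) \<le> C"
          by (rule AE_I2) (simp add: radial_def bd dilate_bidisk radius_bounds space_torus_measure)
      qed
      also have "\<dots> \<le> C * H2_norm f" by (intro mult_left_mono radial_norm_le f C)
      finally show ?thesis by (simp add: radial_def[abs_def])
    qed
  qed
qed

text \<open>The distance from x to r x is exactly 1 - r, so the strict inequality holds with
  aperture 2.\<close>

lemma stolz_radial:
  assumes "cmod x = 1"
  shows "of_real (radius n) * x \<in> stolz 2 x"
proof -
  have "cmod (x - of_real (radius n) * x) = cmod (of_real (1 - radius n) * x)"
    by (simp add: algebra_simps)
  also have "\<dots> = 1 - radius n" using radius_bounds[of n] assms by (simp add: norm_mult del: of_real_diff)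
  finally show ?thesis using radius_bounds[of n] assms by (simp add: stolz_def norm_mult)
qed

lemma nt_limit_radial:
  assumes "nt_limit f \<zeta> l" "\<zeta> \<in> torus"
  shows "(\<lambda>n. radial n f \<zeta>) \<longlonglongrightarrow> l"
proof -
  have "(f \<longlongrightarrow> l) (at \<zeta> within stolz 2 (fst \<zeta>) \<times> stolz 2 (snd \<zeta>))"
    using assms(1) by (simp add: nt_limit_def)
  moreover have "filterlim (\<lambda>n. dilate (radius n) \<zeta>) (at \<zeta> within stolz 2 (fst \<zeta>) \<times> stolz 2 (snd \<zeta>)) sequentially"
  proof (subst filterlim_at, intro conjI always_eventually allI)
    show "dilate (radius n) \<zeta> \<in> stolz 2 (fst \<zeta>) \<times> stolz 2 (snd \<zeta>)" for n
      using assms(2) by (auto simp: dilate_def torus_mem intro: stolz_radial)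
    \<comment> \<open>The filter \<open>at\<close> leaves out the point itself; the dilated point is
      interior to the bidisk and \<open>\<zeta>\<close> is not.\<close>
    show "dilate (radius n) \<zeta> \<noteq> \<zeta>" for n
      using assms(2) dilate_bidisk[OF assms(2) radius_bounds(1,3), of n] by (auto simp: torus_mem bidisk_mem)
    have "(\<lambda>n. dilate (radius n) \<zeta>) \<longlonglongrightarrow> (of_real 1 * fst \<zeta>, of_real 1 * snd \<zeta>)"
      unfolding dilate_def by (intro tendsto_intros radius_tendsto)
    then show "(\<lambda>n. dilate (radius n) \<zeta>) \<longlonglongrightarrow> \<zeta>" by simp
  qed
  ultimately show ?thesis
    unfolding radial_def by (rule filterlim_compose)
qed

lemma boundary_values_radial:
  "boundary_values f F \<Longrightarrow> AE \<zeta> in torus_measure. (\<lambda>n. radial n f \<zeta>) \<longlonglongrightarrow> F \<zeta>"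
  unfolding boundary_values_def
  by (auto elim!: eventually_mono[rotated] simp: nt_limit_radial space_torus_measure
      intro: AE_mp AE_I2)

lemma boundary_values_L2:
  assumes "f \<in> H2" "boundary_values f F"
  shows "F \<in> L2 torus_measure" "(\<lambda>n. L2_norm torus_measure (\<lambda>\<zeta>. radial n f \<zeta> - F \<zeta>)) \<longlonglongrightarrow> 0"
  using L2_Cauchy_AE_limit[OF radial_Cauchy[OF assms(1)] _ boundary_values_radial[OF assms(2)]] assms(2)
  by (auto simp: boundary_values_def)

subsection \<open>Multiplication by an inner function\<close>

lemma inner_function_taylor:
  assumes "inner_function \<phi>"
  obtains c where "has_taylor \<phi> c"
  using assms holomorphic_bidisk_has_taylor unfolding inner_function_def by blast

lemma inner_function_bounded:
  assumes "inner_function \<phi>"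
  obtains C where "\<And>z. z \<in> bidisk \<Longrightarrow> cmod (\<phi> z) \<le> C"
  using assms unfolding inner_function_def bounded_iff by blast

lemma inner_mult_H2:
  assumes "inner_function \<phi>" "f \<in> H2"
  shows "(\<lambda>z. \<phi> z * f z) \<in> H2"
proof -
  obtain c where "has_taylor \<phi> c" using inner_function_taylor[OF assms(1)] .
  moreover obtain C where "\<And>z. z \<in> bidisk \<Longrightarrow> cmod (\<phi> z) \<le> C"
    using inner_function_bounded[OF assms(1)] by metis
  ultimately show ?thesis using H2_mult_bounded assms(2) by blast
qed

text \<open>On the dilated torus the two inner products differ by the pairing of
  \<open>m n * radial n f\<close> with \<open>radial n g\<close>, where \<open>m n\<close> is the
  squared modulus of the dilated \<phi> minus 1. Radial limits of modulus 1 make \<open>m n\<close>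
  tend to 0 almost everywhere, and it is bounded. As \<open>radial n f\<close> varies as well, the
  version for Cauchy sequences is required.\<close>

lemma inner_mult_isometry:
  assumes \<phi>: "inner_function \<phi>" and f: "f \<in> H2" and g: "g \<in> H2"
  shows "H2_inner (\<lambda>z. \<phi> z * f z) (\<lambda>z. \<phi> z * g z) = H2_inner f g"
proof -
  obtain c where c: "has_taylor \<phi> c" using inner_function_taylor[OF \<phi>] .
  obtain C where C: "\<And>z. z \<in> bidisk \<Longrightarrow> cmod (\<phi> z) \<le> C" using inner_function_bounded[OF \<phi>] by metis
  have C0: "C \<ge> 0" using order_trans[OF norm_ge_zero C[of "(0,0)"]] by (simp add: bidisk_mem)
  define m where "m n \<zeta> = radial n \<phi> \<zeta> * cnj (radial n \<phi> \<zeta>) - 1" for n \<zeta>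
  have dC: "cmod (radial n \<phi> \<zeta>) \<le> C" if "\<zeta> \<in> torus" for n \<zeta>
    using that by (simp add: radial_def C dilate_bidisk radius_bounds)
  have mm: "m n \<in> borel_measurable torus_measure" for n
    unfolding m_def[abs_def] using L2_measurable[OF has_taylor_radial_L2[OF c, of n]] by measurable
  have mb: "AE \<zeta> in torus_measure. cmod (m n \<zeta>) \<le> C * C + 1" for n
  proof (rule AE_I2)
    fix \<zeta> assume "\<zeta> \<in> space torus_measure"
    then have "cmod (radial n \<phi> \<zeta> * cnj (radial n \<phi> \<zeta>)) \<le> C * C"
      by (auto simp: norm_mult space_torus_measure C0 dC intro!: mult_mono)
    then show "cmod (m n \<zeta>) \<le> C * C + 1"
      unfolding m_def using norm_triangle_ineq4[of "radial n \<phi> \<zeta> * cnj (radial n \<phi> \<zeta>)" 1] by simp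
  qed
  have "AE \<zeta> in torus_measure. \<exists>l. nt_limit \<phi> \<zeta> l \<and> cmod l = 1"
    using \<phi> by (simp add: inner_function_def)
  then have "AE \<zeta> in torus_measure. (\<lambda>n. m n \<zeta>) \<longlonglongrightarrow> 0"
  proof (rule AE_mp, intro AE_I2 impI)
    fix \<zeta> assume \<zeta>: "\<zeta> \<in> space torus_measure" and "\<exists>l. nt_limit \<phi> \<zeta> l \<and> cmod l = 1"
    then obtain l where l: "nt_limit \<phi> \<zeta> l" "cmod l = 1" by blast
    have "(\<lambda>n. m n \<zeta>) \<longlonglongrightarrow> l * cnj l - 1"
      unfolding m_def using nt_limit_radial[OF l(1)] \<zeta> by (intro tendsto_intros) (auto simp: space_torus_measure)
    then show "(\<lambda>n. m n \<zeta>) \<longlonglongrightarrow> 0" using l(2) complex_norm_square[of l] by simp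
  qed
  then have lim: "(\<lambda>n. L2_norm torus_measure (\<lambda>\<zeta>. m n \<zeta> * radial n f \<zeta>)) \<longlonglongrightarrow> 0"
    using C0 by (intro L2_Cauchy_mult_tendsto_0[OF radial_Cauchy[OF f] mm mb]) auto
  have L: "(\<lambda>\<zeta>. m n \<zeta> * radial n f \<zeta>) \<in> L2 torus_measure" for n
    using C0 by (intro L2_mult_bounded(1)[OF has_taylor_radial_L2[OF H2_taylor[OF f]] mm mb]) auto
  have dg: "radial n g \<in> L2 torus_measure" and df: "radial n f \<in> L2 torus_measure" for n
    by (rule has_taylor_radial_L2[OF H2_taylor], fact)+
  have "(\<lambda>n. L2_inner torus_measure (\<lambda>\<zeta>. m n \<zeta> * radial n f \<zeta>) (radial n g)) \<longlonglongrightarrow> 0"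
  proof (rule Lim_null_comparison)
    show "\<forall>\<^sub>F n in sequentially. norm (L2_inner torus_measure (\<lambda>\<zeta>. m n \<zeta> * radial n f \<zeta>) (radial n g))
       \<le> L2_norm torus_measure (\<lambda>\<zeta>. m n \<zeta> * radial n f \<zeta>) * H2_norm g"
      by (intro always_eventually allI order_trans[OF L2_Cauchy_Schwarz[OF L dg]] mult_left_mono radial_norm_le g L2_norm_nonneg)
    show "(\<lambda>n. L2_norm torus_measure (\<lambda>\<zeta>. m n \<zeta> * radial n f \<zeta>) * H2_norm g) \<longlonglongrightarrow> 0"
      using tendsto_mult_right[OF lim, of "H2_norm g"] by simp
  qed
  moreover have "L2_inner torus_measure (\<lambda>\<zeta>. m n \<zeta> * radial n f \<zeta>) (radial n g) =
      L2_inner torus_measure (radial n (\<lambda>z. \<phi> z * f z)) (radial n (\<lambda>z. \<phi> z * g z)) - L2_inner torus_measure (radial n f) (radial n g)" for n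
  proof -
    have "L2_inner torus_measure (\<lambda>\<zeta>. m n \<zeta> * radial n f \<zeta> + radial n f \<zeta>) (radial n g) =
        L2_inner torus_measure (radial n (\<lambda>z. \<phi> z * f z)) (radial n (\<lambda>z. \<phi> z * g z))"
      unfolding L2_inner_def by (simp add: m_def radial_def algebra_simps)
    then show ?thesis using L2_inner_add_left[OF L df dg, of n n n] by (simp add: eq_diff_eq)
  qed
  ultimately have "(\<lambda>n. L2_inner torus_measure (radial n (\<lambda>z. \<phi> z * f z)) (radial n (\<lambda>z. \<phi> z * g z))
      - L2_inner torus_measure (radial n f) (radial n g)) \<longlonglongrightarrow> 0" by simp
  moreover have "(\<lambda>n. L2_inner torus_measure (radial n (\<lambda>z. \<phi> z * f z)) (radial n (\<lambda>z. \<phi> z * g z))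
      - L2_inner torus_measure (radial n f) (radial n g)) \<longlonglongrightarrow> H2_inner (\<lambda>z. \<phi> z * f z) (\<lambda>z. \<phi> z * g z) - H2_inner f g"
    by (intro tendsto_diff radial_inner_tendsto inner_mult_H2 \<phi> f g)
  ultimately show ?thesis using LIMSEQ_unique by fastforce
qed

lemma H2_inner_diff_left:
  "f \<in> H2 \<Longrightarrow> g \<in> H2 \<Longrightarrow> h \<in> H2 \<Longrightarrow> H2_inner (\<lambda>z. f z - g z) h = H2_inner f h - H2_inner g h"
  by (simp add: H2_inner_ell2 H2_diff L2_inner_diff_left H2_taylor_L2)

lemma H2_inner_diff_right:
  "f \<in> H2 \<Longrightarrow> g \<in> H2 \<Longrightarrow> h \<in> H2 \<Longrightarrow> H2_inner h (\<lambda>z. f z - g z) = H2_inner h f - H2_inner h g"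
  by (simp add: H2_inner_ell2 H2_diff L2_inner_diff_right H2_taylor_L2)

lemma H2_inner_add_left:
  "f \<in> H2 \<Longrightarrow> g \<in> H2 \<Longrightarrow> h \<in> H2 \<Longrightarrow> H2_inner (\<lambda>z. f z + g z) h = H2_inner f h + H2_inner g h"
  by (simp add: H2_inner_ell2 H2_add L2_inner_add_left H2_taylor_L2)

lemma H2_inner_scale_left: "f \<in> H2 \<Longrightarrow> H2_inner (\<lambda>z. c * f z) h = c * H2_inner f h"
  by (simp add: H2_inner_ell2 H2_scale L2_inner_scale_left)

lemma H2_inner_scale_right: "f \<in> H2 \<Longrightarrow> H2_inner h (\<lambda>z. c * f z) = cnj c * H2_inner h f"
  by (simp add: H2_inner_ell2 H2_scale L2_inner_scale_right)

lemma H2_inner_commute: "H2_inner f g = cnj (H2_inner g f)"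
  unfolding H2_inner_ell2 by (rule L2_inner_commute)

lemma H2_norm_eq_0:
  assumes "f \<in> H2" "H2_norm f = 0"
  shows "f = (\<lambda>z. 0)"
proof -
  have "taylor f = (\<lambda>p. 0)"
    using assms by (intro ell2_norm_eq_0 H2_taylor_L2) (simp_all add: H2_norm_ell2)
  then show ?thesis by (intro H2_ext assms H2_zero) (simp add: taylor_zero)
qed

lemma H2_inner_self_eq_0:
  assumes "f \<in> H2" "H2_inner f f = 0"
  shows "f = (\<lambda>z. 0)"
  using assms by (intro H2_norm_eq_0) (auto simp: H2_norm_ell2 H2_inner_ell2 L2_inner_self)

subsection \<open>The shift in the first variable\<close>

definition shift_coeff :: "(nat \<times> nat \<Rightarrow> complex) \<Rightarrow> nat \<times> nat \<Rightarrow> complex" where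
  "shift_coeff a p = (if fst p = 0 then 0 else a (fst p - 1, snd p))"

definition unshift_coeff :: "(nat \<times> nat \<Rightarrow> complex) \<Rightarrow> nat \<times> nat \<Rightarrow> complex" where
  "unshift_coeff a p = a (Suc (fst p), snd p)"

definition slice_coeff :: "(nat \<times> nat \<Rightarrow> complex) \<Rightarrow> nat \<times> nat \<Rightarrow> complex" where
  "slice_coeff a p = (if fst p = 0 then a p else 0)"

abbreviation (input) up :: "nat \<times> nat \<Rightarrow> nat \<times> nat" where
  "up p \<equiv> (Suc (fst p), snd p)"

lemma inj_up: "inj up"
  by (auto simp: inj_on_def prod_eq_iff)

lemma range_up: "p \<in> range up \<longleftrightarrow> fst p \<noteq> 0"
proof
  assume "fst p \<noteq> 0"
  then have "p = up (fst p - 1, snd p)" by (simp add: prod_eq_iff)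
  then show "p \<in> range up" by blast
qed auto

lemma has_sum_up:
  assumes "\<And>p. fst p = 0 \<Longrightarrow> F p = 0"
  shows "(F has_sum s) UNIV \<longleftrightarrow> ((\<lambda>p. F (up p)) has_sum s) UNIV"
proof -
  have "(F has_sum s) UNIV \<longleftrightarrow> (F has_sum s) (range up)"
    using assms by (intro has_sum_cong_neutral) (auto simp: range_up)
  then show ?thesis by (simp only: has_sum_reindex[OF inj_up] o_def)
qed

lemma summable_on_up:
  assumes "\<And>p. fst p = 0 \<Longrightarrow> F p = 0"
  shows "F summable_on UNIV \<longleftrightarrow> (\<lambda>p. F (up p)) summable_on UNIV"
  using has_sum_up[of F] assms by (auto simp: summable_on_def)

lemma shift_coeff_L2: "a \<in> L2 ell2 \<Longrightarrow> shift_coeff a \<in> L2 ell2"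
  unfolding ell2_iff by (subst summable_on_up) (simp_all add: shift_coeff_def)

lemma unshift_coeff_L2:
  assumes "a \<in> L2 ell2"
  shows "unshift_coeff a \<in> L2 ell2"
proof -
  have "(\<lambda>p. (cmod (a p))\<^sup>2) summable_on range up"
    using assms unfolding ell2_iff by (rule summable_on_subset_banach) simp
  then show ?thesis
    unfolding ell2_iff by (simp add: summable_on_reindex[OF inj_up] o_def unshift_coeff_def)
qed

lemma slice_coeff_L2: "a \<in> L2 ell2 \<Longrightarrow> slice_coeff a \<in> L2 ell2"
  unfolding ell2_iff by (rule summable_on_comparison_test) (auto simp: slice_coeff_def)

lemma shift_coeff_inner: "L2_inner ell2 (shift_coeff a) b = L2_inner ell2 a (unshift_coeff b)"
proof -
  have "infsum F UNIV = infsum (\<lambda>p. F (up p)) UNIV" if "\<And>p. fst p = 0 \<Longrightarrow> F p = 0" for F :: "nat \<times> nat \<Rightarrow> complex"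
    using has_sum_up[of F "infsum F UNIV"] summable_on_up[of F] that
    by (cases "F summable_on UNIV") (simp_all add: infsumI infsum_not_exists)
  from this[of "\<lambda>p. shift_coeff a p * cnj (b p)"] show ?thesis
    by (simp add: ell2_inner shift_coeff_def unshift_coeff_def)
qed

lemma has_taylor_shift1:
  assumes "has_taylor f a"
  shows "has_taylor (shift1 f) (shift_coeff a)"
  unfolding has_taylor_iff
proof
  fix z assume "z \<in> bidisk"
  then have "((\<lambda>p. fst z * (a p * monomial p z)) has_sum fst z * f z) UNIV"
    using assms by (intro has_sum_cmult_right) (simp add: has_taylor_iff)
  then show "((\<lambda>p. shift_coeff a p * monomial p z) has_sum shift1 f z) UNIV"
    by (subst has_sum_up) (simp_all add: shift_coeff_def monomial_def shift1_def mult_ac)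
qed

lemma shift1_H2: "f \<in> H2 \<Longrightarrow> shift1 f \<in> H2"
  and taylor_shift1: "f \<in> H2 \<Longrightarrow> taylor (shift1 f) = shift_coeff (taylor f)"
  using has_taylor_shift1[OF H2_taylor]
  by (auto intro!: H2_I taylor_eqI shift_coeff_L2 H2_taylor_L2 simp: shift1_def H2_outside)

text \<open>Defined on coefficients rather than as the difference quotient
  \<open>backward_shift1\<close>: membership in \<open>H2\<close> and adjointness to the shift are
  then immediate.\<close>

definition bshift1 :: "(complex \<times> complex \<Rightarrow> complex) \<Rightarrow> complex \<times> complex \<Rightarrow> complex" where
  "bshift1 f = power_series (unshift_coeff (taylor f))"

lemma bshift1_H2: "f \<in> H2 \<Longrightarrow> bshift1 f \<in> H2"
  and taylor_bshift1: "f \<in> H2 \<Longrightarrow> taylor (bshift1 f) = unshift_coeff (taylor f)"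
  by (simp_all add: bshift1_def power_series_H2 taylor_power_series unshift_coeff_L2 H2_taylor_L2)

lemma shift1_adjoint: "f \<in> H2 \<Longrightarrow> g \<in> H2 \<Longrightarrow> H2_inner (shift1 f) g = H2_inner f (bshift1 g)"
  by (simp add: H2_inner_ell2 taylor_shift1 taylor_bshift1 shift_coeff_inner)

text \<open>Pointwise cancellation of z1 says nothing where z1 = 0; on coefficients the shift has a
  left inverse.\<close>

lemma shift1_inj:
  assumes "f \<in> H2" "g \<in> H2" "shift1 f = shift1 g"
  shows "f = g"
proof (rule H2_ext[OF assms(1,2)])
  have "unshift_coeff (shift_coeff a) = a" for a by (simp add: unshift_coeff_def[abs_def] shift_coeff_def)
  then show "taylor f = taylor g" using assms by (metis taylor_shift1)
qed

text \<open>On coefficients this is the orthogonal projection of \<open>H2\<close> onto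
  \<open>H2_2\<close>, hence an element of \<open>H2_2\<close> pairs with g as it does with
  \<open>slice g\<close>.\<close>

definition slice :: "(complex \<times> complex \<Rightarrow> complex) \<Rightarrow> complex \<times> complex \<Rightarrow> complex" where
  "slice f = on_bidisk (\<lambda>z. f (0, snd z))"

lemma has_taylor_slice:
  assumes "has_taylor f a"
  shows "has_taylor (slice f) (slice_coeff a)"
  unfolding has_taylor_iff
proof
  fix z assume z: "z \<in> bidisk"
  then have "((\<lambda>p. a p * monomial p (0, snd z)) has_sum f (0, snd z)) UNIV"
    using assms by (simp add: has_taylor_iff bidisk_mem)
  moreover have "a p * monomial p (0, snd z) = slice_coeff a p * monomial p z" for p
    by (simp add: slice_coeff_def monomial_def)
  ultimately show "((\<lambda>p. slice_coeff a p * monomial p z) has_sum slice f z) UNIV"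
    using z by (simp add: slice_def on_bidisk_def)
qed

lemma slice_H2: "f \<in> H2 \<Longrightarrow> slice f \<in> H2"
  and taylor_slice: "f \<in> H2 \<Longrightarrow> taylor (slice f) = slice_coeff (taylor f)"
  using has_taylor_slice[OF H2_taylor]
  by (auto intro!: H2_I taylor_eqI slice_coeff_L2 H2_taylor_L2 simp: slice_def on_bidisk_def)

lemma H2_2_taylor:
  assumes "u \<in> H2_2"
  shows "u \<in> H2" "slice_coeff (taylor u) = taylor u"
proof -
  obtain g where g: "u \<in> H2" "\<And>z. z \<in> bidisk \<Longrightarrow> u z = g (snd z)"
    using assms by (auto simp: H2_2_def)
  then show "u \<in> H2" by simp
  have "slice u = u"
  proof
    fix z show "slice u z = u z"
      using g(2)[of z] g(2)[of "(0, snd z)"] H2_outside[OF g(1), of z]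
      by (auto simp: slice_def on_bidisk_def bidisk_mem)
  qed
  then show "slice_coeff (taylor u) = taylor u" using taylor_slice[OF g(1)] by simp
qed

lemma power_series_H2_2:
  assumes "a \<in> L2 ell2" "slice_coeff a = a"
  shows "power_series a \<in> H2_2"
proof -
  have "slice (power_series a) = power_series a"
    using assms by (intro H2_ext slice_H2 power_series_H2) (simp_all add: taylor_slice power_series_H2 taylor_power_series)
  then have "power_series a z = power_series a (0, snd z)" if "z \<in> bidisk" for z
    using that by (metis slice_def on_bidisk_def)
  then have "\<exists>g. \<forall>z\<in>bidisk. power_series a z = g (snd z)"
    by (intro exI[of _ "\<lambda>y. power_series a (0, y)"]) blast
  then show ?thesis using power_series_H2[OF assms(1)] by (simp add: H2_2_def)
qed

text \<open>On coefficients, the shift after the backward shift is the identity minus the slice. The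
  form multiplied by z1 remains valid at z1 = 0.\<close>

lemma bshift1_identity:
  assumes "f \<in> H2" "z \<in> bidisk"
  shows "fst z * bshift1 f z = f z - f (0, snd z)"
proof -
  have "shift_coeff (unshift_coeff a) p = a p - slice_coeff a p" for a p
    by (simp add: shift_coeff_def unshift_coeff_def slice_coeff_def prod_eq_iff)
  then have "shift1 (bshift1 f) = (\<lambda>z. f z - slice f z)"
    using assms(1)
    by (intro H2_ext shift1_H2 bshift1_H2 H2_diff slice_H2)
      (auto simp: taylor_shift1 taylor_bshift1 bshift1_H2 H2_diff slice_H2 taylor_slice)
  from fun_cong[OF this, of z] show ?thesis
    using assms(2) by (simp add: shift1_def slice_def on_bidisk_def)
qed

subsection \<open>Reproducing kernels\<close>

lemma has_taylor_szego:
  assumes "w \<in> bidisk"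
  shows "has_taylor (on_bidisk (szego_kernel w)) (\<lambda>p. cnj (monomial p w))"
  unfolding has_taylor_iff
proof
  fix z assume z: "z \<in> bidisk"
  have *: "cmod x * cmod y < 1" if "cmod x < 1" "cmod y < 1" for x y
    using mult_strict_mono'[OF that] by simp
  have "((\<lambda>p. monomial p (fst z * cnj (fst w), snd z * cnj (snd w))) has_sum szego_kernel w z) UNIV"
    unfolding szego_kernel_def using z assms
    by (intro has_sum_monomial_geometric) (auto simp: norm_mult bidisk_mem intro!: *)
  then show "((\<lambda>p. cnj (monomial p w) * monomial p z) has_sum on_bidisk (szego_kernel w) z) UNIV"
    using z by (simp add: monomial_def on_bidisk_def power_mult_distrib mult_ac)
qed

lemma szego_H2:
  assumes "w \<in> bidisk"
  shows "on_bidisk (szego_kernel w) \<in> H2"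
  by (rule H2_I[OF has_taylor_szego[OF assms]])
    (use monomial_L2_ell2[OF assms] in \<open>auto simp: ell2_iff on_bidisk_def\<close>)

lemma H2_inner_szego:
  assumes "f \<in> H2" "w \<in> bidisk"
  shows "H2_inner f (on_bidisk (szego_kernel w)) = f w"
  using H2_taylor[OF assms(1)] assms(2)
  by (simp add: H2_inner_def taylor_eqI[OF has_taylor_szego[OF assms(2)]] has_taylor_iff infsumI)

lemma model_spaceD:
  "f \<in> model_space \<phi> \<Longrightarrow> f \<in> H2"
  "f \<in> model_space \<phi> \<Longrightarrow> g \<in> H2 \<Longrightarrow> H2_inner f (\<lambda>z. \<phi> z * g z) = 0"
  by (auto simp: model_space_def)

context
  fixes \<phi> :: "complex \<times> complex \<Rightarrow> complex"
  assumes \<phi>: "inner_function \<phi>"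
begin

lemma model_space_scale: "f \<in> model_space \<phi> \<Longrightarrow> (\<lambda>z. c * f z) \<in> model_space \<phi>"
  by (simp add: model_space_def H2_scale H2_inner_scale_left)

lemma model_space_add:
  "f \<in> model_space \<phi> \<Longrightarrow> g \<in> model_space \<phi> \<Longrightarrow> (\<lambda>z. f z + g z) \<in> model_space \<phi>"
  by (simp add: model_space_def H2_add H2_inner_add_left inner_mult_H2[OF \<phi>])

lemma model_space_zero: "(\<lambda>z. 0) \<in> model_space \<phi>"
  by (simp add: model_space_def H2_zero H2_inner_ell2 taylor_zero L2_inner_def)

lemma model_kernel_eq:
  "model_kernel \<phi> w = (\<lambda>z. on_bidisk (szego_kernel w) z - cnj (\<phi> w) * (\<phi> z * on_bidisk (szego_kernel w) z))"
  by (auto simp: model_kernel_def on_bidisk_def szego_kernel_def diff_divide_distrib mult_ac)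

lemma model_kernel_H2: "w \<in> bidisk \<Longrightarrow> model_kernel \<phi> w \<in> H2"
  unfolding model_kernel_eq by (intro H2_diff H2_scale inner_mult_H2 \<phi> szego_H2)

text \<open>The kernel is k minus a multiple of \<phi> k, where k is the Szego kernel at w. Against
  \<phi> g the first part gives the conjugate of \<phi>(w) g(w); since multiplication by \<phi> is
  isometric, the second gives the same value and they cancel.\<close>

lemma model_kernel_model_space:
  assumes w: "w \<in> bidisk"
  shows "model_kernel \<phi> w \<in> model_space \<phi>"
  unfolding model_space_def
proof (intro CollectI conjI ballI)
  show "model_kernel \<phi> w \<in> H2" by (rule model_kernel_H2[OF w])
  fix g assume g: "g \<in> H2"
  let ?k = "on_bidisk (szego_kernel w)"
  have k: "?k \<in> H2" by (rule szego_H2[OF w])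
  have "H2_inner (model_kernel \<phi> w) (\<lambda>z. \<phi> z * g z) =
     H2_inner ?k (\<lambda>z. \<phi> z * g z) - cnj (\<phi> w) * H2_inner (\<lambda>z. \<phi> z * ?k z) (\<lambda>z. \<phi> z * g z)"
    unfolding model_kernel_eq
    by (simp add: H2_inner_diff_left H2_inner_scale_left H2_scale inner_mult_H2[OF \<phi>] k g)
  also have "H2_inner (\<lambda>z. \<phi> z * ?k z) (\<lambda>z. \<phi> z * g z) = cnj (g w)"
    by (subst inner_mult_isometry[OF \<phi> k g], subst H2_inner_commute) (simp add: H2_inner_szego g w)
  also have "H2_inner ?k (\<lambda>z. \<phi> z * g z) = cnj (\<phi> w * g w)"
    by (subst H2_inner_commute) (simp only: H2_inner_szego inner_mult_H2[OF \<phi> g] w)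
  finally show "H2_inner (model_kernel \<phi> w) (\<lambda>z. \<phi> z * g z) = 0" by simp
qed

lemma model_kernel_reproducing:
  assumes f: "f \<in> model_space \<phi>" and w: "w \<in> bidisk"
  shows "H2_inner f (model_kernel \<phi> w) = f w"
  unfolding model_kernel_eq
  using model_spaceD(1)[OF f] model_spaceD(2)[OF f szego_H2[OF w]]
  by (simp add: H2_inner_diff_right H2_inner_scale_right H2_scale inner_mult_H2[OF \<phi>] szego_H2[OF w] H2_inner_szego w)

subsection \<open>The maximal shift-invariant subspace\<close>

lemma shift1_pow: "(shift1 ^^ n) f z = fst z ^ n * f z"
  by (induction n) (auto simp: shift1_def mult_ac)

lemma shift1_pow_H2: "f \<in> H2 \<Longrightarrow> (shift1 ^^ n) f \<in> H2"
  by (induction n) (auto intro: shift1_H2)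

lemma shift1_pow_adjoint:
  "f \<in> H2 \<Longrightarrow> g \<in> H2 \<Longrightarrow> (bshift1 ^^ n) g \<in> H2 \<and> H2_inner ((shift1 ^^ n) f) g = H2_inner f ((bshift1 ^^ n) g)"
proof (induction n arbitrary: g)
  case (Suc n)
  have "H2_inner ((shift1 ^^ Suc n) f) g = H2_inner ((shift1 ^^ n) f) (bshift1 g)"
    using Suc.prems by (simp add: shift1_adjoint shift1_pow_H2)
  then show ?case using Suc.IH[OF Suc.prems(1) bshift1_H2[OF Suc.prems(2)]]
    by (simp add: funpow_swap1)
qed auto

text \<open>\<open>GREATEST\<close> denotes something only if a largest subspace exists. The
  functions whose shifts all stay in the model space form one: any invariant subspace is contained
  in this set by iteration.\<close>

lemma S1_max_eq: "S1_max \<phi> = {f \<in> H2. \<forall>n. (shift1 ^^ n) f \<in> model_space \<phi>}" (is "_ = ?M")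
  unfolding S1_max_def
proof (rule Greatest_equality)
  \<comment> \<open>closedness: moving the shifts onto \<open>\<phi> g\<close> turns membership into orthogonality of \<open>f\<close>\<close>
  have closed: "f \<in> ?M"
    if s: "\<And>k. s k \<in> ?M" and f: "f \<in> H2" and lim: "(\<lambda>k::nat. H2_norm (\<lambda>z. s k z - f z)) \<longlonglongrightarrow> 0" for s f
  proof -
    have sH: "s k \<in> H2" for k using s by simp
    have "H2_inner ((shift1 ^^ n) f) (\<lambda>z. \<phi> z * g z) = 0" if g: "g \<in> H2" for n g
    proof -
      define q where "q = (bshift1 ^^ n) (\<lambda>z. \<phi> z * g z)"
      have q: "q \<in> H2" "H2_inner ((shift1 ^^ n) h) (\<lambda>z. \<phi> z * g z) = H2_inner h q" if "h \<in> H2" for h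
        using shift1_pow_adjoint[OF that inner_mult_H2[OF \<phi> g]] by (auto simp: q_def)
      have "(\<lambda>k. H2_inner (s k) q) \<longlonglongrightarrow> H2_inner f q"
        unfolding H2_inner_ell2
        using lim by (intro L2_inner_tendsto_left H2_taylor_L2 sH f q(1)[OF f])
          (simp add: H2_norm_ell2 H2_diff sH f)
      moreover have "H2_inner (s k) q = 0" for k
        using s[of k] g by (simp add: q(2)[OF sH, symmetric] model_spaceD(2))
      ultimately have "(\<lambda>k. 0) \<longlonglongrightarrow> H2_inner f q" by simp
      then have "H2_inner f q = 0" by (simp add: LIMSEQ_const_iff)
      then show ?thesis by (simp add: q(2)[OF f])
    qed
    then show ?thesis using f by (simp add: model_space_def shift1_pow_H2)
  qed
  have pow: "(shift1 ^^ n) (\<lambda>z. f z + g z) = (\<lambda>z. (shift1 ^^ n) f z + (shift1 ^^ n) g z)"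
    "(shift1 ^^ n) (\<lambda>z. c * f z) = (\<lambda>z. c * (shift1 ^^ n) f z)"
    "(shift1 ^^ n) (\<lambda>z. 0) = (\<lambda>z. 0)" for n f g c
    by (auto simp: shift1_pow algebra_simps)
  have "closed_subspace ?M"
    unfolding closed_subspace_def
    using closed
    by (auto simp: pow H2_zero H2_add H2_scale model_space_zero model_space_add model_space_scale)
  moreover have "?M \<subseteq> model_space \<phi>"
  proof
    fix f assume "f \<in> ?M"
    then have "(shift1 ^^ 0) f \<in> model_space \<phi>" by blast
    then show "f \<in> model_space \<phi>" by simp
  qed
  moreover have "shift1 ` ?M \<subseteq> ?M"
  proof (rule image_subsetI)
    fix f assume f: "f \<in> ?M"
    have "(shift1 ^^ n) (shift1 f) = (shift1 ^^ Suc n) f" for n by (simp add: funpow_swap1)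
    then show "shift1 f \<in> ?M" using f shift1_H2 by (auto simp only: mem_Collect_eq)
  qed
  ultimately show "closed_subspace ?M \<and> ?M \<subseteq> model_space \<phi> \<and> shift1 ` ?M \<subseteq> ?M" by blast
next
  fix M assume M: "closed_subspace M \<and> M \<subseteq> model_space \<phi> \<and> shift1 ` M \<subseteq> M"
  show "M \<subseteq> ?M"
  proof
    fix f assume f: "f \<in> M"
    have "(shift1 ^^ n) f \<in> M" for n using f M by (induction n) auto
    then show "f \<in> ?M" using f M by (auto simp: closed_subspace_def)
  qed
qed

lemma S1_maxD:
  assumes "f \<in> S1_max \<phi>"
  shows "f \<in> model_space \<phi>" "shift1 f \<in> model_space \<phi>"
proof -
  have *: "\<And>n. (shift1 ^^ n) f \<in> model_space \<phi>" using assms by (simp add: S1_max_eq)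
  show "f \<in> model_space \<phi>" "shift1 f \<in> model_space \<phi>" using *[of 0] *[of 1] by simp_all
qed

text \<open>Any competitor k lies in the model space itself, so it can be tested against k;
  orthogonality of p then leaves that k is orthogonal to itself.\<close>

lemma proj_model_eq_0:
  assumes p: "p \<in> H2" and orth: "\<And>u. u \<in> model_space \<phi> \<Longrightarrow> H2_inner p u = 0"
  shows "proj_model \<phi> p = (\<lambda>z. 0)"
  unfolding proj_model_def
proof (rule the_equality)
  show "(\<lambda>z. 0) \<in> model_space \<phi> \<and> (\<forall>u\<in>model_space \<phi>. H2_inner (\<lambda>z. p z - 0) u = 0)"
    using orth by (simp add: model_space_zero)
  fix k assume k: "k \<in> model_space \<phi> \<and> (\<forall>u\<in>model_space \<phi>. H2_inner (\<lambda>z. p z - k z) u = 0)"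
  then have "H2_inner k k = 0"
    using H2_inner_diff_left[OF p, of k k] orth[of k] model_spaceD(1)[of k \<phi>] by simp
  then show "k = (\<lambda>z. 0)" using k by (intro H2_inner_self_eq_0 model_spaceD(1)[of k \<phi>]) auto
qed

end

section \<open>The projection onto the Hardy space of the second variable\<close>

lemma nt_limit_continuous:
  assumes "isCont f \<zeta>"
  shows "nt_limit f \<zeta> (f \<zeta>)"
  using assms unfolding nt_limit_def isCont_def by (auto intro: tendsto_within_subset)

text \<open>The projection keeps the Fourier coefficients of \<open>G\<close> at the frequencies (0,
  l), which are square summable by Bessel's inequality. The second claim is about dilates, so that
  it can be applied to a slice for which no boundary function is given.\<close>

lemma proj_H2_2_power_series:
  assumes G: "G \<in> L2 torus_measure"
  defines "c \<equiv> slice_coeff (\<lambda>p. L2_inner torus_measure G (monomial p))"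
  shows "c \<in> L2 ell2"
    and "\<And>u n. u \<in> H2 \<Longrightarrow> slice_coeff (taylor u) = taylor u \<Longrightarrow>
      L2_inner torus_measure G (radial n u) = L2_inner ell2 c (radial_coeff n (taylor u))"
    and "proj_H2_2 G = power_series c"
proof -
  have cG: "c p * cnj (c p) = cnj (c p) * L2_inner torus_measure G (monomial p)" for p
    by (simp add: c_def slice_coeff_def)
  have slc: "slice_coeff c = c" by (simp add: c_def slice_coeff_def fun_eq_iff)
  have "(\<Sum>p\<in>A. (cmod (c p))\<^sup>2) \<le> (L2_norm torus_measure G)\<^sup>2" if A: "finite A" for A
  proof -
    \<comment> \<open>Bessel's inequality by testing \<open>G\<close> against the polynomial
      \<open>h\<close> with these coefficients: the pairing of \<open>G\<close> with
      \<open>h\<close> and the squared norm of \<open>h\<close> are both \<open>S\<close>.\<close>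
    define b where "b p = (if p \<in> A then c p else 0)" for p
    define h where "h \<zeta> = (\<Sum>p\<in>A. c p * monomial p \<zeta>)" for \<zeta>
    define S where "S = (\<Sum>p\<in>A. (cmod (c p))\<^sup>2)"
    have S0: "S \<ge> 0" by (simp add: S_def sum_nonneg)
    have fin: "(F has_sum sum F A) UNIV" if "\<And>p. p \<notin> A \<Longrightarrow> F p = 0" for F :: "nat \<times> nat \<Rightarrow> complex"
      using has_sum_cong_neutral[of A UNIV F F "sum F A"] that has_sum_finite[OF A, of F] by auto
    have h: "((\<lambda>p. b p * monomial p \<zeta>) has_sum h \<zeta>) UNIV" for \<zeta>
      using fin[of "\<lambda>p. b p * monomial p \<zeta>"] by (simp add: b_def h_def)
    have hL: "h \<in> L2 torus_measure" by (rule torus_series_L2[OF h])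
    have S: "(\<Sum>p\<in>A. cnj (b p) * L2_inner torus_measure G (monomial p)) = of_real S"
      unfolding S_def of_real_sum complex_norm_square by (simp add: b_def cG)
    have "L2_inner torus_measure G h = of_real S"
      using has_sum_unique[OF torus_series_inner[OF h G] fin[of "\<lambda>p. cnj (b p) * L2_inner torus_measure G (monomial p)"]]
      by (simp only: S) (simp add: b_def)
    moreover have "L2_inner torus_measure h h = of_real S"
    proof -
      have "L2_inner torus_measure h h = infsum (\<lambda>p. b p * cnj (b p)) UNIV"
        by (simp add: torus_series_isometry[OF h h] ell2_inner)
      also have "\<dots> = (\<Sum>p\<in>A. b p * cnj (b p))"
        by (rule infsumI[OF fin]) (simp add: b_def)
      also have "\<dots> = of_real S" unfolding S_def of_real_sum complex_norm_square by (simp add: b_def)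
      finally show ?thesis .
    qed
    then have "(L2_norm torus_measure h)\<^sup>2 = S"
      unfolding L2_inner_self of_real_eq_iff .
    ultimately have "S \<le> L2_norm torus_measure G * sqrt S"
      using L2_Cauchy_Schwarz[OF G hL] S0 by (simp add: real_sqrt_unique[OF _ L2_norm_nonneg])
    then have "sqrt S * sqrt S \<le> L2_norm torus_measure G * sqrt S" using S0 by simp
    \<comment> \<open>The factor \<open>sqrt S\<close> is cancelled only when it is nonzero; for
      \<open>S = 0\<close> the claim is that norms are nonnegative.\<close>
    then have "sqrt S \<le> L2_norm torus_measure G"
      using S0 L2_norm_nonneg[of torus_measure G]
      by (cases "S = 0") (auto dest: mult_right_le_imp_le simp del: real_sqrt_mult_self)
    then have "(sqrt S)\<^sup>2 \<le> (L2_norm torus_measure G)\<^sup>2" using S0 by (intro power_mono) auto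
    then show ?thesis using S0 by (simp add: S_def)
  qed
  then show c: "c \<in> L2 ell2"
    unfolding ell2_iff by (intro nonneg_bdd_above_summable_on) (auto simp: bdd_above_def)
  show X: "L2_inner torus_measure G (radial n u) = L2_inner ell2 c (radial_coeff n (taylor u))"
    if u: "u \<in> H2" "slice_coeff (taylor u) = taylor u" for u n
  proof -
    have z: "taylor u p = 0" if "fst p \<noteq> 0" for p
      using fun_cong[OF u(2), of p] that by (simp add: slice_coeff_def)
    have eq: "cnj (radial_coeff n (taylor u) p) * L2_inner torus_measure G (monomial p) = c p * cnj (radial_coeff n (taylor u) p)" for p
      using z[of p] by (cases "fst p = 0") (simp_all add: c_def slice_coeff_def radial_coeff_def)
    show ?thesis
      using torus_series_inner[OF has_taylor_radial[OF H2_taylor[OF u(1)], of _ n] G]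
      unfolding eq ell2_inner by (rule infsumI[symmetric])
  qed
  show "proj_H2_2 G = power_series c"
    unfolding proj_H2_2_def
  proof (rule the_equality)
    have "L2_inner torus_measure G U = H2_inner (power_series c) u" if u: "u \<in> H2_2" and U: "boundary_values u U" for u U
    proof -
      note uH = H2_2_taylor[OF u]
      have "(\<lambda>n. L2_inner torus_measure G (radial n u)) \<longlonglongrightarrow> L2_inner torus_measure G U"
        by (intro L2_inner_tendsto_right boundary_values_L2[OF uH(1) U] G has_taylor_radial_L2[OF H2_taylor[OF uH(1)]])
      moreover have "(\<lambda>n. L2_inner torus_measure G (radial n u)) \<longlonglongrightarrow> L2_inner ell2 c (taylor u)"
        unfolding X[OF uH]
        by (intro L2_inner_tendsto_right radial_coeff_L2 radial_coeff_tendsto H2_taylor_L2 uH(1) c)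
      ultimately have "L2_inner torus_measure G U = L2_inner ell2 c (taylor u)" by (rule LIMSEQ_unique)
      then show ?thesis by (simp add: H2_inner_ell2 taylor_power_series c)
    qed
    then show "power_series c \<in> H2_2 \<and> (\<forall>u\<in>H2_2. \<forall>U. boundary_values u U \<longrightarrow> L2_inner torus_measure G U = H2_inner (power_series c) u)"
      using power_series_H2_2[OF c slc] by blast
    fix h assume h: "h \<in> H2_2 \<and> (\<forall>u\<in>H2_2. \<forall>U. boundary_values u U \<longrightarrow> L2_inner torus_measure G U = H2_inner h u)"
    then have hH: "h \<in> H2" "slice_coeff (taylor h) = taylor h" using H2_2_taylor by blast+
    have "taylor h p = c p" if p: "fst p = 0" for p
    proof -
      \<comment> \<open>monomials determine \<open>h\<close>, and they have boundary values without Fatou's theorem\<close>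
      define d where "d q = (if q = p then 1 else 0 :: complex)" for q
      have d: "d \<in> L2 ell2"
        using has_sum_single[of p "\<lambda>q. (cmod (d q))\<^sup>2"] has_sum_imp_summable
        unfolding ell2_iff d_def by fastforce
      have sld: "slice_coeff d = d" using p by (auto simp: fun_eq_iff slice_coeff_def d_def)
      have eq: "power_series d z = monomial p z" if "z \<in> bidisk" for z
      proof -
        have "((\<lambda>q. d q * monomial q z) has_sum power_series d z) UNIV"
          using has_taylor_power_series[OF d] that by (simp add: has_taylor_iff)
        moreover have "((\<lambda>q. d q * monomial q z) has_sum (d p * monomial p z)) UNIV"
          by (rule has_sum_single) (simp add: d_def)
        ultimately show ?thesis using has_sum_unique by (fastforce simp: d_def)
      qed
      have "boundary_values (power_series d) (monomial p)"
        unfolding boundary_values_def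
      proof (intro conjI AE_I2 measurable_monomial)
        fix \<zeta>
        have "isCont (monomial p) \<zeta>" unfolding monomial_def[abs_def] by (intro continuous_intros)
        then have *: "nt_limit (monomial p) \<zeta> (monomial p \<zeta>)" by (rule nt_limit_continuous)
        show "nt_limit (power_series d) \<zeta> (monomial p \<zeta>)"
          unfolding nt_limit_def
        proof (intro allI impI)
          fix k :: real assume "k > 1"
          then have "(monomial p \<longlongrightarrow> monomial p \<zeta>) (at \<zeta> within stolz k (fst \<zeta>) \<times> stolz k (snd \<zeta>))"
            using * by (simp add: nt_limit_def)
          then show "(power_series d \<longlongrightarrow> monomial p \<zeta>) (at \<zeta> within stolz k (fst \<zeta>) \<times> stolz k (snd \<zeta>))"
            \<comment> \<open>The two functions agree only inside the bidisk, but the approach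
              regions lie there.\<close>
            by (rule Lim_transform_within[where d = 1]) (auto simp: eq stolz_def bidisk_mem)
        qed
      qed
      then have "L2_inner torus_measure G (monomial p) = H2_inner h (power_series d)"
        using h power_series_H2_2[OF d sld] by blast
      moreover have "H2_inner h (power_series d) = taylor h p"
        using has_sum_single[of p "\<lambda>q. taylor h q * cnj (d q)"]
        by (simp add: H2_inner_ell2 taylor_power_series d ell2_inner infsumI d_def)
      ultimately show ?thesis using p by (simp add: c_def slice_coeff_def)
    qed
    moreover have "taylor h p = c p" if "fst p \<noteq> 0" for p
      using that fun_cong[OF hH(2), of p] by (simp add: c_def slice_coeff_def)
    ultimately have "taylor h = c" by blast
    then show "h = power_series c" using c hH(1) by (intro H2_ext power_series_H2) (simp_all add: taylor_power_series)
  qed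
qed

section \<open>The Clark embedding\<close>

text \<open>Expanding the squared norms gives the real part of the inner product rotated by any
  \<open>c\<close>; 1 and \<open>- \<i>\<close> recover it. Two measures occur because
  \<open>J\<close> maps coefficients isometrically into L2 of \<sigma>.\<close>

lemma L2_polarization:
  assumes L: "F \<in> L2 M" "G \<in> L2 M" "A \<in> L2 N" "B \<in> L2 N"
    and eq: "\<And>c. L2_norm M (\<lambda>x. F x + c * G x) = L2_norm N (\<lambda>x. A x + c * B x)"
    and G: "L2_norm M G = L2_norm N B"
  shows "L2_inner M F G = L2_inner N A B"
proof -
  have F: "L2_norm M F = L2_norm N A" using eq[of 0] by simp
  have re: "Re (cnj c * L2_inner M F G) = Re (cnj c * L2_inner N A B)" for c
    using arg_cong[OF eq[of c], of "\<lambda>r. r\<^sup>2"] L F G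
    by (simp add: L2_norm_add_square L2_scale L2_inner_scale_right L2_norm_scale)
  show ?thesis using re[of 1] re[of "- \<i>"] by (simp add: complex_eq_iff)
qed

text \<open>This is X / (1 - X) = 1 / (1 - X) - 1 in the first variable; the term 1 belongs to the
  kernel with w1 = 0.\<close>

lemma szego_kernel_shift:
  assumes "\<zeta> \<in> torus" "w \<in> bidisk"
  shows "cnj (fst w) * (fst \<zeta> * szego_kernel w \<zeta>) = szego_kernel w \<zeta> - szego_kernel (0, snd w) \<zeta>"
proof -
  have *: "x * cnj y \<noteq> 1" if "cmod x = 1" "cmod y < 1" for x y
  proof
    assume "x * cnj y = 1"
    then have "cmod (x * cnj y) = 1" by simp
    then show False using that by (simp add: norm_mult)
  qed
  define X where "X = fst \<zeta> * cnj (fst w)"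
  define Y where "Y = snd \<zeta> * cnj (snd w)"
  have XY: "1 - X \<noteq> 0" "1 - Y \<noteq> 0"
    using assms *[of "fst \<zeta>" "fst w"] *[of "snd \<zeta>" "snd w"] by (auto simp: X_def Y_def torus_mem bidisk_mem)
  have "X * (1 / ((1 - X) * (1 - Y))) = 1 / ((1 - X) * (1 - Y)) - 1 / (1 - Y)"
    using XY by (simp add: divide_simps)
  then show ?thesis by (simp add: szego_kernel_def X_def Y_def mult_ac)
qed

context
  fixes \<phi> :: "complex \<times> complex \<Rightarrow> complex"
    and \<alpha> :: complex
    and \<sigma> :: "(complex \<times> complex) measure"
    and J :: "(complex \<times> complex \<Rightarrow> complex) \<Rightarrow> complex \<times> complex \<Rightarrow> complex"
  assumes \<phi>: "inner_function \<phi>" and nonconst: "\<not> \<phi> constant_on bidisk"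
    and \<alpha>: "\<alpha> \<in> sphere 0 1"
    and \<sigma>: "clark_measure \<phi> \<alpha> \<sigma>"
    and J: "clark_embedding \<phi> \<alpha> \<sigma> J"
    and surj: "clark_surjective \<phi> \<sigma> J"
begin

lemma space_clark: "space \<sigma> = torus"
  using \<sigma> sets_eq_imp_space_eq[of \<sigma> "restrict_space borel torus"]
  by (simp add: clark_measure_def space_restrict_space)

lemma measurable_clark: "fst \<in> borel_measurable \<sigma>" "snd \<in> borel_measurable \<sigma>"
proof -
  have s: "sets \<sigma> = sets (restrict_space borel torus)" using \<sigma> by (simp add: clark_measure_def)
  have "fst \<in> borel_measurable (borel :: (complex \<times> complex) measure)"
    "snd \<in> borel_measurable (borel :: (complex \<times> complex) measure)"
    by (intro borel_measurable_continuous_onI continuous_intros)+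
  then show "fst \<in> borel_measurable \<sigma>" "snd \<in> borel_measurable \<sigma>"
    unfolding measurable_cong_sets[OF s refl] by (auto intro: measurable_restrict_space1)
qed

lemma J_L2: "f \<in> model_space \<phi> \<Longrightarrow> J f \<in> L2 \<sigma>"
  using J by (simp add: clark_embedding_def)

lemma J_inner:
  assumes f: "f \<in> model_space \<phi>" and g: "g \<in> model_space \<phi>"
  shows "L2_inner \<sigma> (J f) (J g) = H2_inner f g"
  unfolding H2_inner_ell2
proof (rule L2_polarization)
  note H = model_spaceD(1)[OF f] model_spaceD(1)[OF g]
  show "taylor f \<in> L2 ell2" "taylor g \<in> L2 ell2" using H by (auto intro: H2_taylor_L2)
  show "L2_norm \<sigma> (J g) = L2_norm ell2 (taylor g)"
    using J g H by (simp add: clark_embedding_def H2_norm_ell2)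
  fix c
  have cg: "(\<lambda>z. c * g z) \<in> model_space \<phi>" by (rule model_space_scale[OF \<phi> g])
  have fcg: "(\<lambda>z. f z + c * g z) \<in> model_space \<phi>" by (rule model_space_add[OF \<phi> f cg])
  have "AE \<zeta> in \<sigma>. J (\<lambda>z. c * g z) \<zeta> = c * J g \<zeta>"
    using J g by (simp add: clark_embedding_def)
  moreover have "AE \<zeta> in \<sigma>. J (\<lambda>z. f z + c * g z) \<zeta> = J f \<zeta> + J (\<lambda>z. c * g z) \<zeta>"
    using J[unfolded clark_embedding_def, THEN conjunct2, THEN conjunct1] f cg by simp
  ultimately have "AE \<zeta> in \<sigma>. J f \<zeta> + c * J g \<zeta> = J (\<lambda>z. f z + c * g z) \<zeta>"
    by eventually_elim simp
  then have "L2_norm \<sigma> (\<lambda>\<zeta>. J f \<zeta> + c * J g \<zeta>) = L2_norm \<sigma> (J (\<lambda>z. f z + c * g z))"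
    by (intro L2_norm_cong_AE L2_add L2_scale J_L2 f g fcg)
  also have "\<dots> = L2_norm ell2 (\<lambda>p. taylor f p + c * taylor g p)"
    using J fcg H by (simp add: clark_embedding_def H2_norm_ell2 model_spaceD(1)[OF fcg] H2_add H2_scale)
  finally show "L2_norm \<sigma> (\<lambda>\<zeta>. J f \<zeta> + c * J g \<zeta>) = L2_norm ell2 (\<lambda>p. taylor f p + c * taylor g p)" .
qed (intro J_L2 f g)+

lemma J_kernel:
  "w \<in> bidisk \<Longrightarrow> AE \<zeta> in \<sigma>. J (model_kernel \<phi> w) \<zeta> = (1 - \<alpha> * cnj (\<phi> w)) * szego_kernel w \<zeta>"
  using J by (simp add: clark_embedding_def)

text \<open>If \<open>\<phi> w = \<alpha>\<close> then \<open>J\<close> annihilates the reproducing kernel at \<open>w\<close>, so that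
  kernel vanishes and \<open>\<phi>\<close> is constant.\<close>

lemma denominator_nonzero:
  assumes w: "w \<in> bidisk"
  shows "1 - cnj \<alpha> * \<phi> w \<noteq> 0"
proof
  assume eq: "1 - cnj \<alpha> * \<phi> w = 0"
  have "1 - \<alpha> * cnj (\<phi> w) = cnj (1 - cnj \<alpha> * \<phi> w)" by simp
  then have "1 - \<alpha> * cnj (\<phi> w) = 0" by (simp only: eq complex_cnj_zero)
  then have "AE \<zeta> in \<sigma>. J (model_kernel \<phi> w) \<zeta> = 0" using J_kernel[OF w] by simp
  then have "L2_norm \<sigma> (J (model_kernel \<phi> w)) = 0"
    using L2_norm_eq_0_iff J_L2[OF model_kernel_model_space[OF \<phi> w]] by blast
  then have "H2_norm (model_kernel \<phi> w) = 0"
    using J model_kernel_model_space[OF \<phi> w] by (simp add: clark_embedding_def)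
  then have k0: "model_kernel \<phi> w = (\<lambda>z. 0)"
    by (intro H2_norm_eq_0 model_kernel_H2[OF \<phi> w])
  have ne: "x * cnj y \<noteq> 1" if "cmod x < 1" "cmod y < 1" for x y
  proof
    assume "x * cnj y = 1"
    then have "cmod x * cmod y = 1" by (metis complex_mod_cnj norm_mult norm_one)
    then show False using mult_strict_mono'[OF that] by simp
  qed
  have "\<phi> z = 1 / cnj (\<phi> w)" if z: "z \<in> bidisk" for z
  proof -
    have "(1 - \<phi> z * cnj (\<phi> w)) / ((1 - fst z * cnj (fst w)) * (1 - snd z * cnj (snd w))) = 0"
      using fun_cong[OF k0, of z] z by (simp add: model_kernel_def on_bidisk_def)
    then have *: "\<phi> z * cnj (\<phi> w) = 1"
      using ne[of "fst z" "fst w"] ne[of "snd z" "snd w"] z w by (auto simp: bidisk_mem)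
    then have "cnj (\<phi> w) \<noteq> 0" by auto
    with * show ?thesis by (simp add: eq_divide_eq)
  qed
  then show False using nonconst by (auto simp: constant_on_def)
qed

text \<open>Integrability is inherited from the image of the model kernel, which is a nonzero
  multiple of this kernel almost everywhere.\<close>

lemma szego_clark_L2:
  assumes w: "w \<in> bidisk"
  shows "szego_kernel w \<in> L2 \<sigma>"
proof -
  let ?c = "1 - \<alpha> * cnj (\<phi> w)"
  have "?c = cnj (1 - cnj \<alpha> * \<phi> w)" by simp
  then have c: "?c \<noteq> 0"
    using denominator_nonzero[OF w] by (simp only: complex_cnj_zero_iff not_False_eq_True)
  have meas: "szego_kernel w \<in> borel_measurable \<sigma>"
    unfolding szego_kernel_def[abs_def] using measurable_clark by measurable
  have AE: "AE \<zeta> in \<sigma>. (cmod ((1 / ?c) * J (model_kernel \<phi> w) \<zeta>))\<^sup>2 = (cmod (szego_kernel w \<zeta>))\<^sup>2"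
    using J_kernel[OF w] by eventually_elim (use c in simp)
  have L: "(\<lambda>\<zeta>. (1 / ?c) * J (model_kernel \<phi> w) \<zeta>) \<in> L2 \<sigma>"
    by (intro L2_scale J_L2 model_kernel_model_space \<phi> w)
  note [measurable] = meas L2_measurable[OF L]
  have "integrable \<sigma> (\<lambda>\<zeta>. (cmod (szego_kernel w \<zeta>))\<^sup>2)"
    by (rule integrable_cong_AE_imp[OF L2_integrable_square[OF L]]) (use AE in \<open>auto elim: eventually_mono\<close>)
  with meas show ?thesis by (rule L2_I)
qed

text \<open>A Cauchy-type formula that recovers f from \<open>J f\<close>: \<open>J\<close>
  preserves the pairing with the reproducing kernel, and the constant in the image of that kernel
  comes out conjugated.\<close>

lemma J_reproducing:
  assumes f: "f \<in> model_space \<phi>" and w: "w \<in> bidisk"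
  shows "f w = (1 - cnj \<alpha> * \<phi> w) * L2_inner \<sigma> (J f) (szego_kernel w)"
proof -
  have "f w = L2_inner \<sigma> (J f) (J (model_kernel \<phi> w))"
    using J_inner[OF f model_kernel_model_space[OF \<phi> w]] model_kernel_reproducing[OF \<phi> f w] by simp
  also have "\<dots> = L2_inner \<sigma> (J f) (\<lambda>\<zeta>. (1 - \<alpha> * cnj (\<phi> w)) * szego_kernel w \<zeta>)"
    by (intro L2_inner_cong_AE J_kernel w J_L2 f model_kernel_model_space \<phi> L2_scale szego_clark_L2) simp
  finally show ?thesis by (simp add: L2_inner_scale_right)
qed

text \<open>\<open>unshift g\<close> is the preimage under \<open>J\<close> of \<open>J g\<close> multiplied by the conjugate of the
  first coordinate; on the model space it acts as \<open>g \<mapsto> B\<^sub>1 g + \<theta> \<cdot> g(0, \<cdot>)\<close>.\<close>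

definition unshift :: "(complex \<times> complex \<Rightarrow> complex) \<Rightarrow> complex \<times> complex \<Rightarrow> complex" where
  "unshift g = (SOME v. v \<in> model_space \<phi> \<and> (AE \<zeta> in \<sigma>. J v \<zeta> = cnj (fst \<zeta>) * J g \<zeta>))"

lemma cnj_fst_L2: "f \<in> model_space \<phi> \<Longrightarrow> (\<lambda>\<zeta>. cnj (fst \<zeta>) * J f \<zeta>) \<in> L2 \<sigma>"
  by (rule L2_mult_bounded(1)[where C = 1])
    (use measurable_clark in \<open>auto intro!: J_L2 borel_measurable_cnj simp: space_clark torus_mem\<close>)

lemma unshift:
  assumes "g \<in> model_space \<phi>"
  shows "unshift g \<in> model_space \<phi>" "AE \<zeta> in \<sigma>. J (unshift g) \<zeta> = cnj (fst \<zeta>) * J g \<zeta>"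
proof -
  have "\<exists>v. v \<in> model_space \<phi> \<and> (AE \<zeta> in \<sigma>. J v \<zeta> = cnj (fst \<zeta>) * J g \<zeta>)"
    using bspec[OF surj[unfolded clark_surjective_def] cnj_fst_L2[OF assms]] by (simp only: Bex_def)
  from someI_ex[OF this]
  show "unshift g \<in> model_space \<phi>" "AE \<zeta> in \<sigma>. J (unshift g) \<zeta> = cnj (fst \<zeta>) * J g \<zeta>"
    by (auto simp: unshift_def)
qed

text \<open>\<sigma> lives on the torus, where multiplication by the conjugate of the first
  coordinate is unimodular.\<close>

lemma unshift_isometry:
  assumes f: "f \<in> model_space \<phi>" and g: "g \<in> model_space \<phi>"
  shows "H2_inner (unshift f) (unshift g) = H2_inner f g"
proof -
  have "H2_inner (unshift f) (unshift g) = L2_inner \<sigma> (J (unshift f)) (J (unshift g))"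
    by (rule J_inner[symmetric]) (intro unshift f g)+
  also have "\<dots> = L2_inner \<sigma> (\<lambda>\<zeta>. cnj (fst \<zeta>) * J f \<zeta>) (\<lambda>\<zeta>. cnj (fst \<zeta>) * J g \<zeta>)"
    by (intro L2_inner_cong_AE unshift J_L2 cnj_fst_L2 f g)
  also have "\<dots> = L2_inner \<sigma> (J f) (J g)"
    unfolding L2_inner_def
  proof (rule Bochner_Integration.integral_cong[OF refl])
    fix \<zeta> assume "\<zeta> \<in> space \<sigma>"
    then have "fst \<zeta> * cnj (fst \<zeta>) = 1"
      using complex_norm_square[of "fst \<zeta>"] by (simp add: space_clark torus_mem)
    moreover have "cnj (fst \<zeta>) * J f \<zeta> * cnj (cnj (fst \<zeta>) * J g \<zeta>) =
        (fst \<zeta> * cnj (fst \<zeta>)) * (J f \<zeta> * cnj (J g \<zeta>))" by (simp add: mult_ac)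
    ultimately show "cnj (fst \<zeta>) * J f \<zeta> * cnj (cnj (fst \<zeta>) * J g \<zeta>) = J f \<zeta> * cnj (J g \<zeta>)" by simp
  qed
  finally show ?thesis by (simp add: J_inner f g)
qed

text \<open>The conjugate coordinate passes to the kernel as \<zeta>1, and the factor w1 enters
  there conjugated; \<open>szego_kernel_shift\<close> then leaves two pairings, evaluated by
  \<open>J_reproducing\<close> at w and at (0, w2). Keeping w1 as a factor covers w1 = 0.\<close>

lemma unshift_formula:
  assumes g: "g \<in> model_space \<phi>" and w: "w \<in> bidisk"
  shows "fst w * unshift g w =
    g w - (1 - cnj \<alpha> * \<phi> w) * (g (0, snd w) / (1 - cnj \<alpha> * \<phi> (0, snd w)))"
proof -
  have w0: "(0, snd w) \<in> bidisk" using w by (simp add: bidisk_mem)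
  note L = szego_clark_L2[OF w] szego_clark_L2[OF w0] J_L2[OF g]
  have "L2_inner \<sigma> (J (unshift g)) (szego_kernel w) = L2_inner \<sigma> (\<lambda>\<zeta>. cnj (fst \<zeta>) * J g \<zeta>) (szego_kernel w)"
    by (intro L2_inner_cong_AE unshift J_L2 cnj_fst_L2 g L) simp
  then have "fst w * L2_inner \<sigma> (J (unshift g)) (szego_kernel w) =
      L2_inner \<sigma> (J g) (\<lambda>\<zeta>. cnj (fst w) * (fst \<zeta> * szego_kernel w \<zeta>))"
    by (simp add: L2_inner_def mult_ac flip: integral_mult_right_zero)
  also have "\<dots> = L2_inner \<sigma> (J g) (\<lambda>\<zeta>. szego_kernel w \<zeta> - szego_kernel (0, snd w) \<zeta>)"
    unfolding L2_inner_def
    by (rule Bochner_Integration.integral_cong) (simp_all add: szego_kernel_shift w space_clark)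
  also have "\<dots> = L2_inner \<sigma> (J g) (szego_kernel w) - L2_inner \<sigma> (J g) (szego_kernel (0, snd w))"
    by (rule L2_inner_diff_right[OF L])
  finally have *: "fst w * L2_inner \<sigma> (J (unshift g)) (szego_kernel w) =
      L2_inner \<sigma> (J g) (szego_kernel w) - L2_inner \<sigma> (J g) (szego_kernel (0, snd w))" .
  have "fst w * unshift g w = (1 - cnj \<alpha> * \<phi> w) * (fst w * L2_inner \<sigma> (J (unshift g)) (szego_kernel w))"
    using J_reproducing[OF unshift(1)[OF g] w] by simp
  also have "\<dots> = g w - (1 - cnj \<alpha> * \<phi> w) * L2_inner \<sigma> (J g) (szego_kernel (0, snd w))"
    unfolding * using J_reproducing[OF g w] by (simp add: right_diff_distrib)
  also have "L2_inner \<sigma> (J g) (szego_kernel (0, snd w)) = g (0, snd w) / (1 - cnj \<alpha> * \<phi> (0, snd w))"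
    using J_reproducing[OF g w0] denominator_nonzero[OF w0] by (simp add: field_simps)
  finally show ?thesis .
qed

text \<open>z1 f vanishes at z1 = 0, so the correction term of the formula disappears and z1 can be
  cancelled.\<close>

lemma unshift_shift1:
  assumes f: "f \<in> model_space \<phi>" and sf: "shift1 f \<in> model_space \<phi>"
  shows "unshift (shift1 f) = f"
proof (rule shift1_inj)
  note u = model_spaceD(1)[OF unshift(1)[OF sf]]
  show "unshift (shift1 f) \<in> H2" by (rule u)
  show "f \<in> H2" by (rule model_spaceD(1)[OF f])
  show "shift1 (unshift (shift1 f)) = shift1 f"
  proof
    fix z show "shift1 (unshift (shift1 f)) z = shift1 f z"
      using unshift_formula[OF sf, of z] H2_outside[OF u, of z] H2_outside[OF model_spaceD(1)[OF f], of z]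
      by (cases "z \<in> bidisk") (simp_all add: shift1_def)
  qed
qed

lemma unshift_theta1:
  assumes g: "g \<in> model_space \<phi>" and w: "w \<in> bidisk" "fst w \<noteq> 0"
  shows "unshift g w - bshift1 g w = theta1 \<phi> \<alpha> w * slice g w"
proof -
  have d: "1 - cnj \<alpha> * \<phi> (0, snd w) \<noteq> 0"
    using w by (intro denominator_nonzero) (simp add: bidisk_mem)
  have "fst w * (unshift g w - bshift1 g w) =
      g (0, snd w) - (1 - cnj \<alpha> * \<phi> w) * (g (0, snd w) / (1 - cnj \<alpha> * \<phi> (0, snd w)))"
    by (simp add: right_diff_distrib unshift_formula[OF g w(1)] bshift1_identity[OF model_spaceD(1)[OF g] w(1)])
  \<comment> \<open>The two denominators \<open>1 - cnj \<alpha> * \<phi> (0, snd w)\<close> and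
    \<open>1 - cnj \<alpha> * \<phi> w\<close> differ by the conjugate of \<alpha> times the
    increment of \<phi>, the numerator of the difference quotient.\<close>
  also have "\<dots> = fst w * (theta1 \<phi> \<alpha> w * slice g w)"
    using w d by (simp add: theta1_def backward_shift1_def slice_def on_bidisk_def divide_simps) (simp add: algebra_simps)
  finally show ?thesis using w(2) by simp
qed

text \<open>On a dilated torus the first coordinate is nonzero, so only the quotient branch of
  \<open>backward_shift1\<close> occurs and \<theta> is a rational expression in the dilates of
  \<phi> and \<open>slice \<phi>\<close>.\<close>

lemma theta1_radial_measurable: "radial n (theta1 \<phi> \<alpha>) \<in> borel_measurable torus_measure"
proof -
  obtain c where c: "has_taylor \<phi> c" using inner_function_taylor[OF \<phi>] .
  note [measurable] = L2_measurable[OF has_taylor_radial_L2[OF c, of n]]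
    L2_measurable[OF has_taylor_radial_L2[OF has_taylor_slice[OF c], of n]]
  have "(\<lambda>\<zeta>. cnj \<alpha> * ((radial n \<phi> \<zeta> - radial n (slice \<phi>) \<zeta>) / (of_real (radius n) * fst \<zeta>) / (1 - cnj \<alpha> * radial n (slice \<phi>) \<zeta>)))
     \<in> borel_measurable torus_measure" by measurable
  also have "?this \<longleftrightarrow> ?thesis"
  proof (rule measurable_cong)
    fix \<zeta> assume "\<zeta> \<in> space torus_measure"
    then have \<zeta>: "\<zeta> \<in> torus" by (simp add: space_torus_measure)
    then have "slice \<phi> (dilate (radius n) \<zeta>) = \<phi> (0, snd (dilate (radius n) \<zeta>))"
      by (simp add: slice_def on_bidisk_def dilate_bidisk radius_bounds)
    moreover have "fst (dilate (radius n) \<zeta>) = of_real (radius n) * fst \<zeta>" "fst (dilate (radius n) \<zeta>) \<noteq> 0"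
      using \<zeta> radius_bounds(2)[of n] by (auto simp: dilate_def torus_mem)
    ultimately show "cnj \<alpha> * ((radial n \<phi> \<zeta> - radial n (slice \<phi>) \<zeta>) / (of_real (radius n) * fst \<zeta>) / (1 - cnj \<alpha> * radial n (slice \<phi>) \<zeta>))
       = radial n (theta1 \<phi> \<alpha>) \<zeta>"
      by (simp add: radial_def theta1_def backward_shift1_def)
  qed
  finally show ?thesis .
qed

section \<open>Radial limits of the conjugate of \<theta> times f\<close>

context
  fixes \<Theta> F f C
  assumes bd: "\<And>z. z \<in> bidisk \<Longrightarrow> cmod (theta1 \<phi> \<alpha> z) \<le> C"
    and \<Theta>: "boundary_values (theta1 \<phi> \<alpha>) \<Theta>"
    and f: "f \<in> H2" and F: "boundary_values f F"
begin

lemma C_nonneg: "C \<ge> 0"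
  using order_trans[OF norm_ge_zero bd[of "(0,0)"]] by (simp add: bidisk_mem)

lemma theta1_radial_bound: "\<zeta> \<in> torus \<Longrightarrow> cmod (radial n (theta1 \<phi> \<alpha>) \<zeta>) \<le> C"
  by (simp add: radial_def bd dilate_bidisk radius_bounds)

lemma Theta_measurable: "\<Theta> \<in> borel_measurable torus_measure"
  using \<Theta> by (simp add: boundary_values_def)

lemma Theta_bound: "AE \<zeta> in torus_measure. cmod (\<Theta> \<zeta>) \<le> C"
  using boundary_values_radial[OF \<Theta>]
proof (rule AE_mp, intro AE_I2 impI)
  fix \<zeta> assume "\<zeta> \<in> space torus_measure" and "(\<lambda>n. radial n (theta1 \<phi> \<alpha>) \<zeta>) \<longlonglongrightarrow> \<Theta> \<zeta>"
  then show "cmod (\<Theta> \<zeta>) \<le> C"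
    by (intro LIMSEQ_le_const2[OF tendsto_norm]) (auto simp: space_torus_measure theta1_radial_bound)
qed

lemma Theta_mult_L2: "(\<lambda>\<zeta>. cnj (\<Theta> \<zeta>) * F \<zeta>) \<in> L2 torus_measure"
  using Theta_bound C_nonneg
  by (intro L2_mult_bounded(1)[OF boundary_values_L2(1)[OF f F], where C = C])
    (auto intro: borel_measurable_cnj Theta_measurable)

lemma radial_theta1_mult_L2: "(\<lambda>\<zeta>. cnj (radial n (theta1 \<phi> \<alpha>) \<zeta>) * radial n f \<zeta>) \<in> L2 torus_measure"
  using C_nonneg
  by (intro L2_mult_bounded(1)[OF has_taylor_radial_L2[OF H2_taylor[OF f]], where C = C])
    (auto intro!: borel_measurable_cnj theta1_radial_measurable simp: space_torus_measure theta1_radial_bound)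

text \<open>The error splits into (conjugate difference of \<Theta> and the dilated \<theta>) times
  the dilated f, plus the conjugate of \<Theta> times (F minus the dilated f). The first part has
  multipliers bounded by \<open>2 * C\<close> that tend to 0, the second is at most \<open>C\<close>
  times a norm tending to 0.\<close>

lemma radial_theta1_mult_tendsto:
  "(\<lambda>n. L2_norm torus_measure (\<lambda>\<zeta>. cnj (\<Theta> \<zeta>) * F \<zeta> - cnj (radial n (theta1 \<phi> \<alpha>) \<zeta>) * radial n f \<zeta>)) \<longlonglongrightarrow> 0"
proof -
  define D where "D n \<zeta> = radial n (theta1 \<phi> \<alpha>) \<zeta>" for n \<zeta>
  define m where "m n \<zeta> = cnj (\<Theta> \<zeta>) - cnj (D n \<zeta>)" for n \<zeta>
  note FL = boundary_values_L2[OF f F]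
  have df: "radial n f \<in> L2 torus_measure" for n by (rule has_taylor_radial_L2[OF H2_taylor[OF f]])
  have mm: "m n \<in> borel_measurable torus_measure" for n
    unfolding m_def[abs_def] D_def using Theta_measurable theta1_radial_measurable by measurable
  have mb: "AE \<zeta> in torus_measure. cmod (m n \<zeta>) \<le> 2 * C" for n
    using Theta_bound
  proof (rule AE_mp, intro AE_I2 impI)
    fix \<zeta> assume "\<zeta> \<in> space torus_measure" "cmod (\<Theta> \<zeta>) \<le> C"
    then show "cmod (m n \<zeta>) \<le> 2 * C"
      using norm_triangle_ineq4[of "cnj (\<Theta> \<zeta>)" "cnj (D n \<zeta>)"] theta1_radial_bound[of \<zeta> n]
      by (simp add: m_def D_def space_torus_measure)
  qed
  have ml: "AE \<zeta> in torus_measure. (\<lambda>n. m n \<zeta>) \<longlonglongrightarrow> 0"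
    using boundary_values_radial[OF \<Theta>]
  proof eventually_elim
    case (elim \<zeta>)
    then have "(\<lambda>n. m n \<zeta>) \<longlonglongrightarrow> cnj (\<Theta> \<zeta>) - cnj (\<Theta> \<zeta>)"
      unfolding m_def D_def by (intro tendsto_intros)
    then show ?case by simp
  qed
  have 1: "(\<lambda>n. L2_norm torus_measure (\<lambda>\<zeta>. m n \<zeta> * radial n f \<zeta>)) \<longlonglongrightarrow> 0"
    using C_nonneg by (intro L2_Cauchy_mult_tendsto_0[OF radial_Cauchy[OF f] mm mb ml]) simp
  have 2: "(\<lambda>n. C * L2_norm torus_measure (\<lambda>\<zeta>. F \<zeta> - radial n f \<zeta>)) \<longlonglongrightarrow> 0"
    using tendsto_mult_left[OF FL(2), of C] by (simp add: L2_norm_minus_commute[of _ F])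
  show ?thesis
  proof (rule tendsto_sandwich[OF _ _ tendsto_const])
    show "\<forall>\<^sub>F n in sequentially. 0 \<le> L2_norm torus_measure
       (\<lambda>\<zeta>. cnj (\<Theta> \<zeta>) * F \<zeta> - cnj (radial n (theta1 \<phi> \<alpha>) \<zeta>) * radial n f \<zeta>)"
      by (simp add: L2_norm_nonneg)
    show "(\<lambda>n. L2_norm torus_measure (\<lambda>\<zeta>. m n \<zeta> * radial n f \<zeta>)
        + C * L2_norm torus_measure (\<lambda>\<zeta>. F \<zeta> - radial n f \<zeta>)) \<longlonglongrightarrow> 0"
      using tendsto_add[OF 1 2] by simp
    show "\<forall>\<^sub>F n in sequentially. L2_norm torus_measure
       (\<lambda>\<zeta>. cnj (\<Theta> \<zeta>) * F \<zeta> - cnj (radial n (theta1 \<phi> \<alpha>) \<zeta>) * radial n f \<zeta>)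
       \<le> L2_norm torus_measure (\<lambda>\<zeta>. m n \<zeta> * radial n f \<zeta>) + C * L2_norm torus_measure (\<lambda>\<zeta>. F \<zeta> - radial n f \<zeta>)"
    proof (intro always_eventually allI)
      fix n
      have L: "(\<lambda>\<zeta>. F \<zeta> - radial n f \<zeta>) \<in> L2 torus_measure" by (intro L2_diff FL df)
      have T: "AE \<zeta> in torus_measure. cmod (cnj (\<Theta> \<zeta>)) \<le> C" using Theta_bound by simp
      note B = L2_mult_bounded[OF L borel_measurable_cnj[OF Theta_measurable] T C_nonneg]
      have "L2_norm torus_measure (\<lambda>\<zeta>. cnj (\<Theta> \<zeta>) * F \<zeta> - cnj (radial n (theta1 \<phi> \<alpha>) \<zeta>) * radial n f \<zeta>)
        = L2_norm torus_measure (\<lambda>\<zeta>. m n \<zeta> * radial n f \<zeta> + cnj (\<Theta> \<zeta>) * (F \<zeta> - radial n f \<zeta>))"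
        by (simp add: m_def D_def algebra_simps)
      also have "\<dots> \<le> L2_norm torus_measure (\<lambda>\<zeta>. m n \<zeta> * radial n f \<zeta>)
          + L2_norm torus_measure (\<lambda>\<zeta>. cnj (\<Theta> \<zeta>) * (F \<zeta> - radial n f \<zeta>))"
        using C_nonneg by (intro L2_norm_triangle B(1) L2_mult_bounded(1)[OF df mm mb]) simp
      also have "\<dots> \<le> L2_norm torus_measure (\<lambda>\<zeta>. m n \<zeta> * radial n f \<zeta>)
          + C * L2_norm torus_measure (\<lambda>\<zeta>. F \<zeta> - radial n f \<zeta>)"
        using B(2) by simp
      finally show "L2_norm torus_measure (\<lambda>\<zeta>. cnj (\<Theta> \<zeta>) * F \<zeta> - cnj (radial n (theta1 \<phi> \<alpha>) \<zeta>) * radial n f \<zeta>)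
        \<le> L2_norm torus_measure (\<lambda>\<zeta>. m n \<zeta> * radial n f \<zeta>) + C * L2_norm torus_measure (\<lambda>\<zeta>. F \<zeta> - radial n f \<zeta>)" .
    qed
  qed
qed

text \<open>The factor \<theta> moves to the other side on each dilated torus, where its product
  with \<open>slice g\<close> equals the dilated \<open>q\<close>, an element of \<open>H2\<close>.
  The left pairing converges to that of the projection with g, the right one to that of f with
  \<open>q\<close>.\<close>

lemma proj_inner:
  assumes g: "g \<in> model_space \<phi>"
  shows "H2_inner (proj_H2_2 (\<lambda>\<zeta>. cnj (\<Theta> \<zeta>) * F \<zeta>)) g = H2_inner f (\<lambda>z. unshift g z - bshift1 g z)"
proof -
  define G where "G \<zeta> = cnj (\<Theta> \<zeta>) * F \<zeta>" for \<zeta>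
  define E where "E n \<zeta> = cnj (radial n (theta1 \<phi> \<alpha>) \<zeta>) * radial n f \<zeta>" for n \<zeta>
  define q where "q z = unshift g z - bshift1 g z" for z
  define c where "c = slice_coeff (\<lambda>p. L2_inner torus_measure G (monomial p))"
  have G: "G \<in> L2 torus_measure" and E: "E n \<in> L2 torus_measure" for n
    using Theta_mult_L2 radial_theta1_mult_L2 by (simp_all add: G_def[abs_def] E_def[abs_def])
  note proj = proj_H2_2_power_series[OF G, folded c_def]
  have gH: "g \<in> H2" by (rule model_spaceD(1)[OF g])
  have u: "slice g \<in> H2" "slice_coeff (taylor (slice g)) = taylor (slice g)"
    using gH by (simp_all add: slice_H2 taylor_slice slice_coeff_def fun_eq_iff)
  have q: "q \<in> H2"
    unfolding q_def[abs_def] by (intro H2_diff bshift1_H2 gH model_spaceD(1)[OF unshift(1)[OF g]])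
  have du: "radial n (slice g) \<in> L2 torus_measure" for n by (rule has_taylor_radial_L2[OF H2_taylor[OF u(1)]])
  \<comment> \<open>The coefficients \<open>c\<close> vanish off \<open>fst p = 0\<close>, so g
    contributes only through its slice.\<close>
  have "H2_inner (proj_H2_2 G) g = L2_inner ell2 c (taylor (slice g))"
    unfolding proj(3) H2_inner_ell2 taylor_power_series[OF proj(1)] taylor_slice[OF gH] L2_inner_def
    by (rule Bochner_Integration.integral_cong) (auto simp: c_def slice_coeff_def)
  moreover have "(\<lambda>n. L2_inner torus_measure G (radial n (slice g))) \<longlonglongrightarrow> L2_inner ell2 c (taylor (slice g))"
    unfolding proj(2)[OF u]
    by (intro L2_inner_tendsto_right radial_coeff_L2 radial_coeff_tendsto H2_taylor_L2 u(1) proj(1))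
  moreover have "(\<lambda>n. L2_inner torus_measure (\<lambda>\<zeta>. G \<zeta> - E n \<zeta>) (radial n (slice g))) \<longlonglongrightarrow> 0"
  proof (rule Lim_null_comparison)
    show "\<forall>\<^sub>F n in sequentially. norm (L2_inner torus_measure (\<lambda>\<zeta>. G \<zeta> - E n \<zeta>) (radial n (slice g)))
       \<le> L2_norm torus_measure (\<lambda>\<zeta>. G \<zeta> - E n \<zeta>) * H2_norm (slice g)"
      by (intro always_eventually allI order_trans[OF L2_Cauchy_Schwarz[OF L2_diff[OF G E] du]]
          mult_left_mono radial_norm_le u(1) L2_norm_nonneg)
    show "(\<lambda>n. L2_norm torus_measure (\<lambda>\<zeta>. G \<zeta> - E n \<zeta>) * H2_norm (slice g)) \<longlonglongrightarrow> 0"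
      using tendsto_mult_right[OF radial_theta1_mult_tendsto, of "H2_norm (slice g)"]
      by (simp add: G_def E_def)
  qed
  moreover have "L2_inner torus_measure (\<lambda>\<zeta>. G \<zeta> - E n \<zeta>) (radial n (slice g)) =
     L2_inner torus_measure G (radial n (slice g)) - L2_inner torus_measure (radial n f) (radial n q)" for n
  proof -
    have "L2_inner torus_measure (E n) (radial n (slice g)) = L2_inner torus_measure (radial n f) (radial n q)"
      unfolding L2_inner_def
    proof (rule Bochner_Integration.integral_cong[OF refl])
      fix \<zeta> assume "\<zeta> \<in> space torus_measure"
      then have "dilate (radius n) \<zeta> \<in> bidisk" "fst (dilate (radius n) \<zeta>) \<noteq> 0"
        using radius_bounds[of n] by (auto simp: space_torus_measure torus_mem dilate_def intro: dilate_bidisk[unfolded dilate_def])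
      from unshift_theta1[OF g this]
      show "E n \<zeta> * cnj (radial n (slice g) \<zeta>) = radial n f \<zeta> * cnj (radial n q \<zeta>)"
        by (simp add: E_def radial_def q_def)
    qed
    then show ?thesis by (simp add: L2_inner_diff_left G E du)
  qed
  ultimately have 1: "(\<lambda>n. L2_inner torus_measure G (radial n (slice g))) \<longlonglongrightarrow> H2_inner (proj_H2_2 G) g"
    and 2: "(\<lambda>n. L2_inner torus_measure G (radial n (slice g)) - L2_inner torus_measure (radial n f) (radial n q)) \<longlonglongrightarrow> 0"
    by simp_all
  have "(\<lambda>n. L2_inner torus_measure (radial n f) (radial n q)) \<longlonglongrightarrow> H2_inner (proj_H2_2 G) g"
    using tendsto_diff[OF 1 2] by simp
  then have "H2_inner (proj_H2_2 G) g = H2_inner f q"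
    using radial_inner_tendsto[OF f q] by (rule LIMSEQ_unique)
  then show ?thesis by (simp add: G_def[abs_def] q_def[abs_def])
qed

end

end

theorem theorem4p9:
  fixes \<phi> :: "complex \<times> complex \<Rightarrow> complex"
    and \<alpha> :: complex
    and \<sigma> :: "(complex \<times> complex) measure"
    and J :: "(complex \<times> complex \<Rightarrow> complex) \<Rightarrow> complex \<times> complex \<Rightarrow> complex"
    and \<Theta> :: "complex \<times> complex \<Rightarrow> complex"
  assumes "inner_function \<phi>"
    and "\<not> \<phi> constant_on bidisk"
    and "\<alpha> \<in> sphere 0 1"
    and "clark_measure \<phi> \<alpha> \<sigma>"
    and "clark_embedding \<phi> \<alpha> \<sigma> J"
    and "clark_surjective \<phi> \<sigma> J"
    and "bounded (theta1 \<phi> \<alpha> ` bidisk)"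
    and "on_bidisk (\<lambda>z. 1 / (1 - cnj \<alpha> * \<phi> (0, snd z))) \<in> H2_2"
    and "boundary_values (theta1 \<phi> \<alpha>) \<Theta>"
  shows "\<forall>f\<in>S1_max \<phi>. \<forall>F. boundary_values f F \<longrightarrow>
           proj_model \<phi> (proj_H2_2 (\<lambda>\<zeta>. cnj (\<Theta> \<zeta>) * F \<zeta>)) = (\<lambda>z. 0)"
proof (intro ballI allI impI)
  fix f F assume fS: "f \<in> S1_max \<phi>" and F: "boundary_values f F"
  note A = assms(1-6)
  obtain C where C: "\<And>z. z \<in> bidisk \<Longrightarrow> cmod (theta1 \<phi> \<alpha> z) \<le> C"
    using assms(7) unfolding bounded_iff by blast
  \<comment> \<open>Invariance enters here: f and z1 f both lie in the model space, so
    \<open>unshift\<close> undoes the shift on f.\<close>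
  note f = S1_maxD[OF assms(1) fS]
  have fH: "f \<in> H2" by (rule model_spaceD(1)[OF f(1)])
  let ?p = "proj_H2_2 (\<lambda>\<zeta>. cnj (\<Theta> \<zeta>) * F \<zeta>)"
  show "proj_model \<phi> ?p = (\<lambda>z. 0)"
  proof (rule proj_model_eq_0[OF assms(1)])
    have "(\<lambda>\<zeta>. cnj (\<Theta> \<zeta>) * F \<zeta>) \<in> L2 torus_measure"
      using Theta_mult_L2[OF A C assms(9) fH F] .
    then show "?p \<in> H2" by (simp add: proj_H2_2_power_series power_series_H2)
    fix g assume g: "g \<in> model_space \<phi>"
    have gH: "g \<in> H2" by (rule model_spaceD(1)[OF g])
    let ?V = "unshift \<phi> \<sigma> J"
    have "H2_inner ?p g = H2_inner f (\<lambda>z. ?V g z - bshift1 g z)"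
      by (rule proj_inner[OF A C assms(9) fH F g])
    also have "\<dots> = H2_inner f (?V g) - H2_inner (shift1 f) g"
      by (simp add: H2_inner_diff_right model_spaceD(1)[OF unshift(1)[OF A g]] bshift1_H2 gH fH shift1_adjoint)
    also have "H2_inner f (?V g) = H2_inner (?V (shift1 f)) (?V g)"
      by (simp only: unshift_shift1[OF A f])
    also have "\<dots> = H2_inner (shift1 f) g"
      by (rule unshift_isometry[OF A f(2) g])
    finally show "H2_inner ?p g = 0" by simp
  qed
qed

end
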